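(* Let $\Bbbk$ be an algebraically closed field, let $A$ be a finite-dimensional $\Bbbk$-algebra, and let $M$ be a finite-dimensional left $A$-module. Then for every indecomposable $A$-module $L$, $$\boldsymbol{d}_M(L)=\dim_\Bbbk \operatorname{Hom}_A(L,M)-\sum_{X\in J_L}a(X)\,\dim_\Bbbk\operatorname{Hom}_A(X,M)+\dim_\Bbbk\operatorname{Hom}_A(\tau^{-1}L,M).$$
   Context: All modules are finite-dimensional left modules. $\mathcal{L}$ denotes a complete set of representatives of the isomorphism classes of indecomposable $A$-modules. By the Krull–Schmidt theorem, for each $A$-module $M$ there is a unique map $\boldsymbol{d}_M\colon\mathcal{L}\to\mathbb{N}_0$ with $M\cong\bigoplus_{L\in\mathcal{L}}L^{(\boldsymbol{d}_M(L))}$; for an indecomposable module $L$, $\boldsymbol{d}_M(L)$ means the value at the representative of $L$ in $\mathcal{L}$, i.e. the multiplicity of $L$ as a direct summand of $M$. The finite subset $J_L\subseteq\mathcal{L}$, the integers $a(X)\ge 1$ ($X\in J_L$) and the module $\tau^{-1}L$ are defined as follows. If $L$ is not injective, let $0\to L\to\bigoplus_{X\in J_L}X^{(a(X))}\to\tau^{-1}L\to 0$ be an almost split sequence (Auslander–Reiten sequence) starting at $L$. If $L$ is injective, write the indecomposable decomposition $L/\operatorname{soc}L\cong\bigoplus_{X\in J_L}X^{(a(X))}$ (so $J_L=\emptyset$ if $L$ is simple injective) and put $\tau^{-1}L=0$. *)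

theory Defs
  imports
    "HOL-Algebra.Algebraic_Closure"
    "Jordan_Normal_Form.Missing_VectorSpace"
begin

text \<open>
  The locales \<^locale>\<open>module\<close> and \<^locale>\<open>algebra\<close> of the library are about commutative rings
  (and commutative algebras) only, so the non-commutative versions are introduced here.
  As for vector spaces in the library, a left \<open>A\<close>-module is a record of type \<open>('a, 'm) module\<close>,
  whose fields \<open>mult\<close> and \<open>one\<close> have no meaning.
  The library's \<^const>\<open>module_hom\<close> and \<^locale>\<open>Module.submodule\<close> do not presuppose commutativity.

  All modules that are quantified over inside a definition (test objects for injectivity and
  for almost split maps, isomorphism classes of indecomposables) have their carriers in the type
  \<open>'m\<close> of the modules under consideration.  This is no restriction over an algebraically closed
  (hence infinite) field \<open>K\<close>: every nonzero finite-dimensional module has the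
  cardinality of \<open>K\<close>, so as soon as one such module has its carrier in \<open>'m\<close>, every
  finite-dimensional module is isomorphic to one with carrier in \<open>'m\<close>.
\<close>

locale fd_algebra = V?: vectorspace K A + R?: ring A for K and A (structure) +
  assumes smult_mult_left:
      "\<lbrakk>c \<in> carrier K; x \<in> carrier A; y \<in> carrier A\<rbrakk> \<Longrightarrow> (c \<odot> x) \<otimes> y = c \<odot> (x \<otimes> y)"
    and smult_mult_right:
      "\<lbrakk>c \<in> carrier K; x \<in> carrier A; y \<in> carrier A\<rbrakk> \<Longrightarrow> x \<otimes> (c \<odot> y) = c \<odot> (x \<otimes> y)"
    and fin_dim_algebra: "V.fin_dim"

locale left_module = A?: ring A + M?: abelian_group M
  for A :: "('a, 'r) ring_scheme" and M :: "('a, 'm, 'z) module_scheme" (structure) +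
  assumes smult_closed:
      "\<lbrakk>a \<in> carrier A; x \<in> carrier M\<rbrakk> \<Longrightarrow> a \<odot> x \<in> carrier M"
    and smult_l_distr:
      "\<lbrakk>a \<in> carrier A; b \<in> carrier A; x \<in> carrier M\<rbrakk> \<Longrightarrow> (a \<oplus>\<^bsub>A\<^esub> b) \<odot> x = a \<odot> x \<oplus> b \<odot> x"
    and smult_r_distr:
      "\<lbrakk>a \<in> carrier A; x \<in> carrier M; y \<in> carrier M\<rbrakk> \<Longrightarrow> a \<odot> (x \<oplus> y) = a \<odot> x \<oplus> a \<odot> y"
    and smult_assoc:
      "\<lbrakk>a \<in> carrier A; b \<in> carrier A; x \<in> carrier M\<rbrakk> \<Longrightarrow> (a \<otimes>\<^bsub>A\<^esub> b) \<odot> x = a \<odot> (b \<odot> x)"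
    and smult_one:
      "x \<in> carrier M \<Longrightarrow> \<one>\<^bsub>A\<^esub> \<odot> x = x"

text \<open>The \<open>K\<close>-vector space underlying an \<open>A\<close>-module.\<close>

definition underlying_space :: "('k, 'a) module \<Rightarrow> ('a, 'm) module \<Rightarrow> ('k, 'm) module" where
  "underlying_space A M =
     \<lparr>carrier = carrier M, monoid.mult = monoid.mult M, one = one M, zero = zero M, add = add M,
      smult = (\<lambda>c x. (c \<odot>\<^bsub>A\<^esub> \<one>\<^bsub>A\<^esub>) \<odot>\<^bsub>M\<^esub> x)\<rparr>"

definition fd_module :: "'k ring \<Rightarrow> ('k, 'a) module \<Rightarrow> ('a, 'm) module \<Rightarrow> bool" where
  "fd_module K A M \<longleftrightarrow> left_module A M \<and> vectorspace.fin_dim K (underlying_space A M)"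

text \<open>
  Elements of \<open>Hom\<^sub>A(M, N)\<close> are made extensional on the carrier of \<open>M\<close>, so that
  equal homomorphisms are equal as HOL functions.
\<close>

definition hom_space ::
    "('k, 'a) module \<Rightarrow> ('a, 'm) module \<Rightarrow> ('a, 'n) module \<Rightarrow> ('k, 'm \<Rightarrow> 'n) module" where
  "hom_space A M N =
     \<lparr>carrier = module_hom A M N \<inter> extensional (carrier M),
      monoid.mult = (\<lambda>f g. \<lambda>x\<in>carrier M. \<zero>\<^bsub>N\<^esub>),
      one = (\<lambda>x\<in>carrier M. \<zero>\<^bsub>N\<^esub>),
      zero = (\<lambda>x\<in>carrier M. \<zero>\<^bsub>N\<^esub>),
      add = (\<lambda>f g. \<lambda>x\<in>carrier M. f x \<oplus>\<^bsub>N\<^esub> g x),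
      smult = (\<lambda>c f. \<lambda>x\<in>carrier M. (c \<odot>\<^bsub>A\<^esub> \<one>\<^bsub>A\<^esub>) \<odot>\<^bsub>N\<^esub> f x)\<rparr>"

definition hom_dim ::
    "'k ring \<Rightarrow> ('k, 'a) module \<Rightarrow> ('a, 'm) module \<Rightarrow> ('a, 'n) module \<Rightarrow> nat" where
  "hom_dim K A M N = vectorspace.dim K (hom_space A M N)"

definition module_iso :: "('k, 'a) module \<Rightarrow> ('a, 'm) module \<Rightarrow> ('a, 'n) module \<Rightarrow> bool" where
  "module_iso A M N \<longleftrightarrow> (\<exists>f \<in> module_hom A M N. bij_betw f (carrier M) (carrier N))"

definition indecomposable :: "('k, 'a) module \<Rightarrow> ('a, 'm) module \<Rightarrow> bool" where
  "indecomposable A M \<longleftrightarrow>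
     carrier M \<noteq> {\<zero>\<^bsub>M\<^esub>} \<and>
     (\<forall>U V. Module.submodule U A M \<and> Module.submodule V A M \<and>
            U \<inter> V = {\<zero>\<^bsub>M\<^esub>} \<and> U <+>\<^bsub>M\<^esub> V = carrier M
        \<longrightarrow> U = {\<zero>\<^bsub>M\<^esub>} \<or> V = {\<zero>\<^bsub>M\<^esub>})"

definition dsum :: "'i set \<Rightarrow> ('i \<Rightarrow> ('a, 'm) module) \<Rightarrow> ('a, 'i \<Rightarrow> 'm) module" where
  "dsum I F =
     \<lparr>carrier = {f \<in> (\<Pi>\<^sub>E i\<in>I. carrier (F i)). finite {i \<in> I. f i \<noteq> \<zero>\<^bsub>F i\<^esub>}},
      monoid.mult = (\<lambda>f g. \<lambda>i\<in>I. \<zero>\<^bsub>F i\<^esub>),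
      one = (\<lambda>i\<in>I. \<zero>\<^bsub>F i\<^esub>),
      zero = (\<lambda>i\<in>I. \<zero>\<^bsub>F i\<^esub>),
      add = (\<lambda>f g. \<lambda>i\<in>I. f i \<oplus>\<^bsub>F i\<^esub> g i),
      smult = (\<lambda>a f. \<lambda>i\<in>I. a \<odot>\<^bsub>F i\<^esub> f i)\<rparr>"

text \<open>
  The direct sum over \<open>Y \<in> \<Y>\<close> of \<open>d Y\<close> copies of \<open>Y\<close>, the copies being indexed by the
  pairs \<open>(Y, i)\<close> with \<open>i < d Y\<close>.  Over \<open>\<Y> = {}\<close> it is the zero module.
\<close>

definition multiple_dsum ::
    "('a, 'm) module set \<Rightarrow> (('a, 'm) module \<Rightarrow> nat) \<Rightarrow> ('a, ('a, 'm) module \<times> nat \<Rightarrow> 'm) module"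
  where "multiple_dsum \<Y> d = dsum (SIGMA Y:\<Y>. {..<d Y}) fst"

definition complete_indecomposables ::
    "'k ring \<Rightarrow> ('k, 'a) module \<Rightarrow> ('a, 'm) module set \<Rightarrow> bool" where
  "complete_indecomposables K A \<L> \<longleftrightarrow>
     (\<forall>Y\<in>\<L>. fd_module K A Y \<and> indecomposable A Y) \<and>
     (\<forall>L :: ('a, 'm) module. fd_module K A L \<and> indecomposable A L \<longrightarrow> (\<exists>!Y. Y \<in> \<L> \<and> module_iso A L Y))"

text \<open>
  The map \<open>\<L> \<rightarrow> \<nat>\<close> of the Krull--Schmidt theorem, and its value at the representative in \<open>\<L>\<close>
  of an arbitrary indecomposable module.  Being a map on \<open>\<L>\<close> is expressed by
  \<^const>\<open>extensional\<close>; without this the description would not be unique.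
\<close>

definition decomposition_vector ::
    "('k, 'a) module \<Rightarrow> ('a, 'm) module set \<Rightarrow> ('a, 'm) module \<Rightarrow> ('a, 'm) module \<Rightarrow> nat" where
  "decomposition_vector A \<L> M =
     (THE d. d \<in> extensional \<L> \<and> module_iso A M (multiple_dsum \<L> d))"

definition representative ::
    "('k, 'a) module \<Rightarrow> ('a, 'm) module set \<Rightarrow> ('a, 'm) module \<Rightarrow> ('a, 'm) module" where
  "representative A \<L> L = (THE Y. Y \<in> \<L> \<and> module_iso A L Y)"

definition multiplicity_in ::
    "('k, 'a) module \<Rightarrow> ('a, 'm) module set \<Rightarrow> ('a, 'm) module \<Rightarrow> ('a, 'm) module \<Rightarrow> nat" where
  "multiplicity_in A \<L> M L = decomposition_vector A \<L> M (representative A \<L> L)"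

definition injective_module :: "'k ring \<Rightarrow> ('k, 'a) module \<Rightarrow> ('a, 'm) module \<Rightarrow> bool" where
  "injective_module K A I \<longleftrightarrow>
     (\<forall>(Y :: ('a, 'm) module) (Z :: ('a, 'm) module) i h.
        fd_module K A Y \<and> fd_module K A Z \<and>
        i \<in> module_hom A Y Z \<and> inj_on i (carrier Y) \<and> h \<in> module_hom A Y I
        \<longrightarrow> (\<exists>h' \<in> module_hom A Z I. \<forall>x \<in> carrier Y. h' (i x) = h x))"

definition simple_submodule :: "('k, 'a) module \<Rightarrow> ('a, 'm) module \<Rightarrow> 'm set \<Rightarrow> bool" where
  "simple_submodule A M S \<longleftrightarrow>
     Module.submodule S A M \<and> S \<noteq> {\<zero>\<^bsub>M\<^esub>} \<and>
     (\<forall>T. Module.submodule T A M \<and> T \<subseteq> S \<longrightarrow> T = {\<zero>\<^bsub>M\<^esub>} \<or> T = S)"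

text \<open>The socle is the sum of all simple submodules, i.e. the submodule generated by their union.\<close>

definition socle :: "('k, 'a) module \<Rightarrow> ('a, 'm) module \<Rightarrow> 'm set" where
  "socle A M = \<Inter> {U. Module.submodule U A M \<and> (\<forall>S. simple_submodule A M S \<longrightarrow> S \<subseteq> U)}"

text \<open>As in \<^const>\<open>rcoset_mult\<close>, a union over representatives avoids choosing one.\<close>

definition quotient_module :: "('a, 'm) module \<Rightarrow> 'm set \<Rightarrow> ('a, 'm set) module" where
  "quotient_module M U =
     \<lparr>carrier = a_rcosets\<^bsub>M\<^esub> U, monoid.mult = (\<lambda>C D. U), one = U, zero = U,
      add = set_add M, smult = (\<lambda>a C. \<Union>x\<in>C. U +>\<^bsub>M\<^esub> (a \<odot>\<^bsub>M\<^esub> x))\<rparr>"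

definition short_exact ::
    "('k, 'a) module \<Rightarrow> ('a, 'l) module \<Rightarrow> ('a, 'e) module \<Rightarrow> ('a, 'n) module \<Rightarrow>
     ('l \<Rightarrow> 'e) \<Rightarrow> ('e \<Rightarrow> 'n) \<Rightarrow> bool" where
  "short_exact A L E N f g \<longleftrightarrow>
     f \<in> module_hom A L E \<and> g \<in> module_hom A E N \<and>
     inj_on f (carrier L) \<and> g ` carrier E = carrier N \<and>
     f ` carrier L = {y \<in> carrier E. g y = \<zero>\<^bsub>N\<^esub>}"

definition split_mono ::
    "('k, 'a) module \<Rightarrow> ('a, 'm) module \<Rightarrow> ('a, 'n) module \<Rightarrow> ('m \<Rightarrow> 'n) \<Rightarrow> bool" where
  "split_mono A M N f \<longleftrightarrow>
     f \<in> module_hom A M N \<and> (\<exists>r \<in> module_hom A N M. \<forall>x \<in> carrier M. r (f x) = x)"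

definition split_epi ::
    "('k, 'a) module \<Rightarrow> ('a, 'm) module \<Rightarrow> ('a, 'n) module \<Rightarrow> ('m \<Rightarrow> 'n) \<Rightarrow> bool" where
  "split_epi A M N g \<longleftrightarrow>
     g \<in> module_hom A M N \<and> (\<exists>s \<in> module_hom A N M. \<forall>y \<in> carrier N. g (s y) = y)"

definition left_almost_split ::
    "'k ring \<Rightarrow> ('k, 'a) module \<Rightarrow> ('a, 'm) module \<Rightarrow> ('a, 'e) module \<Rightarrow> ('m \<Rightarrow> 'e) \<Rightarrow> bool" where
  "left_almost_split K A L E f \<longleftrightarrow>
     f \<in> module_hom A L E \<and> \<not> split_mono A L E f \<and>
     (\<forall>(Z :: ('a, 'm) module) h.
        fd_module K A Z \<and> h \<in> module_hom A L Z \<and> \<not> split_mono A L Z h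
        \<longrightarrow> (\<exists>h' \<in> module_hom A E Z. \<forall>x \<in> carrier L. h' (f x) = h x))"

definition right_almost_split ::
    "'k ring \<Rightarrow> ('k, 'a) module \<Rightarrow> ('a, 'e) module \<Rightarrow> ('a, 'm) module \<Rightarrow> ('e \<Rightarrow> 'm) \<Rightarrow> bool" where
  "right_almost_split K A E N g \<longleftrightarrow>
     g \<in> module_hom A E N \<and> \<not> split_epi A E N g \<and>
     (\<forall>(Z :: ('a, 'm) module) h.
        fd_module K A Z \<and> h \<in> module_hom A Z N \<and> \<not> split_epi A Z N h
        \<longrightarrow> (\<exists>h' \<in> module_hom A Z E. \<forall>z \<in> carrier Z. g (h' z) = h z))"

definition almost_split_sequence ::
    "'k ring \<Rightarrow> ('k, 'a) module \<Rightarrow> ('a, 'm) module \<Rightarrow> ('a, 'e) module \<Rightarrow> ('a, 'm) module \<Rightarrow>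
     ('m \<Rightarrow> 'e) \<Rightarrow> ('e \<Rightarrow> 'm) \<Rightarrow> bool" where
  "almost_split_sequence K A L E N f g \<longleftrightarrow>
     fd_module K A L \<and> fd_module K A E \<and> fd_module K A N \<and>
     short_exact A L E N f g \<and>
     left_almost_split K A L E f \<and> right_almost_split K A E N g"

text \<open>
  \<open>J\<close>, \<open>a\<close> and \<open>N\<close> are the data \<open>J\<^sub>L\<close>, \<open>a(Y)\<close> and \<open>\<tau>\<^sup>-\<^sup>1L\<close> attached to the indecomposable module \<open>L\<close>.
\<close>

definition ar_data ::
    "'k ring \<Rightarrow> ('k, 'a) module \<Rightarrow> ('a, 'm) module set \<Rightarrow> ('a, 'm) module \<Rightarrow>
     ('a, 'm) module set \<Rightarrow> (('a, 'm) module \<Rightarrow> nat) \<Rightarrow> ('a, 'm) module \<Rightarrow> bool" where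
  "ar_data K A \<L> L J a N \<longleftrightarrow>
     finite J \<and> J \<subseteq> \<L> \<and> (\<forall>Y\<in>J. a Y \<ge> 1) \<and> fd_module K A N \<and>
     (if injective_module K A L
      then module_iso A (quotient_module L (socle A L)) (multiple_dsum J a) \<and> carrier N = {\<zero>\<^bsub>N\<^esub>}
      else \<exists>f g. almost_split_sequence K A L (multiple_dsum J a) N f g)"

end

theory Submission
  imports Defs
begin

text \<open>
  For indecomposable \<open>L\<close> let \<open>rad(L, M)\<close> be the space of homomorphisms \<open>L \<rightarrow> M\<close> that are not split
  monomorphisms.  By Fitting's lemma \<open>End(L)\<close> is local, and its residue field is \<open>K\<close> because
  endomorphisms have eigenvalues.  Taking residues of the components of \<open>h : L \<rightarrow> M\<close> in the summands
  isomorphic to \<open>L\<close> maps \<open>Hom(L, M)\<close> onto a power of \<open>K\<close> with kernel \<open>rad(L, M)\<close>, so the multiplicity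
  of \<open>L\<close> in \<open>M\<close> is \<open>dim Hom(L, M) - dim rad(L, M)\<close>; this also gives uniqueness in the Krull--Schmidt
  theorem.

  If \<open>f : L \<rightarrow> E\<close> is left almost split, then \<open>rad(L, M)\<close> is the image of \<open>Hom(E, M)\<close> under composition
  with \<open>f\<close>, and if \<open>N\<close> is the cokernel of \<open>f\<close>, the kernel of this map is \<open>Hom(N, M)\<close>.  For injective
  \<open>L\<close> the map \<open>L \<rightarrow> L / soc L\<close> is left almost split, since a homomorphism from \<open>L\<close> that does not split
  has a nonzero kernel, and any two nonzero submodules of \<open>L\<close> intersect nontrivially.
\<close>

section \<open>Linear algebra\<close>

text \<open>The map \<open>d\<close> ranges over all functions on \<L>, so before uniqueness is
  known \<open>multiple_dsum \<L> d\<close> may have infinitely many nonzero summands. The counting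
  argument therefore allows an infinite index set: it uses that every element has finite support and
  asks for finiteness only of the set of summands isomorphic to \<open>L\<close>. A second
  constraint is typing: the middle term \<open>E\<close> has its carrier in a function type, so it
  is not among the test objects of the almost split property, and \<open>Hom(E, M)\<close> is
  controlled through the summands of \<open>E\<close>. Direct sums are handled by embeddings and
  projections, and a linear map into a product by a finite family of linear maps, so no product
  spaces have to be built. Eigenvalues come from a monic polynomial of least degree that annihilates
  a chosen vector; no determinant occurs.\<close>

lemma linear_mapI:
  assumes "vectorspace K V" "vectorspace K W" "T \<in> module_hom K V W"
  shows "linear_map K V W T"
  using assms unfolding linear_map_def mod_hom_def mod_hom_axioms_def vectorspace_def by auto

lemma subspaceI:
  assumes "vectorspace K V" "U \<subseteq> carrier V" "\<zero>\<^bsub>V\<^esub> \<in> U"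
    and "\<And>u v. u \<in> U \<Longrightarrow> v \<in> U \<Longrightarrow> u \<oplus>\<^bsub>V\<^esub> v \<in> U"
    and "\<And>c u. c \<in> carrier K \<Longrightarrow> u \<in> U \<Longrightarrow> c \<odot>\<^bsub>V\<^esub> u \<in> U"
  shows "subspace K U V"
  using assms unfolding subspace_def LinearCombinations.submodule_def vectorspace_def by auto

lemma subspace_subset: "subspace K U V \<Longrightarrow> U \<subseteq> carrier V"
  by (simp add: subspace_def LinearCombinations.submodule_def)

context vectorspace
begin

lemma is_vs: "vectorspace K V" ..

text \<open>Independence in \<open>U\<close> and in \<open>V\<close> agree for subsets of
  \<open>U\<close>, so the size of independent sets in \<open>U\<close> is bounded by
  \<open>dim\<close>; a maximal one exists and generates \<open>U\<close>.\<close>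

lemma subspace_fin_dim:
  assumes fd: "fin_dim" and U: "subspace K U V"
  shows "vectorspace.fin_dim K (vs U)"
proof -
  interpret U: vectorspace K "vs U" by (rule subspace_is_vs[OF U])
  have UV: "U \<subseteq> carrier V" using U by (rule subspace_subset)
  have li: "U.lin_indpt S = lin_indpt S" if "S \<subseteq> U" for S
    using span_li_not_depend(2)[OF that] U by auto
  let ?P = "\<lambda>S. S \<subseteq> carrier (vs U) \<and> U.lin_indpt S"
  have "\<exists>S. finite S \<and> maximal S ?P"
  proof (rule maximal_exists[of ?P dim "{}"])
    fix S assume "?P S"
    then show "finite S \<and> card S \<le> dim"
      using li_le_dim[OF fd, of S] li[of S] UV by auto
  next
    show "?P {}" by (auto simp: U.lin_dep_def)
  qed
  then obtain S where S: "finite S" "maximal S ?P" by blast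
  have "U.gen_set S" by (rule U.max_li_is_gen) (use S(2) in simp)
  moreover have "S \<subseteq> carrier (vs U)" using S(2) by (simp add: maximal_def)
  ultimately show ?thesis using S(1) unfolding U.fin_dim_def by blast
qed

text \<open>A basis of \<open>U\<close> stays independent in \<open>V\<close>. If it has
  \<open>dim\<close> elements it is already a basis of \<open>V\<close>, which forces
  equality.\<close>

lemma subspace_dim_le:
  assumes fd: "fin_dim" and U: "subspace K U V"
  shows "vectorspace.dim K (vs U) \<le> dim"
    and "vectorspace.dim K (vs U) = dim \<Longrightarrow> U = carrier V"
proof -
  interpret U: vectorspace K "vs U" by (rule subspace_is_vs[OF U])
  have UV: "U \<subseteq> carrier V" using U by (rule subspace_subset)
  obtain B where B: "finite B" "U.basis B"
    using U.finite_basis_exists[OF subspace_fin_dim[OF fd U]] by blast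
  have BU: "B \<subseteq> U" and "U.lin_indpt B" using B(2) by (auto simp: U.basis_def)
  then have li: "lin_indpt B"
    using span_li_not_depend(2)[OF BU] U by auto
  have card: "U.dim = card B" by (rule U.dim_basis[OF B])
  show "U.dim \<le> dim" unfolding card using li_le_dim[OF fd _ li] BU UV by blast
  assume "U.dim = dim"
  then have "basis B" using dim_li_is_basis[OF fd B(1) _ li] card BU UV by auto
  then have "span B = carrier V" by (simp add: basis_def)
  moreover have "span B \<subseteq> U" using span_is_subset[OF BU] U by auto
  ultimately show "U = carrier V" using UV by blast
qed

lemma dim_zero_space: "carrier V = {\<zero>\<^bsub>V\<^esub>} \<Longrightarrow> dim = 0"
proof -
  assume "carrier V = {\<zero>\<^bsub>V\<^esub>}"
  then have "span {\<zero>\<^bsub>V\<^esub>} = carrier V"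
    using span_is_subset2[of "{\<zero>\<^bsub>V\<^esub>}"] in_own_span[of "{\<zero>\<^bsub>V\<^esub>}"] by auto
  then show "dim = 0" by (rule dim0I)
qed

lemma dim_eq_0_imp:
  assumes fd: "fin_dim" and "dim = 0"
  shows "carrier V = {\<zero>\<^bsub>V\<^esub>}"
proof -
  have Z: "subspace K {\<zero>\<^bsub>V\<^esub>} V" by (rule subspaceI[OF is_vs]) auto
  interpret Z: vectorspace K "vs {\<zero>\<^bsub>V\<^esub>}" by (rule subspace_is_vs[OF Z])
  have "Z.dim = 0" by (rule Z.dim_zero_space) simp
  then show ?thesis using subspace_dim_le(2)[OF fd Z] assms by simp
qed

lemma subspace_dim_mono:
  assumes fd: "fin_dim" and U: "subspace K U V" and W: "subspace K W V" and UW: "U \<subseteq> W"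
  shows "vectorspace.dim K (vs U) \<le> vectorspace.dim K (vs W)"
    and "vectorspace.dim K (vs U) = vectorspace.dim K (vs W) \<Longrightarrow> U = W"
proof -
  interpret W: vectorspace K "vs W" by (rule subspace_is_vs[OF W])
  have U': "subspace K U (vs W)"
    by (rule subspaceI[OF W.is_vs]) (use U UW in \<open>auto simp: subspace_def LinearCombinations.submodule_def\<close>)
  note * = W.subspace_dim_le[OF subspace_fin_dim[OF fd W] U']
  show "vectorspace.dim K (vs U) \<le> vectorspace.dim K (vs W)" using *(1) by simp
  show "vectorspace.dim K (vs U) = vectorspace.dim K (vs W) \<Longrightarrow> U = W" using *(2) by simp
qed

end

context linear_map
begin

lemma ker_subspace: "subspace K {v \<in> carrier V. T v = \<zero>\<^bsub>W\<^esub>} V"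
  using kerT_is_subspace by (simp add: ker_def)

lemma im_subspace: "subspace K (T ` carrier V) W"
  using imT_is_subspace by (simp add: im_def)

lemma rank_nullity':
  assumes "V.fin_dim"
  shows "V.dim = vectorspace.dim K (W.vs (T ` carrier V))
    + vectorspace.dim K (V.vs {v \<in> carrier V. T v = \<zero>\<^bsub>W\<^esub>})"
  using rank_nullity[OF assms] by (simp add: ker_def im_def)

lemma image_of_subspace:
  assumes U: "subspace K U V"
  shows "subspace K (T ` U) W"
proof (rule subspaceI)
  have UV: "U \<subseteq> carrier V" using U by (rule subspace_subset)
  note [simp] = subsetD[OF UV]
  interpret U: LinearCombinations.submodule K U V using U by (simp add: subspace_def)
  show "vectorspace K W" ..
  show "T ` U \<subseteq> carrier W" by auto
  show "\<zero>\<^bsub>W\<^esub> \<in> T ` U" using U.zero_closed T0_is_0 by (metis imageI)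
  show "u \<oplus>\<^bsub>W\<^esub> v \<in> T ` U" if u: "u \<in> T ` U" and v: "v \<in> T ` U" for u v
  proof -
    obtain x y where xy: "x \<in> U" "y \<in> U" "u = T x" "v = T y" using u v by blast
    then have "u \<oplus>\<^bsub>W\<^esub> v = T (x \<oplus>\<^bsub>V\<^esub> y)" by simp
    with xy show ?thesis by blast
  qed
  show "c \<odot>\<^bsub>W\<^esub> u \<in> T ` U" if c: "c \<in> carrier K" and u: "u \<in> T ` U" for c u
  proof -
    obtain x where x: "x \<in> U" "u = T x" using u by blast
    then have "c \<odot>\<^bsub>W\<^esub> u = T (c \<odot>\<^bsub>V\<^esub> x)" using c by simp
    with x c show ?thesis by blast
  qed
qed

end

text \<open>Rank and nullity add up to \<open>dim\<close>, so the image is everything exactly when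
  the kernel has dimension 0.\<close>

lemma (in vectorspace) inj_iff_surj_endo:
  assumes fd: "fin_dim" and T: "T \<in> module_hom K V V"
  shows "T ` carrier V = carrier V \<longleftrightarrow> inj_on T (carrier V)"
proof -
  interpret T: linear_map K V V T by (rule linear_mapI[OF is_vs is_vs T])
  show ?thesis
  proof
    assume s: "T ` carrier V = carrier V"
    then have "vectorspace.dim K (vs {v \<in> carrier V. T v = \<zero>\<^bsub>V\<^esub>}) = 0"
      using T.rank_nullity'[OF fd] by simp
    then have "{v \<in> carrier V. T v = \<zero>\<^bsub>V\<^esub>} = {\<zero>\<^bsub>V\<^esub>}"
      using vectorspace.dim_eq_0_imp[OF subspace_is_vs[OF T.ker_subspace]
        subspace_fin_dim[OF fd T.ker_subspace]] by simp
    then show "inj_on T (carrier V)" using T.Ke0_imp_inj by (simp add: T.ker_def)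
  next
    assume "inj_on T (carrier V)"
    then have "vectorspace.dim K (vs {v \<in> carrier V. T v = \<zero>\<^bsub>V\<^esub>}) = 0"
      using T.inj_imp_dim_ker0 by (simp add: T.ker_def)
    then show "T ` carrier V = carrier V"
      using T.rank_nullity'[OF fd] subspace_dim_le(2)[OF fd T.im_subspace] by simp
  qed
qed

text \<open>Rank-nullity presupposes that the source is finite-dimensional; here this is deduced.
  Generators of the kernel together with preimages of generators of the image span
  \<open>V\<close>.\<close>

lemma fin_dim_of_ker_im:
  assumes V: "vectorspace K V" and W: "vectorspace K W" and T: "T \<in> module_hom K V W"
    and im: "vectorspace.fin_dim K W"
    and ker: "vectorspace.fin_dim K (V\<lparr>carrier := {v \<in> carrier V. T v = \<zero>\<^bsub>W\<^esub>}\<rparr>)"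
  shows "vectorspace.fin_dim K V"
proof -
  interpret V: vectorspace K V by fact
  interpret W: vectorspace K W by fact
  interpret T: linear_map K V W T by (rule linear_mapI[OF V W T])
  let ?N = "{v \<in> carrier V. T v = \<zero>\<^bsub>W\<^esub>}"
  interpret N: vectorspace K "V.vs ?N" by (rule V.subspace_is_vs[OF T.ker_subspace])
  interpret I: vectorspace K "W.vs (T ` carrier V)" by (rule W.subspace_is_vs[OF T.im_subspace])
  obtain B where B: "finite B" "B \<subseteq> ?N" "N.span B = ?N"
    using ker unfolding N.fin_dim_def by auto
  have "I.fin_dim" by (rule W.subspace_fin_dim[OF im T.im_subspace])
  then obtain C where C: "finite C" "C \<subseteq> T ` carrier V" "I.span C = T ` carrier V"
    unfolding I.fin_dim_def by auto
  obtain C' where C': "C' \<subseteq> carrier V" "finite C'" "C = T ` C'"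
    using C(1,2) by (metis finite_subset_image)
  have BV: "B \<subseteq> carrier V" using B by blast
  let ?S = "V.span (B \<union> C')"
  have S: "subspace K ?S V" by (rule V.span_is_subspace) (use BV C' in blast)
  interpret S: LinearCombinations.submodule K ?S V using S by (simp add: subspace_def)
  have gens: "B \<union> C' \<subseteq> ?S" by (rule V.in_own_span) (use BV C' in blast)
  have "?N = V.span B"
    using B(3) V.span_li_not_depend(1)[OF B(2)] T.ker_subspace by (simp add: subspace_def)
  then have N: "?N \<subseteq> ?S" using V.span_is_monotone[of B "B \<union> C'"] by auto
  have "W.span C \<subseteq> T ` ?S"
    by (rule W.span_is_subset) (use T.image_of_subspace[OF S] gens C' in \<open>auto simp: subspace_def\<close>)
  moreover have "W.span C = T ` carrier V"
    using C(3) W.span_li_not_depend(1)[OF C(2)] T.im_subspace by (simp add: subspace_def)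
  ultimately have im: "T ` carrier V \<subseteq> T ` ?S" by simp
  have "v \<in> ?S" if v: "v \<in> carrier V" for v
  proof -
    \<comment> \<open>The span already has the full image, so \<open>v\<close> differs from some
      element \<open>s\<close> of the span by an element of the kernel, which lies in the span
      too.\<close>
    obtain s where s: "s \<in> ?S" "T v = T s" using im v by blast
    have sV: "s \<in> carrier V" using s S.subset by blast
    have "v \<ominus>\<^bsub>V\<^esub> s \<in> ?N" using v sV s by simp
    then have "(v \<ominus>\<^bsub>V\<^esub> s) \<oplus>\<^bsub>V\<^esub> s \<in> ?S" using N s by blast
    moreover have "(v \<ominus>\<^bsub>V\<^esub> s) \<oplus>\<^bsub>V\<^esub> s = v" using v sV
      by (simp add: V.minus_eq V.M.a_assoc V.M.l_neg)
    ultimately show ?thesis by simp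
  qed
  then have "?S = carrier V" using S.subset by blast
  then show ?thesis using B(1) C'(2) BV C'(1) unfolding V.fin_dim_def
    by (metis Un_least finite_UnI)
qed

section \<open>Finite families of linear maps and their joint kernels\<close>

lemma joint_kernel_subspace:
  assumes V: "vectorspace K V"
    and W: "\<And>i. i \<in> I \<Longrightarrow> vectorspace K (W i)"
    and T: "\<And>i. i \<in> I \<Longrightarrow> T i \<in> module_hom K V (W i)"
  shows "subspace K {v \<in> carrier V. \<forall>i\<in>I. T i v = \<zero>\<^bsub>W i\<^esub>} V"
proof (rule subspaceI[OF V])
  interpret V: vectorspace K V by fact
  have lm: "linear_map K V (W i) (T i)" if "i \<in> I" for i
    by (rule linear_mapI[OF V W T]) (use that in auto)
  have T0: "T i \<zero>\<^bsub>V\<^esub> = \<zero>\<^bsub>W i\<^esub>" if "i \<in> I" for i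
    using linear_map.T0_is_0[OF lm[OF that]] .
  have Tadd: "T i (u \<oplus>\<^bsub>V\<^esub> v) = \<zero>\<^bsub>W i\<^esub>" if "i \<in> I" "u \<in> carrier V" "v \<in> carrier V"
      "T i u = \<zero>\<^bsub>W i\<^esub>" "T i v = \<zero>\<^bsub>W i\<^esub>" for i u v
  proof -
    interpret linear_map K V "W i" "T i" by (rule lm[OF that(1)])
    show ?thesis using that by simp
  qed
  have Tsm: "T i (c \<odot>\<^bsub>V\<^esub> v) = \<zero>\<^bsub>W i\<^esub>" if "i \<in> I" "c \<in> carrier K" "v \<in> carrier V" "T i v = \<zero>\<^bsub>W i\<^esub>"
    for i c v
  proof -
    interpret linear_map K V "W i" "T i" by (rule lm[OF that(1)])
    show ?thesis using that by simp
  qed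
  show "{v \<in> carrier V. \<forall>i\<in>I. T i v = \<zero>\<^bsub>W i\<^esub>} \<subseteq> carrier V" by blast
  show "\<zero>\<^bsub>V\<^esub> \<in> {v \<in> carrier V. \<forall>i\<in>I. T i v = \<zero>\<^bsub>W i\<^esub>}" using T0 by simp
  show "u \<oplus>\<^bsub>V\<^esub> v \<in> {v \<in> carrier V. \<forall>i\<in>I. T i v = \<zero>\<^bsub>W i\<^esub>}"
    if "u \<in> {v \<in> carrier V. \<forall>i\<in>I. T i v = \<zero>\<^bsub>W i\<^esub>}" "v \<in> {v \<in> carrier V. \<forall>i\<in>I. T i v = \<zero>\<^bsub>W i\<^esub>}" for u v
    using that Tadd by auto
  show "c \<odot>\<^bsub>V\<^esub> u \<in> {v \<in> carrier V. \<forall>i\<in>I. T i v = \<zero>\<^bsub>W i\<^esub>}"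
    if "c \<in> carrier K" "u \<in> {v \<in> carrier V. \<forall>i\<in>I. T i v = \<zero>\<^bsub>W i\<^esub>}" for c u
    using that Tsm by auto
qed 

lemma module_hom_subspace:
  assumes "T \<in> module_hom K V W" "U \<subseteq> carrier V"
  shows "T \<in> module_hom K (V\<lparr>carrier := U\<rparr>) W"
  using assms unfolding module_hom_def by (auto simp: subset_iff)

text \<open>This replaces an embedding of \<open>V\<close> into the product of the
  \<open>W i\<close>. The maps are removed one at a time: the joint kernel for
  \<open>insert j I\<close> is the kernel of \<open>T j\<close> on the joint kernel for
  \<open>I\<close>.\<close>

lemma fin_dim_joint_inj:
  assumes V: "vectorspace K V" and I: "finite I"
    and W: "\<And>i. i \<in> I \<Longrightarrow> vectorspace K (W i)"
    and fd: "\<And>i. i \<in> I \<Longrightarrow> vectorspace.fin_dim K (W i)"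
    and T: "\<And>i. i \<in> I \<Longrightarrow> T i \<in> module_hom K V (W i)"
    and inj: "\<And>v. v \<in> carrier V \<Longrightarrow> (\<And>i. i \<in> I \<Longrightarrow> T i v = \<zero>\<^bsub>W i\<^esub>) \<Longrightarrow> v = \<zero>\<^bsub>V\<^esub>"
  shows "vectorspace.fin_dim K V"
proof -
  interpret V: vectorspace K V by fact
  \<comment> \<open>Joint injectivity is not inherited by subfamilies, so the induction carries an
    implication that makes sense for every subfamily.\<close>
  have "vectorspace.fin_dim K (V\<lparr>carrier := {v \<in> carrier V. \<forall>i\<in>I. T i v = \<zero>\<^bsub>W i\<^esub>}\<rparr>)
    \<longrightarrow> V.fin_dim"
    using I W fd T
  proof (induction I rule: finite_induct)
    case empty then show ?case by simp
  next
    case (insert j I)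
    let ?U = "{v \<in> carrier V. \<forall>i\<in>I. T i v = \<zero>\<^bsub>W i\<^esub>}"
    have U: "subspace K ?U V" by (rule joint_kernel_subspace[OF V]) (use insert.prems in auto)
    interpret U: vectorspace K "V\<lparr>carrier := ?U\<rparr>" by (rule V.subspace_is_vs[OF U])
    interpret L: linear_map K "V\<lparr>carrier := ?U\<rparr>" "W j" "T j"
      by (rule linear_mapI[OF U.is_vs]) (use insert.prems in \<open>auto intro: module_hom_subspace\<close>)
    have eq: "{v \<in> carrier V. \<forall>i\<in>insert j I. T i v = \<zero>\<^bsub>W i\<^esub>} =
      {v \<in> carrier (V\<lparr>carrier := ?U\<rparr>). T j v = \<zero>\<^bsub>W j\<^esub>}" by auto
    show ?case
    proof
      assume "vectorspace.fin_dim K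
        (V\<lparr>carrier := {v \<in> carrier V. \<forall>i\<in>insert j I. T i v = \<zero>\<^bsub>W i\<^esub>}\<rparr>)"
      then have "U.fin_dim" unfolding eq
        using fin_dim_of_ker_im[OF U.is_vs L.W.is_vs L.f_hom] insert.prems(2)[of j] by simp
      then show "V.fin_dim" using insert by auto
    qed
  qed
  moreover have "vectorspace.fin_dim K (V\<lparr>carrier := {v \<in> carrier V. \<forall>i\<in>I. T i v = \<zero>\<^bsub>W i\<^esub>}\<rparr>)"
  proof -
    have U: "subspace K {v \<in> carrier V. \<forall>i\<in>I. T i v = \<zero>\<^bsub>W i\<^esub>} V"
      by (rule joint_kernel_subspace[OF V W T])
    then have eq: "{v \<in> carrier V. \<forall>i\<in>I. T i v = \<zero>\<^bsub>W i\<^esub>} = {\<zero>\<^bsub>V\<^esub>}"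
      using inj by (auto simp: subspace_def LinearCombinations.submodule_def)
    interpret U: vectorspace K "V\<lparr>carrier := {\<zero>\<^bsub>V\<^esub>}\<rparr>"
      using V.subspace_is_vs[OF U] unfolding eq .
    show ?thesis unfolding eq U.fin_dim_def
      using U.span_is_subset2[of "{\<zero>\<^bsub>V\<^esub>}"] U.in_own_span[of "{\<zero>\<^bsub>V\<^esub>}"]
      by (intro exI[of _ "{\<zero>\<^bsub>V\<^esub>}"]) auto
  qed
  ultimately show ?thesis by blast
qed

text \<open>Rank-nullity for the map into the product of the \<open>W i\<close>, again by adding one
  map at a time. Joint surjectivity makes \<open>T j\<close> surjective even on the joint kernel of
  the other maps.\<close>

lemma dim_joint_kernel:
  assumes V: "vectorspace K V" and fdV: "vectorspace.fin_dim K V" and I: "finite I"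
    and W: "\<And>i. i \<in> I \<Longrightarrow> vectorspace K (W i)"
    and T: "\<And>i. i \<in> I \<Longrightarrow> T i \<in> module_hom K V (W i)"
    and surj: "\<And>w. (\<And>i. i \<in> I \<Longrightarrow> w i \<in> carrier (W i)) \<Longrightarrow> \<exists>v\<in>carrier V. \<forall>i\<in>I. T i v = w i"
  shows "vectorspace.dim K V =
    vectorspace.dim K (V\<lparr>carrier := {v \<in> carrier V. \<forall>i\<in>I. T i v = \<zero>\<^bsub>W i\<^esub>}\<rparr>)
      + (\<Sum>i\<in>I. vectorspace.dim K (W i))"
proof -
  interpret V: vectorspace K V by fact
  show ?thesis using I W T surj
  proof (induction I rule: finite_induct)
    case empty then show ?case by simp
  next
    case (insert j I)
    let ?U = "{v \<in> carrier V. \<forall>i\<in>I. T i v = \<zero>\<^bsub>W i\<^esub>}"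
    have U: "subspace K ?U V" by (rule joint_kernel_subspace[OF V]) (use insert.prems in auto)
    interpret U: vectorspace K "V\<lparr>carrier := ?U\<rparr>" by (rule V.subspace_is_vs[OF U])
    interpret L: linear_map K "V\<lparr>carrier := ?U\<rparr>" "W j" "T j"
      by (rule linear_mapI[OF U.is_vs]) (use insert.prems in \<open>auto intro: module_hom_subspace\<close>)
    have eq: "{v \<in> carrier V. \<forall>i\<in>insert j I. T i v = \<zero>\<^bsub>W i\<^esub>} =
      {v \<in> carrier (V\<lparr>carrier := ?U\<rparr>). T j v = \<zero>\<^bsub>W j\<^esub>}" by auto
    have zero: "\<zero>\<^bsub>W i\<^esub> \<in> carrier (W i)" if "i \<in> insert j I" for i
    proof -
      interpret vectorspace K "W i" using insert.prems(1) that by blast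
      show ?thesis by simp
    qed
    have "T j ` carrier (V\<lparr>carrier := ?U\<rparr>) = carrier (W j)"
    proof
      show "carrier (W j) \<subseteq> T j ` carrier (V\<lparr>carrier := ?U\<rparr>)"
      proof
        fix y assume y: "y \<in> carrier (W j)"
        \<comment> \<open>The target is \<open>y\<close> at \<open>j\<close> and zero elsewhere, so
          the preimage lies in the joint kernel of the remaining maps.\<close>
        obtain v where "v \<in> carrier V" "\<forall>i\<in>insert j I. T i v = (if i = j then y else \<zero>\<^bsub>W i\<^esub>)"
          using insert.prems(3)[of "\<lambda>i. if i = j then y else \<zero>\<^bsub>W i\<^esub>"] y zero
          by (metis (no_types, lifting))
        then show "y \<in> T j ` carrier (V\<lparr>carrier := ?U\<rparr>)" using insert.hyps
          by (intro image_eqI[of _ _ v]) (auto split: if_splits)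
      qed
    qed auto
    then have "U.dim = L.W.dim + vectorspace.dim K (V\<lparr>carrier := {v \<in> carrier V. \<forall>i\<in>insert j I. T i v = \<zero>\<^bsub>W i\<^esub>}\<rparr>)"
      using L.rank_nullity'[OF V.subspace_fin_dim[OF fdV U]] unfolding eq by simp
    moreover have "V.dim = U.dim + (\<Sum>i\<in>I. vectorspace.dim K (W i))"
    proof (rule insert.IH)
      fix w assume w: "\<And>i. i \<in> I \<Longrightarrow> w i \<in> carrier (W i)"
      show "\<exists>v\<in>carrier V. \<forall>i\<in>I. T i v = w i"
        using insert.prems(3)[of "\<lambda>i. if i \<in> I then w i else \<zero>\<^bsub>W i\<^esub>"] w zero
        by (smt (verit) insertCI)
    qed (use insert.prems in auto)
    ultimately show ?case using insert.hyps by simp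
  qed
qed

section \<open>Left modules and homomorphisms\<close>

lemma module_homI:
  assumes "\<And>x. x \<in> carrier M \<Longrightarrow> f x \<in> carrier N"
    and "\<And>x y. x \<in> carrier M \<Longrightarrow> y \<in> carrier M \<Longrightarrow> f (x \<oplus>\<^bsub>M\<^esub> y) = f x \<oplus>\<^bsub>N\<^esub> f y"
    and "\<And>a x. a \<in> carrier A \<Longrightarrow> x \<in> carrier M \<Longrightarrow> f (a \<odot>\<^bsub>M\<^esub> x) = a \<odot>\<^bsub>N\<^esub> f x"
  shows "f \<in> module_hom A M N"
  using assms by (auto simp: module_hom_def)

lemma module_hom_in: "f \<in> module_hom A M N \<Longrightarrow> x \<in> carrier M \<Longrightarrow> f x \<in> carrier N"
  by (auto simp: module_hom_def)

lemma module_hom_id: "(\<lambda>x. x) \<in> module_hom A M M"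
  by (auto simp: module_hom_def)

lemma module_hom_comp:
  assumes "f \<in> module_hom A M N" "g \<in> module_hom A N P"
  shows "(\<lambda>x. g (f x)) \<in> module_hom A M P"
  using assms unfolding module_hom_def by (auto simp: Pi_iff)

section \<open>Arithmetic and submodules of a left module\<close>

context left_module
begin

lemma smult_zero_right [simp]: "a \<in> carrier A \<Longrightarrow> a \<odot> \<zero> = \<zero>"
  using smult_r_distr[of a \<zero> \<zero>] smult_closed[of a \<zero>]
  by (metis M.add.l_cancel_one' M.l_zero M.zero_closed)

lemma smult_zero_left [simp]: "x \<in> carrier M \<Longrightarrow> \<zero>\<^bsub>A\<^esub> \<odot> x = \<zero>"
  using smult_l_distr[of "\<zero>\<^bsub>A\<^esub>" "\<zero>\<^bsub>A\<^esub>" x] smult_closed[of "\<zero>\<^bsub>A\<^esub>" x]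
  by (metis M.add.l_cancel_one' A.l_zero A.zero_closed)

lemma smult_minus_one: "x \<in> carrier M \<Longrightarrow> (\<ominus>\<^bsub>A\<^esub> \<one>\<^bsub>A\<^esub>) \<odot> x = \<ominus> x"
proof -
  assume x: "x \<in> carrier M"
  have "(\<ominus>\<^bsub>A\<^esub> \<one>\<^bsub>A\<^esub>) \<odot> x \<oplus> x = (\<ominus>\<^bsub>A\<^esub> \<one>\<^bsub>A\<^esub> \<oplus>\<^bsub>A\<^esub> \<one>\<^bsub>A\<^esub>) \<odot> x"
    using x by (simp only: smult_l_distr smult_one A.one_closed A.a_inv_closed)
  also have "\<dots> = \<zero>" using x by (simp add: A.l_neg)
  finally show ?thesis using x smult_closed by (metis A.a_inv_closed A.one_closed M.minus_equality)
qed

lemma smult_neg: "a \<in> carrier A \<Longrightarrow> x \<in> carrier M \<Longrightarrow> a \<odot> (\<ominus> x) = \<ominus> (a \<odot> x)"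
proof -
  assume a: "a \<in> carrier A" "x \<in> carrier M"
  have "a \<odot> (\<ominus> x) \<oplus> a \<odot> x = \<zero>"
    using a by (simp add: smult_r_distr[symmetric] M.l_neg)
  then show ?thesis using a smult_closed by (metis M.a_inv_closed M.minus_equality)
qed

text \<open>Additive inverses need no separate condition: the action is unital, so
  \<open>\<ominus> x\<close> is the product of \<open>\<ominus> \<one>\<close> and
  \<open>x\<close>.\<close>

lemma submodule_iff:
  "Module.submodule U A M \<longleftrightarrow> U \<subseteq> carrier M \<and> \<zero> \<in> U \<and> (\<forall>x\<in>U. \<forall>y\<in>U. x \<oplus> y \<in> U) \<and>
    (\<forall>a\<in>carrier A. \<forall>x\<in>U. a \<odot> x \<in> U)" (is "_ = ?R")
proof
  assume "Module.submodule U A M"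
  then interpret U: Module.submodule U A M .
  show ?R using U.subset U.one_closed U.m_closed U.smult_closed by auto
next
  assume R: ?R
  show "Module.submodule U A M"
  proof (intro Module.submodule.intro subgroup.intro)
    show "inv\<^bsub>add_monoid M\<^esub> x \<in> U" if "x \<in> U" for x
      using R that smult_minus_one by (metis A.a_inv_closed A.one_closed a_inv_def subsetD)
  qed (use R in \<open>auto simp: Module.submodule_axioms_def\<close>)
qed

lemma submodule_neg:
  assumes U: "Module.submodule U A M" and x: "x \<in> U"
  shows "\<ominus> x \<in> U"
proof -
  have "x \<in> carrier M" "(\<ominus>\<^bsub>A\<^esub> \<one>\<^bsub>A\<^esub>) \<odot> x \<in> U"
    using U x unfolding submodule_iff by auto
  then show ?thesis by (simp add: smult_minus_one)
qed

lemma submodule_minus: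
  assumes "Module.submodule U A M" "x \<in> U" "y \<in> U"
  shows "x \<ominus> y \<in> U"
  using assms submodule_neg[OF assms(1,3)] unfolding submodule_iff M.minus_eq by auto

lemma submodule_self: "Module.submodule (carrier M) A M"
  by (auto simp: submodule_iff smult_closed)

lemma submodule_Int:
  "Module.submodule U A M \<Longrightarrow> Module.submodule V A M \<Longrightarrow> Module.submodule (U \<inter> V) A M"
  by (auto simp: submodule_iff)

lemma add_sum_iff:
  "x \<in> U <+>\<^bsub>M\<^esub> V \<longleftrightarrow> (\<exists>u\<in>U. \<exists>v\<in>V. x = u \<oplus> v)"
  by (auto simp: set_add_def set_mult_def)

lemma submodule_sum:
  assumes "Module.submodule U A M" "Module.submodule V A M"
  shows "Module.submodule (U <+>\<^bsub>M\<^esub> V) A M"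
proof -
  have U: "U \<subseteq> carrier M" "\<zero> \<in> U" "\<And>x y. x \<in> U \<Longrightarrow> y \<in> U \<Longrightarrow> x \<oplus> y \<in> U" 
    "\<And>a x. a \<in> carrier A \<Longrightarrow> x \<in> U \<Longrightarrow> a \<odot> x \<in> U" 
    and V: "V \<subseteq> carrier M" "\<zero> \<in> V" "\<And>x y. x \<in> V \<Longrightarrow> y \<in> V \<Longrightarrow> x \<oplus> y \<in> V" 
    "\<And>a x. a \<in> carrier A \<Longrightarrow> x \<in> V \<Longrightarrow> a \<odot> x \<in> V"
    using assms by (auto simp: submodule_iff)
  show ?thesis unfolding submodule_iff
  proof (intro conjI ballI)
    show "U <+>\<^bsub>M\<^esub> V \<subseteq> carrier M" using U(1) V(1) by (auto simp: add_sum_iff subset_iff)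
    show "\<zero> \<in> U <+>\<^bsub>M\<^esub> V" using U V by (force simp: add_sum_iff)
  next
    fix x y assume "x \<in> U <+>\<^bsub>M\<^esub> V" "y \<in> U <+>\<^bsub>M\<^esub> V"
    then obtain u v u' v' where *: "u \<in> U" "v \<in> V" "x = u \<oplus> v" "u' \<in> U" "v' \<in> V" "y = u' \<oplus> v'"
      by (auto simp: add_sum_iff)
    have c: "u \<in> carrier M" "v \<in> carrier M" "u' \<in> carrier M" "v' \<in> carrier M"
      using * U(1) V(1) by blast+
    have "x \<oplus> y = (u \<oplus> u') \<oplus> (v \<oplus> v')" unfolding *(3,6) using c
      by (simp add: M.a_ac)
    moreover have "u \<oplus> u' \<in> U" "v \<oplus> v' \<in> V" using * U(3) V(3) by auto
    ultimately show "x \<oplus> y \<in> U <+>\<^bsub>M\<^esub> V" unfolding add_sum_iff by blast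
  next
    fix a x assume a: "a \<in> carrier A" and "x \<in> U <+>\<^bsub>M\<^esub> V"
    then obtain u v where *: "u \<in> U" "v \<in> V" "x = u \<oplus> v" by (auto simp: add_sum_iff)
    then have "a \<odot> x = a \<odot> u \<oplus> a \<odot> v" using a U(1) V(1) by (simp add: smult_r_distr subset_iff)
    moreover have "a \<odot> u \<in> U" "a \<odot> v \<in> V" using * a U(4) V(4) by auto
    ultimately show "a \<odot> x \<in> U <+>\<^bsub>M\<^esub> V" unfolding add_sum_iff by blast
  qed
qed

lemma submodule_in_sum:
  assumes "Module.submodule U A M" "Module.submodule V A M"
  shows "U \<subseteq> U <+>\<^bsub>M\<^esub> V" "V \<subseteq> U <+>\<^bsub>M\<^esub> V"
proof -
  have *: "U \<subseteq> carrier M" "\<zero> \<in> U" "V \<subseteq> carrier M" "\<zero> \<in> V" using assms by (auto simp: submodule_iff)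
  show "U \<subseteq> U <+>\<^bsub>M\<^esub> V"
  proof
    fix x assume x: "x \<in> U"
    then have "x = x \<oplus> \<zero>" using *(1) by (simp add: subset_iff)
    with x *(4) show "x \<in> U <+>\<^bsub>M\<^esub> V" unfolding add_sum_iff by blast
  qed
  show "V \<subseteq> U <+>\<^bsub>M\<^esub> V"
  proof
    fix x assume x: "x \<in> V"
    then have "x = \<zero> \<oplus> x" using *(3) by (simp add: subset_iff)
    with x *(2) show "x \<in> U <+>\<^bsub>M\<^esub> V" unfolding add_sum_iff by blast
  qed
qed

lemma submodule_is_left_module:
  assumes "Module.submodule U A M"
  shows "left_module A (M\<lparr>carrier := U\<rparr>)"
proof -
  have U: "U \<subseteq> carrier M" "\<zero> \<in> U" "\<And>x y. x \<in> U \<Longrightarrow> y \<in> U \<Longrightarrow> x \<oplus> y \<in> U" 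
    "\<And>a x. a \<in> carrier A \<Longrightarrow> x \<in> U \<Longrightarrow> a \<odot> x \<in> U" 
    using assms by (auto simp: submodule_iff)
  note [simp] = subsetD[OF U(1)]
  show ?thesis
  proof (intro left_module.intro left_module_axioms.intro abelian_groupI)
    show "ring A" ..
    show "\<exists>y\<in>carrier (M\<lparr>carrier := U\<rparr>). y \<oplus>\<^bsub>M\<lparr>carrier := U\<rparr>\<^esub> x = \<zero>\<^bsub>M\<lparr>carrier := U\<rparr>\<^esub>"
      if "x \<in> carrier (M\<lparr>carrier := U\<rparr>)" for x
      using that submodule_neg[OF assms, of x] by (auto simp: M.l_neg intro!: bexI[of _ "\<ominus> x"])
  qed (use U in \<open>auto simp: M.a_ac smult_l_distr smult_r_distr smult_assoc smult_one\<close>)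
qed

lemma submodule_of_submodule:
  assumes "Module.submodule U A M"
  shows "Module.submodule W A (M\<lparr>carrier := U\<rparr>) \<longleftrightarrow> Module.submodule W A M \<and> W \<subseteq> U"
proof -
  interpret U: left_module A "M\<lparr>carrier := U\<rparr>" by (rule submodule_is_left_module[OF assms])
  show ?thesis using assms unfolding U.submodule_iff submodule_iff by auto
qed

lemma module_hom_inclusion:
  assumes "Module.submodule U A M"
  shows "(\<lambda>x. x) \<in> module_hom A (M\<lparr>carrier := U\<rparr>) M"
  using assms by (auto simp: module_hom_def submodule_iff)

text \<open>Membership in \<open>module_hom\<close> depends only on the values on the carrier. This
  permits the passage to extensional functions, as \<open>hom_space\<close> demands.\<close>

lemma module_hom_cong:
  assumes "f \<in> module_hom A M N" "\<And>x. x \<in> carrier M \<Longrightarrow> g x = f x"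
  shows "g \<in> module_hom A M N"
  using assms smult_closed by (auto simp: module_hom_def Pi_iff)

lemma module_hom_restrict:
  assumes "f \<in> module_hom A M N"
  shows "restrict f (carrier M) \<in> module_hom A M N"
  by (rule module_hom_cong[OF assms]) auto

text \<open>Over a noncommutative ring only central elements may be multiplied onto a homomorphism;
  the application is to scalars from \<open>K\<close>.\<close>

lemma smult_hom_commute:
  assumes c: "c \<in> carrier A" and cen: "\<And>a. a \<in> carrier A \<Longrightarrow> c \<otimes>\<^bsub>A\<^esub> a = a \<otimes>\<^bsub>A\<^esub> c"
    and "f \<in> module_hom A P M"
  shows "(\<lambda>x. c \<odot> f x) \<in> module_hom A P M"
  using assms(3) c smult_closed unfolding module_hom_def
  by (auto simp: Pi_iff smult_r_distr) (metis cen smult_assoc)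

end

lemma module_hom_zero_map:
  assumes "left_module A N"
  shows "(\<lambda>x. \<zero>\<^bsub>N\<^esub>) \<in> module_hom A M N"
proof -
  interpret N: left_module A N by fact
  show ?thesis by (auto simp: module_hom_def)
qed

section \<open>Kernels, images, inverses and sums of homomorphisms\<close>

locale left_module_hom = M: left_module A M + N: left_module A N
  for A :: "('a, 'r) ring_scheme" and M :: "('a, 'm, 'y) module_scheme"
    and N :: "('a, 'n, 'z) module_scheme" +
  fixes f
  assumes hom: "f \<in> module_hom A M N"
begin

lemma in_carrier [simp, intro]: "x \<in> carrier M \<Longrightarrow> f x \<in> carrier N"
  using hom by (rule module_hom_in)

lemma add [simp]: "x \<in> carrier M \<Longrightarrow> y \<in> carrier M \<Longrightarrow> f (x \<oplus>\<^bsub>M\<^esub> y) = f x \<oplus>\<^bsub>N\<^esub> f y"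
  using hom by (simp add: module_hom_def)

lemma smult [simp]: "a \<in> carrier A \<Longrightarrow> x \<in> carrier M \<Longrightarrow> f (a \<odot>\<^bsub>M\<^esub> x) = a \<odot>\<^bsub>N\<^esub> f x"
  using hom by (simp add: module_hom_def)

lemma zero [simp]: "f \<zero>\<^bsub>M\<^esub> = \<zero>\<^bsub>N\<^esub>"
  by (metis M.M.zero_closed M.A.zero_closed M.smult_zero_left N.smult_zero_left in_carrier smult)

lemma neg [simp]: "x \<in> carrier M \<Longrightarrow> f (\<ominus>\<^bsub>M\<^esub> x) = \<ominus>\<^bsub>N\<^esub> f x"
  by (metis M.A.a_inv_closed M.A.one_closed M.smult_minus_one N.smult_minus_one in_carrier smult)

lemma minus [simp]: "x \<in> carrier M \<Longrightarrow> y \<in> carrier M \<Longrightarrow> f (x \<ominus>\<^bsub>M\<^esub> y) = f x \<ominus>\<^bsub>N\<^esub> f y"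
  by (simp add: M.M.minus_eq N.M.minus_eq)

lemma inj_iff: "inj_on f (carrier M) \<longleftrightarrow> (\<forall>x\<in>carrier M. f x = \<zero>\<^bsub>N\<^esub> \<longrightarrow> x = \<zero>\<^bsub>M\<^esub>)"
proof
  assume "inj_on f (carrier M)"
  then show "\<forall>x\<in>carrier M. f x = \<zero>\<^bsub>N\<^esub> \<longrightarrow> x = \<zero>\<^bsub>M\<^esub>"
    by (metis M.M.zero_closed inj_onD zero)
next
  assume *: "\<forall>x\<in>carrier M. f x = \<zero>\<^bsub>N\<^esub> \<longrightarrow> x = \<zero>\<^bsub>M\<^esub>"
  show "inj_on f (carrier M)"
  proof (rule inj_onI)
    fix x y assume "x \<in> carrier M" "y \<in> carrier M" "f x = f y"
    moreover from this have "x \<ominus>\<^bsub>M\<^esub> y = \<zero>\<^bsub>M\<^esub>" using * by simp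
    ultimately show "x = y" by simp
  qed
qed

lemma kernel_submodule: "Module.submodule {x \<in> carrier M. f x = \<zero>\<^bsub>N\<^esub>} A M"
  by (auto simp: M.submodule_iff M.smult_closed)

lemma image_submodule:
  assumes "Module.submodule U A M"
  shows "Module.submodule (f ` U) A N"
proof -
  have U: "U \<subseteq> carrier M" "\<zero>\<^bsub>M\<^esub> \<in> U" "\<And>x y. x \<in> U \<Longrightarrow> y \<in> U \<Longrightarrow> x \<oplus>\<^bsub>M\<^esub> y \<in> U" 
    "\<And>a x. a \<in> carrier A \<Longrightarrow> x \<in> U \<Longrightarrow> a \<odot>\<^bsub>M\<^esub> x \<in> U" 
    using assms by (auto simp: M.submodule_iff)
  note [simp] = subsetD[OF U(1)]
  show ?thesis unfolding N.submodule_iff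
  proof (intro conjI ballI)
    show "\<zero>\<^bsub>N\<^esub> \<in> f ` U" using U(2) zero by (metis imageI)
    show "x \<oplus>\<^bsub>N\<^esub> y \<in> f ` U" if xy: "x \<in> f ` U" "y \<in> f ` U" for x y
    proof -
      obtain u v where "u \<in> U" "v \<in> U" "x = f u" "y = f v" using xy by blast
      then have "x \<oplus>\<^bsub>N\<^esub> y = f (u \<oplus>\<^bsub>M\<^esub> v)" "u \<oplus>\<^bsub>M\<^esub> v \<in> U" using U by auto
      then show ?thesis by blast
    qed
    show "a \<odot>\<^bsub>N\<^esub> x \<in> f ` U" if a: "a \<in> carrier A" and x: "x \<in> f ` U" for a x
    proof -
      obtain u where "u \<in> U" "x = f u" using x by blast
      then have "a \<odot>\<^bsub>N\<^esub> x = f (a \<odot>\<^bsub>M\<^esub> u)" "a \<odot>\<^bsub>M\<^esub> u \<in> U" using U a by auto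
      then show ?thesis by blast
    qed
  qed (use U in auto)
qed

lemma inverse_hom:
  assumes "bij_betw f (carrier M) (carrier N)"
  shows "inv_into (carrier M) f \<in> module_hom A N M"
proof -
  let ?g = "inv_into (carrier M) f"
  have g: "?g y \<in> carrier M" "f (?g y) = y" if "y \<in> carrier N" for y
    using that assms inv_into_into[of y f "carrier M"] f_inv_into_f[of y f "carrier M"]
    by (simp_all add: bij_betw_def)
  have gf: "?g (f x) = x" if "x \<in> carrier M" for x
    using that assms by (simp add: bij_betw_def)
  show ?thesis
  proof (rule module_homI)
    show "?g (x \<oplus>\<^bsub>N\<^esub> y) = ?g x \<oplus>\<^bsub>M\<^esub> ?g y" if "x \<in> carrier N" "y \<in> carrier N" for x y
      using gf[of "?g x \<oplus>\<^bsub>M\<^esub> ?g y"] g[OF that(1)] g[OF that(2)] by simp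
    show "?g (a \<odot>\<^bsub>N\<^esub> x) = a \<odot>\<^bsub>M\<^esub> ?g x" if "a \<in> carrier A" "x \<in> carrier N" for a x
      using gf[of "a \<odot>\<^bsub>M\<^esub> ?g x"] g[OF that(2)] that(1) by (simp add: M.smult_closed)
  qed (use g in auto)
qed

lemma sum_hom:
  assumes "g \<in> module_hom A M N"
  shows "(\<lambda>x. f x \<oplus>\<^bsub>N\<^esub> g x) \<in> module_hom A M N"
proof -
  interpret g: left_module_hom A M N g by unfold_locales fact
  show ?thesis
    by (rule module_homI) (auto simp: N.M.a_ac N.smult_r_distr)
qed

lemma diff_hom:
  assumes "g \<in> module_hom A M N"
  shows "(\<lambda>x. f x \<ominus>\<^bsub>N\<^esub> g x) \<in> module_hom A M N"
proof -
  interpret g: left_module_hom A M N g by unfold_locales fact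
  show ?thesis
    by (rule module_homI)
      (auto simp: N.M.minus_eq N.M.minus_add N.M.a_ac N.smult_r_distr N.smult_neg)
qed

end

lemma left_module_homI:
  "left_module A M \<Longrightarrow> left_module A N \<Longrightarrow> f \<in> module_hom A M N \<Longrightarrow> left_module_hom A M N f"
  by (simp add: left_module_hom_def left_module_hom_axioms_def)

section \<open>Vector spaces of homomorphisms\<close>

lemma underlying_space_simps [simp]:
  "carrier (underlying_space A M) = carrier M"
  "zero (underlying_space A M) = zero M"
  "add (underlying_space A M) = add M"
  "c \<odot>\<^bsub>underlying_space A M\<^esub> x = (c \<odot>\<^bsub>A\<^esub> \<one>\<^bsub>A\<^esub>) \<odot>\<^bsub>M\<^esub> x"
  by (simp_all add: underlying_space_def)

lemma underlying_space_submodule: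
  "underlying_space A (M\<lparr>carrier := U\<rparr>) = (underlying_space A M)\<lparr>carrier := U\<rparr>"
  by (simp add: underlying_space_def)

lemma hom_space_simps [simp]:
  "f \<in> carrier (hom_space A M N) \<longleftrightarrow> f \<in> module_hom A M N \<and> f \<in> extensional (carrier M)"
  "zero (hom_space A M N) = (\<lambda>x\<in>carrier M. \<zero>\<^bsub>N\<^esub>)"
  "f \<oplus>\<^bsub>hom_space A M N\<^esub> g = (\<lambda>x\<in>carrier M. f x \<oplus>\<^bsub>N\<^esub> g x)"
  "c \<odot>\<^bsub>hom_space A M N\<^esub> f = (\<lambda>x\<in>carrier M. (c \<odot>\<^bsub>A\<^esub> \<one>\<^bsub>A\<^esub>) \<odot>\<^bsub>N\<^esub> f x)"
  by (simp_all add: hom_space_def)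

lemma fd_moduleD:
  assumes "fd_module K A M"
  shows "left_module A M" "vectorspace.fin_dim K (underlying_space A M)"
  using assms by (auto simp: fd_module_def)

text \<open>Nothing is assumed beyond \<open>fd_algebra\<close>; the record types are fixed to those
  on which \<open>fd_module\<close>, \<open>hom_space\<close> and the other notions are
  defined.\<close>

locale fd_modules = fd_algebra K A for K :: "'k ring" and A :: "('k, 'a) module"
begin

abbreviation scalar where "scalar c \<equiv> c \<odot>\<^bsub>A\<^esub> \<one>\<^bsub>A\<^esub>"

lemma scalar_closed [simp]: "c \<in> carrier K \<Longrightarrow> scalar c \<in> carrier A"
  by simp

lemma scalar_add:
  "c \<in> carrier K \<Longrightarrow> d \<in> carrier K \<Longrightarrow> scalar (c \<oplus>\<^bsub>K\<^esub> d) = scalar c \<oplus>\<^bsub>A\<^esub> scalar d"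
  by (simp add: smult_l_distr)

lemma scalar_mult:
  "c \<in> carrier K \<Longrightarrow> d \<in> carrier K \<Longrightarrow> scalar (c \<otimes>\<^bsub>K\<^esub> d) = scalar c \<otimes>\<^bsub>A\<^esub> scalar d"
  by (simp add: smult_assoc1 smult_mult_left)

lemma scalar_central:
  "c \<in> carrier K \<Longrightarrow> a \<in> carrier A \<Longrightarrow> scalar c \<otimes>\<^bsub>A\<^esub> a = a \<otimes>\<^bsub>A\<^esub> scalar c"
  by (simp add: smult_mult_left smult_mult_right)

lemma scalar_hom:
  assumes "left_module A N" "c \<in> carrier K" "f \<in> module_hom A M N"
  shows "(\<lambda>x. scalar c \<odot>\<^bsub>N\<^esub> f x) \<in> module_hom A M N"
  by (rule left_module.smult_hom_commute) (use assms scalar_central in auto)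

lemma underlying_vectorspace:
  assumes "left_module A M"
  shows "vectorspace K (underlying_space A M)"
proof -
  interpret M: left_module A M by fact
  show ?thesis
  proof (rule vs_criteria)
    show "field K" ..
    show "\<forall>v\<in>carrier (underlying_space A M). \<exists>w\<in>carrier (underlying_space A M).
        v \<oplus>\<^bsub>underlying_space A M\<^esub> w = \<zero>\<^bsub>underlying_space A M\<^esub>"
      using M.M.r_neg by auto
    show "\<forall>a b v. a \<in> carrier K \<and> b \<in> carrier K \<and> v \<in> carrier (underlying_space A M) \<longrightarrow>
        (a \<otimes>\<^bsub>K\<^esub> b) \<odot>\<^bsub>underlying_space A M\<^esub> v =
          a \<odot>\<^bsub>underlying_space A M\<^esub> (b \<odot>\<^bsub>underlying_space A M\<^esub> v)"
      by (simp add: scalar_mult M.smult_assoc del: smult_assoc_simp)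
    show "\<forall>a b v. a \<in> carrier K \<and> b \<in> carrier K \<and> v \<in> carrier (underlying_space A M) \<longrightarrow>
        (a \<oplus>\<^bsub>K\<^esub> b) \<odot>\<^bsub>underlying_space A M\<^esub> v =
          a \<odot>\<^bsub>underlying_space A M\<^esub> v \<oplus>\<^bsub>underlying_space A M\<^esub> b \<odot>\<^bsub>underlying_space A M\<^esub> v"
      by (simp add: scalar_add M.smult_l_distr)
  qed (auto simp: M.smult_closed M.M.a_ac M.smult_one M.smult_r_distr)
qed

lemma module_hom_underlying:
  assumes "f \<in> module_hom A M N"
  shows "f \<in> module_hom K (underlying_space A M) (underlying_space A N)"
  using assms by (auto simp: module_hom_def)

lemma submodule_subspace:
  assumes "left_module A M" "Module.submodule U A M"
  shows "subspace K U (underlying_space A M)"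
  by (rule subspaceI[OF underlying_vectorspace[OF assms(1)]])
    (use assms(2) left_module.submodule_iff[OF assms(1)] in auto)

lemma fd_submodule:
  assumes "fd_module K A M" "Module.submodule U A M"
  shows "fd_module K A (M\<lparr>carrier := U\<rparr>)"
  unfolding fd_module_def underlying_space_submodule
  using vectorspace.subspace_fin_dim[OF underlying_vectorspace fd_moduleD(2) submodule_subspace]
    left_module.submodule_is_left_module fd_moduleD(1) assms by blast

lemma hom_space_vectorspace:
  assumes "left_module A M" "left_module A N"
  shows "vectorspace K (hom_space A M N)"
proof -
  interpret M: left_module A M by fact
  interpret N: left_module A N by fact
  note in_N [simp] = module_hom_in[of _ A M N]
  have ext: "f = g" if "f \<in> carrier (hom_space A M N)" "g \<in> carrier (hom_space A M N)"
      "\<And>x. x \<in> carrier M \<Longrightarrow> f x = g x" for f g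
    using that extensionalityI[of f "carrier M" g] by auto
  have closed_zero: "\<zero>\<^bsub>hom_space A M N\<^esub> \<in> carrier (hom_space A M N)"
    using M.module_hom_restrict[OF module_hom_zero_map[OF assms(2)]] by simp
  have closed_add: "f \<oplus>\<^bsub>hom_space A M N\<^esub> g \<in> carrier (hom_space A M N)"
    if "f \<in> carrier (hom_space A M N)" "g \<in> carrier (hom_space A M N)" for f g
    using that M.module_hom_restrict[OF left_module_hom.sum_hom[OF left_module_homI[OF assms]]]
    by simp
  have closed_smult: "c \<odot>\<^bsub>hom_space A M N\<^esub> f \<in> carrier (hom_space A M N)"
    if "c \<in> carrier K" "f \<in> carrier (hom_space A M N)" for c f
    using that M.module_hom_restrict[OF scalar_hom[OF assms(2)]] by simp
  show ?thesis
  proof (rule vs_criteria)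
    show "field K" ..
    show "\<forall>f\<in>carrier (hom_space A M N). \<exists>g\<in>carrier (hom_space A M N).
        f \<oplus>\<^bsub>hom_space A M N\<^esub> g = \<zero>\<^bsub>hom_space A M N\<^esub>"
    proof
      fix f assume f: "f \<in> carrier (hom_space A M N)"
      then interpret f: left_module_hom A M N f by unfold_locales simp
      have z: "(\<lambda>x. \<zero>\<^bsub>N\<^esub>) \<in> module_hom A M N" by (rule module_hom_zero_map[OF assms(2)])
      let ?g = "restrict (\<lambda>x. \<zero>\<^bsub>N\<^esub> \<ominus>\<^bsub>N\<^esub> f x) (carrier M)"
      have "?g \<in> carrier (hom_space A M N)"
        using M.module_hom_restrict[OF left_module_hom.diff_hom[OF left_module_homI[OF assms z]]] f by simp
      moreover have "f \<oplus>\<^bsub>hom_space A M N\<^esub> ?g = \<zero>\<^bsub>hom_space A M N\<^esub>"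
        by (auto simp: fun_eq_iff restrict_def N.M.minus_eq N.M.r_neg)
      ultimately show "\<exists>g\<in>carrier (hom_space A M N).
        f \<oplus>\<^bsub>hom_space A M N\<^esub> g = \<zero>\<^bsub>hom_space A M N\<^esub>" by blast
    qed
    show "\<forall>f g h. f \<in> carrier (hom_space A M N) \<and> g \<in> carrier (hom_space A M N) \<and>
        h \<in> carrier (hom_space A M N) \<longrightarrow>
        f \<oplus>\<^bsub>hom_space A M N\<^esub> g \<oplus>\<^bsub>hom_space A M N\<^esub> h =
        f \<oplus>\<^bsub>hom_space A M N\<^esub> (g \<oplus>\<^bsub>hom_space A M N\<^esub> h)"
      by (auto simp: fun_eq_iff restrict_def N.M.a_ac)
    show "\<forall>f g. f \<in> carrier (hom_space A M N) \<and> g \<in> carrier (hom_space A M N) \<longrightarrow>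
        f \<oplus>\<^bsub>hom_space A M N\<^esub> g = g \<oplus>\<^bsub>hom_space A M N\<^esub> f"
      by (auto simp: fun_eq_iff restrict_def N.M.a_ac)
    show "\<forall>f\<in>carrier (hom_space A M N). f \<oplus>\<^bsub>hom_space A M N\<^esub> \<zero>\<^bsub>hom_space A M N\<^esub> = f"
      by (auto simp: fun_eq_iff restrict_def extensional_def)
    show "\<forall>a b v. a \<in> carrier K \<and> b \<in> carrier K \<and> v \<in> carrier (hom_space A M N) \<longrightarrow>
        (a \<otimes>\<^bsub>K\<^esub> b) \<odot>\<^bsub>hom_space A M N\<^esub> v =
          a \<odot>\<^bsub>hom_space A M N\<^esub> (b \<odot>\<^bsub>hom_space A M N\<^esub> v)"
      by (auto simp: fun_eq_iff restrict_def scalar_mult N.smult_assoc simp del: smult_assoc_simp)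
    show "\<forall>v\<in>carrier (hom_space A M N). \<one>\<^bsub>K\<^esub> \<odot>\<^bsub>hom_space A M N\<^esub> v = v"
      by (auto simp: fun_eq_iff restrict_def extensional_def N.smult_one)
    show "\<forall>a b v. a \<in> carrier K \<and> b \<in> carrier K \<and> v \<in> carrier (hom_space A M N) \<longrightarrow>
        (a \<oplus>\<^bsub>K\<^esub> b) \<odot>\<^bsub>hom_space A M N\<^esub> v =
          a \<odot>\<^bsub>hom_space A M N\<^esub> v \<oplus>\<^bsub>hom_space A M N\<^esub> b \<odot>\<^bsub>hom_space A M N\<^esub> v"
      by (auto simp: fun_eq_iff restrict_def scalar_add N.smult_l_distr)
    show "\<forall>a v w. a \<in> carrier K \<and> v \<in> carrier (hom_space A M N) \<and> w \<in> carrier (hom_space A M N) \<longrightarrow>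
        a \<odot>\<^bsub>hom_space A M N\<^esub> (v \<oplus>\<^bsub>hom_space A M N\<^esub> w) =
          a \<odot>\<^bsub>hom_space A M N\<^esub> v \<oplus>\<^bsub>hom_space A M N\<^esub> a \<odot>\<^bsub>hom_space A M N\<^esub> w"
      by (auto simp: fun_eq_iff restrict_def N.smult_r_distr)
  qed (use closed_zero closed_add closed_smult in blast)+
qed

text \<open>A homomorphism is determined by its values on a finite set spanning \<open>M\<close>
  over \<open>K\<close>, so the evaluations at these vectors are jointly injective.\<close>

lemma hom_space_fin_dim:
  assumes "fd_module K A M" "fd_module K A N"
  shows "vectorspace.fin_dim K (hom_space A M N)"
proof -
  note M = fd_moduleD[OF assms(1)] and N = fd_moduleD[OF assms(2)]
  interpret M: left_module A M by (rule M)
  interpret UM: vectorspace K "underlying_space A M" by (rule underlying_vectorspace[OF M(1)])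
  obtain B where B: "finite B" "B \<subseteq> carrier M" "UM.span B = carrier M"
    using M(2) unfolding UM.fin_dim_def by auto
  show ?thesis
  proof (rule fin_dim_joint_inj[where I = B and W = "\<lambda>_. underlying_space A N" and T = "\<lambda>b f. f b"])
    show "vectorspace K (hom_space A M N)" by (rule hom_space_vectorspace[OF M(1) N(1)])
    show "vectorspace K (underlying_space A N)" by (rule underlying_vectorspace[OF N(1)])
    show "(\<lambda>f. f b) \<in> module_hom K (hom_space A M N) (underlying_space A N)" if "b \<in> B" for b
      by (rule module_homI) (use that B(2) in \<open>auto intro: module_hom_in\<close>)
    fix f assume f: "f \<in> carrier (hom_space A M N)" and z: "\<And>b. b \<in> B \<Longrightarrow> f b = \<zero>\<^bsub>underlying_space A N\<^esub>"
    interpret f: left_module_hom A M N f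
      by (rule left_module_homI[OF M(1) N(1)]) (use f in simp)
    \<comment> \<open>The kernel of \<open>f\<close> is a subspace that contains the spanning set
      \<open>B\<close>.\<close>
    have "UM.span B \<subseteq> {x \<in> carrier M. f x = \<zero>\<^bsub>N\<^esub>}"
      by (rule UM.span_is_subset)
        (use B(2) z submodule_subspace[OF M(1) f.kernel_submodule] in \<open>auto simp: subspace_def\<close>)
    then show "f = \<zero>\<^bsub>hom_space A M N\<^esub>" using B(3) f
      by (auto simp: fun_eq_iff extensional_def)
  qed (use B N in auto)
qed

lemma hom_precomp:
  assumes "left_module A M" "left_module A L" "left_module A N" "f \<in> module_hom A L M"
  shows "(\<lambda>h. \<lambda>x\<in>carrier L. h (f x)) \<in> module_hom K (hom_space A M N) (hom_space A L N)"
proof -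
  interpret L: left_module A L by fact
  interpret f: left_module_hom A L M f by (rule left_module_homI) fact+
  show ?thesis
    by (rule module_homI)
      (use assms L.module_hom_restrict[OF module_hom_comp[OF f.hom]] in \<open>auto simp: fun_eq_iff\<close>)
qed

end

section \<open>Eigenvectors over an algebraically closed field\<close>

text \<open>The setting is the \<open>K[X]\<close>-submodule generated by a nonzero vector
  \<open>x\<close>, where \<open>X\<close> acts as \<open>T\<close>.\<close>

locale cyclic_span = vectorspace K V for K (structure) and V +
  fixes T x
  assumes fin_dim: "fin_dim"
    and T: "T \<in> module_hom K V V"
    and x: "x \<in> carrier V" "x \<noteq> \<zero>\<^bsub>V\<^esub>"
begin

sublocale T: linear_map K V V T
  by (rule linear_mapI[OF is_vs is_vs T])

text \<open>This is p(T) x by Horner's rule. Coefficients are listed with the leading one first,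
  matching the polynomials of the library, and leading zeros are allowed.\<close>

definition act :: "'a list \<Rightarrow> 'c" where
  "act p = foldl (\<lambda>v c. T v \<oplus>\<^bsub>V\<^esub> c \<odot>\<^bsub>V\<^esub> x) \<zero>\<^bsub>V\<^esub> p"

lemma act_snoc: "act (p @ [c]) = T (act p) \<oplus>\<^bsub>V\<^esub> c \<odot>\<^bsub>V\<^esub> x"
  by (simp add: act_def)

lemma act_Nil [simp]: "act [] = \<zero>\<^bsub>V\<^esub>"
  by (simp add: act_def)

lemma act_closed [simp]: "set p \<subseteq> carrier K \<Longrightarrow> act p \<in> carrier V"
  by (induction p rule: rev_induct) (use x in \<open>auto simp: act_snoc\<close>)

text \<open>The span of x, T x, ..., T^(n-1) x. Since leading zeros are allowed, fixing the length
  to be exactly \<open>n\<close> still covers all polynomials of smaller degree.\<close>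

definition layer :: "nat \<Rightarrow> 'c set" where
  "layer n = act ` {p. set p \<subseteq> carrier K \<and> length p = n}"

lemma layer_0: "layer 0 = {\<zero>\<^bsub>V\<^esub>}"
  by (auto simp: layer_def)

lemma layer_Suc: "layer (Suc n) = {T s \<oplus>\<^bsub>V\<^esub> c \<odot>\<^bsub>V\<^esub> x | s c. s \<in> layer n \<and> c \<in> carrier K}"
proof
  show "layer (Suc n) \<subseteq> {T s \<oplus>\<^bsub>V\<^esub> c \<odot>\<^bsub>V\<^esub> x | s c. s \<in> layer n \<and> c \<in> carrier K}"
  proof
    fix v assume "v \<in> layer (Suc n)"
    then obtain p where p: "set p \<subseteq> carrier K" "length p = Suc n" "v = act p" by (auto simp: layer_def)
    then obtain q c where "p = q @ [c]" by (metis length_Suc_conv_rev)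
    with p show "v \<in> {T s \<oplus>\<^bsub>V\<^esub> c \<odot>\<^bsub>V\<^esub> x | s c. s \<in> layer n \<and> c \<in> carrier K}"
      by (auto simp: layer_def act_snoc)
  qed
  show "{T s \<oplus>\<^bsub>V\<^esub> c \<odot>\<^bsub>V\<^esub> x | s c. s \<in> layer n \<and> c \<in> carrier K} \<subseteq> layer (Suc n)"
  proof safe
    fix s c assume "s \<in> layer n" and c: "c \<in> carrier K"
    then obtain p where "set p \<subseteq> carrier K" "length p = n" "s = act p" by (auto simp: layer_def)
    then show "T s \<oplus>\<^bsub>V\<^esub> c \<odot>\<^bsub>V\<^esub> x \<in> layer (Suc n)" using c
      by (auto simp: layer_def act_snoc[symmetric] intro!: imageI)
  qed
qed

lemma layer_subspace: "subspace K (layer n) V"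
proof (induction n)
  case 0
  show ?case unfolding layer_0 by (rule subspaceI[OF is_vs]) auto
next
  case (Suc n)
  then interpret S: LinearCombinations.submodule K "layer n" V by (simp add: subspace_def)
  have [simp]: "s \<in> layer n \<Longrightarrow> s \<in> carrier V" for s using S.subset by blast
  show ?case
  proof (rule subspaceI[OF is_vs])
    show "layer (Suc n) \<subseteq> carrier V" using x by (auto simp: layer_Suc)
    have "\<zero>\<^bsub>V\<^esub> = T \<zero>\<^bsub>V\<^esub> \<oplus>\<^bsub>V\<^esub> \<zero> \<odot>\<^bsub>V\<^esub> x" using x by simp
    then show "\<zero>\<^bsub>V\<^esub> \<in> layer (Suc n)" unfolding layer_Suc using S.zero_closed by blast
    fix u assume "u \<in> layer (Suc n)"
    then obtain s c where u: "s \<in> layer n" "c \<in> carrier K" "u = T s \<oplus>\<^bsub>V\<^esub> c \<odot>\<^bsub>V\<^esub> x"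
      by (auto simp: layer_Suc)
    show "u \<oplus>\<^bsub>V\<^esub> v \<in> layer (Suc n)" if v: "v \<in> layer (Suc n)" for v
    proof -
      obtain t d where v: "t \<in> layer n" "d \<in> carrier K" "v = T t \<oplus>\<^bsub>V\<^esub> d \<odot>\<^bsub>V\<^esub> x"
        using v by (auto simp: layer_Suc)
      have "u \<oplus>\<^bsub>V\<^esub> v = T (s \<oplus>\<^bsub>V\<^esub> t) \<oplus>\<^bsub>V\<^esub> (c \<oplus> d) \<odot>\<^bsub>V\<^esub> x"
        using u v x by (simp add: smult_l_distr M.a_ac)
      with u v show ?thesis unfolding layer_Suc by blast
    qed
    show "d \<odot>\<^bsub>V\<^esub> u \<in> layer (Suc n)" if d: "d \<in> carrier K" for d
    proof -
      have "d \<odot>\<^bsub>V\<^esub> u = T (d \<odot>\<^bsub>V\<^esub> s) \<oplus>\<^bsub>V\<^esub> (d \<otimes> c) \<odot>\<^bsub>V\<^esub> x"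
        using u x d by (simp add: smult_r_distr smult_assoc1)
      with u d show ?thesis unfolding layer_Suc by blast
    qed
  qed
qed

lemma layer_mono: "layer n \<subseteq> layer (Suc n)"
proof (induction n)
  case 0
  show ?case using layer_subspace[of 1]
    by (auto simp: layer_0 subspace_def LinearCombinations.submodule_def)
next
  case (Suc n)
  then show ?case unfolding layer_Suc[of "Suc n"] layer_Suc[of n] by blast
qed

text \<open>The layers increase; if no two consecutive ones agreed, their dimensions would grow
  strictly and exceed \<open>dim\<close>.\<close>

lemma layer_stabilises: "\<exists>n. layer (Suc n) = layer n"
proof (rule ccontr)
  assume neq: "\<nexists>n. layer (Suc n) = layer n"
  let ?d = "\<lambda>n. vectorspace.dim K (vs (layer n))"
  have "?d n < ?d (Suc n)" for n
  proof -
    have "?d n \<noteq> ?d (Suc n)"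
      using subspace_dim_mono(2)[OF fin_dim layer_subspace layer_subspace layer_mono, of n] neq by auto
    then show ?thesis
      using subspace_dim_mono(1)[OF fin_dim layer_subspace layer_subspace layer_mono, of n] by simp
  qed
  \<comment> \<open>A strictly increasing sequence of naturals dominates the identity; the
    contradiction is at the index \<open>Suc dim\<close>.\<close>
  then have "n \<le> ?d n" for n
    by (rule strict_mono_imp_increasing[OF strict_mono_Suc_iff[THEN iffD2, rule_format]])
  moreover have "?d (Suc dim) \<le> dim"
    by (rule subspace_dim_le(1)[OF fin_dim layer_subspace])
  ultimately show False by (metis not_less_eq_eq)
qed

lemma act_one_Cons:
  assumes "set p \<subseteq> carrier K"
  shows "act (\<one> # p) = (T ^^ length p) x \<oplus>\<^bsub>V\<^esub> act p" "(T ^^ length p) x \<in> carrier V"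
proof -
  have "act (\<one> # p) = (T ^^ length p) x \<oplus>\<^bsub>V\<^esub> act p \<and> (T ^^ length p) x \<in> carrier V"
    using assms
  proof (induction p rule: rev_induct)
    case Nil
    show ?case using x by (simp add: act_def)
  next
    case (snoc c p)
    then show ?case using x act_snoc[of "\<one> # p" c] by (simp add: act_snoc M.a_assoc)
  qed
  then show "act (\<one> # p) = (T ^^ length p) x \<oplus>\<^bsub>V\<^esub> act p" "(T ^^ length p) x \<in> carrier V" by auto
qed

text \<open>Once the layers stabilise at \<open>n\<close>, the vector T^n x is a combination of
  lower powers; moving it to the other side gives a monic polynomial of degree \<open>n\<close> that
  annihilates \<open>x\<close>.\<close>

lemma annihilator_exists: "\<exists>p. set p \<subseteq> carrier K \<and> act (\<one> # p) = \<zero>\<^bsub>V\<^esub>"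
proof -
  obtain n where n: "layer (Suc n) = layer n" using layer_stabilises by blast
  interpret S: LinearCombinations.submodule K "layer n" V using layer_subspace by (simp add: subspace_def)
  let ?z = "replicate n \<zero>"
  have act0: "act (replicate m \<zero>) = \<zero>\<^bsub>V\<^esub>" for m
  proof (induction m)
    case (Suc m)
    then show ?case using x act_snoc[of "replicate m \<zero>" \<zero>] by (simp add: replicate_append_same)
  qed simp
  have "set ?z \<subseteq> carrier K" by auto
  note one = act_one_Cons[OF this]
  have Tn: "(T ^^ n) x \<in> carrier V" using one(2) by simp
  \<comment> \<open>The list \<open>\<one> # ?z\<close> is the polynomial X^n, of length
    \<open>Suc n\<close>.\<close>
  have "act (\<one> # ?z) \<in> layer (Suc n)" unfolding layer_def by (rule imageI) auto
  then have "(T ^^ n) x \<in> layer n" using one n Tn by (simp add: act0)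
  then have "(\<ominus> \<one>) \<odot>\<^bsub>V\<^esub> (T ^^ n) x \<in> layer n" by (intro S.smult_closed) auto
  then obtain p where p: "set p \<subseteq> carrier K" "length p = n" "act p = (\<ominus> \<one>) \<odot>\<^bsub>V\<^esub> (T ^^ n) x"
    by (auto simp: layer_def)
  have "act (\<one> # p) = \<zero>\<^bsub>V\<^esub>"
    using act_one_Cons[OF p(1)] p Tn by (simp add: smult_minus_1 M.r_neg)
  with p(1) show ?thesis by blast
qed

text \<open>Horner's scheme: \<open>q\<close> is the quotient of \<open>p\<close> by \<open>X - c\<close>.\<close>

lemma act_division:
  assumes "set p \<subseteq> carrier K" "p \<noteq> []" "c \<in> carrier K"
  shows "\<exists>q. set q \<subseteq> carrier K \<and> Suc (length q) = length p \<and> (q \<noteq> [] \<longrightarrow> hd q = hd p) \<and>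
    act p \<oplus>\<^bsub>V\<^esub> c \<odot>\<^bsub>V\<^esub> act q = T (act q) \<oplus>\<^bsub>V\<^esub> eval p c \<odot>\<^bsub>V\<^esub> x"
  using assms(1,2)
proof (induction p rule: rev_induct)
  case (snoc b p)
  show ?case
  proof (cases "p = []")
    case True
    show ?thesis
      by (rule exI[of _ "[]"]) (use True snoc.prems assms(3) x in \<open>auto simp: act_def\<close>)
  next
    case False
    have p: "set p \<subseteq> carrier K" and b: "b \<in> carrier K" using snoc.prems by auto
    obtain q where q: "set q \<subseteq> carrier K" "Suc (length q) = length p" "q \<noteq> [] \<longrightarrow> hd q = hd p"
      "act p \<oplus>\<^bsub>V\<^esub> c \<odot>\<^bsub>V\<^esub> act q = T (act q) \<oplus>\<^bsub>V\<^esub> eval p c \<odot>\<^bsub>V\<^esub> x"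
      using snoc.IH[OF p False] by blast
    let ?e = "eval p c"
    have e: "?e \<in> carrier K" using p assms(3) by (rule eval_in_carrier)
    note c = assms(3)
    have aq: "act q \<in> carrier V" and ap: "act p \<in> carrier V" using p q(1) by auto
    have "hd (q @ [?e]) = hd (p @ [b])"
    proof (cases q)
      case Nil
      then have "length p = 1" using q(2) by simp
      then obtain a where "p = [a]" by (auto simp: length_Suc_conv)
      then show ?thesis using Nil p c by simp
    qed (use q(3) False in auto)
    moreover have "act (p @ [b]) \<oplus>\<^bsub>V\<^esub> c \<odot>\<^bsub>V\<^esub> act (q @ [?e]) =
      T (act (q @ [?e])) \<oplus>\<^bsub>V\<^esub> eval (p @ [b]) c \<odot>\<^bsub>V\<^esub> x"
    proof -
      have "T (act p) \<oplus>\<^bsub>V\<^esub> c \<odot>\<^bsub>V\<^esub> T (act q) = T (act p \<oplus>\<^bsub>V\<^esub> c \<odot>\<^bsub>V\<^esub> act q)"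
        using aq ap c by simp
      also have "\<dots> = T (act (q @ [?e]))" unfolding q(4) act_snoc ..
      finally have *: "T (act p) \<oplus>\<^bsub>V\<^esub> c \<odot>\<^bsub>V\<^esub> T (act q) = T (act (q @ [?e]))" .
      have "act (p @ [b]) \<oplus>\<^bsub>V\<^esub> c \<odot>\<^bsub>V\<^esub> act (q @ [?e]) =
        (T (act p) \<oplus>\<^bsub>V\<^esub> b \<odot>\<^bsub>V\<^esub> x) \<oplus>\<^bsub>V\<^esub> (c \<odot>\<^bsub>V\<^esub> T (act q) \<oplus>\<^bsub>V\<^esub> (?e \<otimes> c) \<odot>\<^bsub>V\<^esub> x)"
        using aq ap b c e x by (simp add: act_snoc smult_r_distr smult_assoc1 R.m_comm)
      also have "\<dots> = (T (act p) \<oplus>\<^bsub>V\<^esub> c \<odot>\<^bsub>V\<^esub> T (act q)) \<oplus>\<^bsub>V\<^esub> ((?e \<otimes> c) \<odot>\<^bsub>V\<^esub> x \<oplus>\<^bsub>V\<^esub> b \<odot>\<^bsub>V\<^esub> x)"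
        using aq ap b c e x by (simp add: M.a_ac del: T.T_smult)
      also have "\<dots> = T (act (q @ [?e])) \<oplus>\<^bsub>V\<^esub> eval (p @ [b]) c \<odot>\<^bsub>V\<^esub> x"
        unfolding * using eval_append_aux[OF p b c] b c e x by (simp add: smult_l_distr)
      finally show ?thesis .
    qed
    ultimately show ?thesis using q(1,2) e by (intro exI[of _ "q @ [?e]"]) auto
  qed
qed simp

text \<open>Take a monic annihilator of \<open>x\<close> of least degree, a root \<open>c\<close> of
  it, and the quotient q by X - c. By minimality q(T) x is nonzero, while T - c kills it, so it is
  an eigenvector.\<close>

lemma eigenvector_exists:
  assumes "algebraically_closed K"
  shows "\<exists>c\<in>carrier K. \<exists>v\<in>carrier V. v \<noteq> \<zero>\<^bsub>V\<^esub> \<and> T v = c \<odot>\<^bsub>V\<^esub> v"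
proof -
  interpret algebraically_closed K by fact
  let ?P = "\<lambda>p. set p \<subseteq> carrier K \<and> act (\<one> # p) = \<zero>\<^bsub>V\<^esub>"
  obtain p where p: "?P p" and min: "\<And>q. ?P q \<Longrightarrow> length p \<le> length q"
    using ex_has_least_nat[of ?P _ length] annihilator_exists by metis
  \<comment> \<open>The constant polynomial 1 sends \<open>x\<close> to itself, and \<open>x\<close>
    is nonzero.\<close>
  have "p \<noteq> []" using p x by (auto simp: act_def)
  have car: "\<one> # p \<in> carrier (poly_ring K)"
    using p by (auto simp: univ_poly_carrier[symmetric] polynomial_def)
  \<comment> \<open>Over an algebraically closed field the number of roots with multiplicity is the
    degree, which is \<open>length p\<close> because \<open>p\<close> omits the leading
    coefficient.\<close>
  then have "size (roots (\<one> # p)) = length p"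
    using roots_over_carrier[OF car] by (simp add: splitted_def)
  then have "roots (\<one> # p) \<noteq> {#}" using \<open>p \<noteq> []\<close> by auto
  then obtain c where "c \<in># roots (\<one> # p)" by blast
  then have c: "c \<in> carrier K" "eval (\<one> # p) c = \<zero>"
    using roots_mem_iff_is_root[OF car] by (auto simp: is_root_def)
  have "set (\<one> # p) \<subseteq> carrier K" using p by simp
  then obtain q where q: "set q \<subseteq> carrier K" "length q = length p" "q \<noteq> [] \<longrightarrow> hd q = \<one>"
    "act (\<one> # p) \<oplus>\<^bsub>V\<^esub> c \<odot>\<^bsub>V\<^esub> act q = T (act q) \<oplus>\<^bsub>V\<^esub> eval (\<one> # p) c \<odot>\<^bsub>V\<^esub> x"
    using act_division[of "\<one> # p" c] c(1) by auto
  obtain r where r: "q = \<one> # r" using q(2,3) \<open>p \<noteq> []\<close> by (cases q) auto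
  have aq: "act q \<in> carrier V" using q(1) by simp
  have "T (act q) = c \<odot>\<^bsub>V\<^esub> act q" using q(4) p c x aq by simp
  \<comment> \<open>The quotient is monic, \<open>q = \<one> # r\<close> with \<open>r\<close> one
    shorter than \<open>p\<close>; if it annihilated \<open>x\<close>, this would contradict the
    choice of \<open>p\<close>.\<close>
  moreover have "act q \<noteq> \<zero>\<^bsub>V\<^esub>" using min[of r] q(1,2) r by auto
  ultimately show ?thesis using c(1) aq by blast
qed

end

section \<open>Fitting's lemma and split monomorphisms\<close>

lemma indecomposableD:
  assumes "indecomposable A L"
  shows "carrier L \<noteq> {\<zero>\<^bsub>L\<^esub>}"
    and "\<And>U V. Module.submodule U A L \<Longrightarrow> Module.submodule V A L \<Longrightarrow> U \<inter> V = {\<zero>\<^bsub>L\<^esub>} \<Longrightarrow>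
      U <+>\<^bsub>L\<^esub> V = carrier L \<Longrightarrow> U = {\<zero>\<^bsub>L\<^esub>} \<or> V = {\<zero>\<^bsub>L\<^esub>}"
  using assms unfolding indecomposable_def by blast+

lemma module_hom_funpow:
  "f \<in> module_hom A L L \<Longrightarrow> (f ^^ n) \<in> module_hom A L L"
proof (induction n)
  case 0
  show ?case using module_hom_id by (simp add: id_def)
next
  case (Suc n)
  then show ?case using module_hom_comp[of "f ^^ n" A L L f L] by (simp add: comp_def)
qed

lemma split_monoI:
  assumes "f \<in> module_hom A M N" "r \<in> module_hom A N M" "\<And>x. x \<in> carrier M \<Longrightarrow> r (f x) = x"
  shows "split_mono A M N f"
  using assms by (auto simp: split_mono_def)

lemma split_monoD:
  assumes "split_mono A M N f"
  obtains r where "r \<in> module_hom A N M" "\<And>x. x \<in> carrier M \<Longrightarrow> r (f x) = x"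
  using assms by (auto simp: split_mono_def)

lemma split_mono_inj: "split_mono A M N f \<Longrightarrow> inj_on f (carrier M)"
  by (metis inj_on_inverseI split_mono_def)

text \<open>A retraction of the composite, precomposed with \<open>g\<close>, is a retraction of
  \<open>h\<close>.\<close>

lemma split_mono_comp_imp:
  assumes "h \<in> module_hom A L M" "g \<in> module_hom A M N" "split_mono A L N (\<lambda>x. g (h x))"
  shows "split_mono A L M h"
proof -
  obtain r where r: "r \<in> module_hom A N L" "\<And>x. x \<in> carrier L \<Longrightarrow> r (g (h x)) = x"
    using assms(3) by (rule split_monoD) blast
  show ?thesis
    by (rule split_monoI[OF assms(1) module_hom_comp[OF assms(2) r(1)]]) (use r in auto)
qed

lemma split_mono_cong:
  assumes "left_module A M" "\<And>x. x \<in> carrier M \<Longrightarrow> f x = g x"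
  shows "split_mono A M N f \<longleftrightarrow> split_mono A M N g"
proof -
  interpret left_module A M by fact
  have "f \<in> module_hom A M N \<longleftrightarrow> g \<in> module_hom A M N"
    using module_hom_cong[of f N g] module_hom_cong[of g N f] assms(2) by auto
  then show ?thesis using assms(2) by (simp add: split_mono_def)
qed

text \<open>With a retraction \<open>r\<close>, the module \<open>M\<close> is the direct sum of the
  image of \<open>h\<close> and the kernel of \<open>r\<close>. The image is nonzero, so the kernel
  vanishes and \<open>r\<close> inverts \<open>h\<close> on both sides.\<close>

lemma split_mono_onto_indecomposable:
  assumes L: "left_module A L" and "carrier L \<noteq> {\<zero>\<^bsub>L\<^esub>}" and M: "left_module A M" "indecomposable A M"
    and h: "split_mono A L M h"
  shows "bij_betw h (carrier L) (carrier M)"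
proof -
  obtain r where r: "r \<in> module_hom A M L" "\<And>x. x \<in> carrier L \<Longrightarrow> r (h x) = x"
    using h by (rule split_monoD) blast
  have hom: "h \<in> module_hom A L M" using h by (simp add: split_mono_def)
  interpret h: left_module_hom A L M h by (rule left_module_homI[OF L M(1) hom])
  interpret r: left_module_hom A M L r by (rule left_module_homI[OF M(1) L r(1)])
  let ?U = "h ` carrier L" and ?V = "{y \<in> carrier M. r y = \<zero>\<^bsub>L\<^esub>}"
  have "?U = {\<zero>\<^bsub>M\<^esub>} \<or> ?V = {\<zero>\<^bsub>M\<^esub>}"
  proof (rule indecomposableD(2)[OF M(2)])
    show "Module.submodule ?U A M" by (rule h.image_submodule[OF h.M.submodule_self])
    show "Module.submodule ?V A M" by (rule r.kernel_submodule)
    show "?U \<inter> ?V = {\<zero>\<^bsub>M\<^esub>}"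
      using r(2) h.zero by (auto simp: image_iff) (metis h.M.M.zero_closed h.zero)
    show "?U <+>\<^bsub>M\<^esub> ?V = carrier M"
    proof
      show "?U <+>\<^bsub>M\<^esub> ?V \<subseteq> carrier M" by (auto simp: h.N.add_sum_iff)
      show "carrier M \<subseteq> ?U <+>\<^bsub>M\<^esub> ?V"
      proof
        fix y assume y: "y \<in> carrier M"
        \<comment> \<open>The idempotent \<open>h\<close> after \<open>r\<close> splits
          \<open>y\<close> into its parts in the image of \<open>h\<close> and in the kernel of
          \<open>r\<close>.\<close>
        have "y = h (r y) \<oplus>\<^bsub>M\<^esub> (y \<ominus>\<^bsub>M\<^esub> h (r y))" using y by (simp add: h.N.M.minus_eq h.N.M.a_ac h.N.M.r_neg)
        moreover have "y \<ominus>\<^bsub>M\<^esub> h (r y) \<in> ?V" using y r(2) by (simp add: h.M.M.minus_eq h.M.M.r_neg)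
        moreover have "h (r y) \<in> ?U" using y by blast
        ultimately show "y \<in> ?U <+>\<^bsub>M\<^esub> ?V" unfolding h.N.add_sum_iff by blast
      qed
    qed
  qed
  moreover have "?U \<noteq> {\<zero>\<^bsub>M\<^esub>}"
  proof
    assume U: "?U = {\<zero>\<^bsub>M\<^esub>}"
    have "x = \<zero>\<^bsub>L\<^esub>" if "x \<in> carrier L" for x
      using r(2)[OF that] U that by (metis imageI r.zero singletonD)
    then show False using assms(2) h.M.M.zero_closed by blast
  qed
  ultimately have V: "?V = {\<zero>\<^bsub>M\<^esub>}" by blast
  have "h (r y) = y" if y: "y \<in> carrier M" for y
  proof -
    have "y \<ominus>\<^bsub>M\<^esub> h (r y) \<in> ?V" using y r(2) by (simp add: h.M.M.minus_eq h.M.M.r_neg)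
    then have "y \<ominus>\<^bsub>M\<^esub> h (r y) = \<zero>\<^bsub>M\<^esub>" unfolding V by blast
    then show ?thesis using y by simp
  qed
  then show ?thesis using r(2) by (intro bij_betwI[where g = r]) auto
qed

context fd_modules
begin

lemma endo_inj_imp_bij:
  assumes "fd_module K A L" "f \<in> module_hom A L L" "inj_on f (carrier L)"
  shows "bij_betw f (carrier L) (carrier L)"
proof -
  note L = fd_moduleD[OF assms(1)]
  interpret UL: vectorspace K "underlying_space A L" by (rule underlying_vectorspace[OF L(1)])
  show ?thesis
    using UL.inj_iff_surj_endo[OF L(2) module_hom_underlying[OF assms(2)]] assms(3)
    by (simp add: bij_betw_def)
qed

text \<open>For a suitable positive power g of \<open>f\<close>, the module is the direct sum of the
  image and the kernel of g. If the image is zero then \<open>f\<close> is nilpotent, and if the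
  kernel is zero then \<open>f\<close> is injective.\<close>

theorem fitting:
  assumes L: "fd_module K A L" "indecomposable A L" and f: "f \<in> module_hom A L L"
  shows "inj_on f (carrier L) \<or> (\<exists>n. \<forall>x\<in>carrier L. (f ^^ n) x = \<zero>\<^bsub>L\<^esub>)"
proof -
  note LL = fd_moduleD[OF L(1)]
  interpret L: left_module A L by (rule LL)
  interpret UL: vectorspace K "underlying_space A L" by (rule underlying_vectorspace[OF LL(1)])
  have hom: "left_module_hom A L L (f ^^ n)" for n
    by (rule left_module_homI[OF LL(1) LL(1) module_hom_funpow[OF f]])
  have im: "Module.submodule ((f ^^ n) ` carrier L) A L" for n
    by (rule left_module_hom.image_submodule[OF hom L.submodule_self])
  \<comment> \<open>The image of least dimension among the positive powers replaces a stabilisation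
    argument. Positive powers only, so that the kernel of \<open>f\<close> lies in the kernel of the
    chosen power.\<close>
  let ?d = "\<lambda>n. vectorspace.dim K (UL.vs ((f ^^ Suc n) ` carrier L))"
  obtain k where k: "\<And>m. ?d k \<le> ?d m"
    using ex_has_least_nat[of "\<lambda>_. True" 0 ?d] by blast
  define g where "g = f ^^ Suc k"
  interpret g: left_module_hom A L L g unfolding g_def by (rule hom)
  let ?I = "g ` carrier L" and ?N = "{x \<in> carrier L. g x = \<zero>\<^bsub>L\<^esub>}"
  have subI: "Module.submodule ?I A L" unfolding g_def by (rule im)
  have IL: "?I \<subseteq> carrier L" by auto
  \<comment> \<open>The square of \<open>g\<close> is again a positive power, so minimality of
    \<open>k\<close> applies to it.\<close>
  have gg: "g (g x) = (f ^^ Suc (k + Suc k)) x" for x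
    unfolding g_def add_Suc[symmetric] funpow_add by (rule comp_apply[symmetric])
  have gI: "g ` ?I = ?I"
  proof (rule UL.subspace_dim_mono(2)[OF LL(2)])
    show "subspace K (g ` ?I) (underlying_space A L)"
      by (rule submodule_subspace[OF LL(1) g.image_submodule[OF subI]])
    show "subspace K ?I (underlying_space A L)" by (rule submodule_subspace[OF LL(1) subI])
    show "g ` ?I \<subseteq> ?I" by auto
    have "g ` ?I = (f ^^ Suc (k + Suc k)) ` carrier L" unfolding image_image gg ..
    then have "?d k \<le> vectorspace.dim K (UL.vs (g ` ?I))" using k by presburger
    moreover have "vectorspace.dim K (UL.vs (g ` ?I)) \<le> vectorspace.dim K (UL.vs ?I)"
      by (rule UL.subspace_dim_mono(1)[OF LL(2)]) fact+
    ultimately show "vectorspace.dim K (UL.vs (g ` ?I)) = vectorspace.dim K (UL.vs ?I)"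
      unfolding g_def by linarith
  qed
  have sI: "subspace K ?I (underlying_space A L)" by (rule submodule_subspace[OF LL(1) subI])
  interpret I: vectorspace K "UL.vs ?I" by (rule UL.subspace_is_vs[OF sI])
  have "inj_on g ?I"
  proof -
    have "g \<in> module_hom K (UL.vs ?I) (UL.vs ?I)"
      by (rule module_homI) (use IL in \<open>auto simp: L.smult_closed\<close>)
    then show ?thesis
      using I.inj_iff_surj_endo[OF UL.subspace_fin_dim[OF LL(2) sI]] gI by simp
  qed
  have int: "?I \<inter> ?N = {\<zero>\<^bsub>L\<^esub>}"
  proof
    have z: "\<zero>\<^bsub>L\<^esub> \<in> ?I" using g.zero by (metis L.M.zero_closed imageI)
    then show "{\<zero>\<^bsub>L\<^esub>} \<subseteq> ?I \<inter> ?N" by simp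
    show "?I \<inter> ?N \<subseteq> {\<zero>\<^bsub>L\<^esub>}"
    proof
      fix y assume y: "y \<in> ?I \<inter> ?N"
      then have "g y = g \<zero>\<^bsub>L\<^esub>" by simp
      then show "y \<in> {\<zero>\<^bsub>L\<^esub>}" using inj_onD[OF \<open>inj_on g ?I\<close> _ _ z, of y] y by blast
    qed
  qed
  have sum: "?I <+>\<^bsub>L\<^esub> ?N = carrier L"
  proof
    show "?I <+>\<^bsub>L\<^esub> ?N \<subseteq> carrier L" by (auto simp: L.add_sum_iff)
    show "carrier L \<subseteq> ?I <+>\<^bsub>L\<^esub> ?N"
    proof
      fix x assume x: "x \<in> carrier L"
      then have "g x \<in> g ` ?I" unfolding gI by blast
      then obtain y where y: "y \<in> carrier L" "g x = g (g y)" by blast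
      then have "x = g y \<oplus>\<^bsub>L\<^esub> (x \<ominus>\<^bsub>L\<^esub> g y)" "x \<ominus>\<^bsub>L\<^esub> g y \<in> ?N" "g y \<in> ?I"
        using x by (simp_all add: L.M.minus_eq L.M.a_ac L.M.r_neg)
      then show "x \<in> ?I <+>\<^bsub>L\<^esub> ?N" unfolding L.add_sum_iff by blast
    qed
  qed
  consider "?I = {\<zero>\<^bsub>L\<^esub>}" | "?N = {\<zero>\<^bsub>L\<^esub>}"
    using indecomposableD(2)[OF L(2) subI g.kernel_submodule int sum] by blast
  then show ?thesis
  proof cases
    case 1
    then have "\<forall>x\<in>carrier L. (f ^^ Suc k) x = \<zero>\<^bsub>L\<^esub>" unfolding g_def by blast
    then show ?thesis by blast
  next
    case 2
    interpret f: left_module_hom A L L f by (rule left_module_homI[OF LL(1) LL(1) f])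
    interpret fk: left_module_hom A L L "f ^^ k" by (rule hom)
    have "x = \<zero>\<^bsub>L\<^esub>" if "x \<in> carrier L" "f x = \<zero>\<^bsub>L\<^esub>" for x
    proof -
      have "g x = (f ^^ k) (f x)" by (simp add: g_def funpow_swap1)
      then have "x \<in> ?N" using that fk.zero by simp
      then show ?thesis using 2 by blast
    qed
    then show ?thesis using f.inj_iff by blast
  qed
qed

text \<open>This is locality of \<open>End(L)\<close>: the noninvertible endomorphisms are closed
  under addition. Multiplying by the inverse of the sum reduces to the case where the sum is the
  identity.\<close>

lemma endo_sum_inj:
  assumes L: "fd_module K A L" "indecomposable A L"
    and f: "f \<in> module_hom A L L" and g: "g \<in> module_hom A L L"
    and inj: "inj_on (\<lambda>x. f x \<oplus>\<^bsub>L\<^esub> g x) (carrier L)"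
  shows "inj_on f (carrier L) \<or> inj_on g (carrier L)"
proof (rule disjCI)
  assume ng: "\<not> inj_on g (carrier L)"
  note LL = fd_moduleD[OF L(1)]
  interpret L: left_module A L by (rule LL)
  interpret f: left_module_hom A L L f by (rule left_module_homI[OF LL(1) LL(1) f])
  interpret g: left_module_hom A L L g by (rule left_module_homI[OF LL(1) LL(1) g])
  let ?s = "\<lambda>x. f x \<oplus>\<^bsub>L\<^esub> g x"
  have s: "?s \<in> module_hom A L L" by (rule f.sum_hom[OF g])
  have bij: "bij_betw ?s (carrier L) (carrier L)" by (rule endo_inj_imp_bij[OF L(1) s inj])
  define h where "h = inv_into (carrier L) ?s"
  have h: "h \<in> module_hom A L L" unfolding h_def
    by (rule left_module_hom.inverse_hom[OF left_module_homI[OF LL(1) LL(1) s] bij])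
  interpret h: left_module_hom A L L h by (rule left_module_homI[OF LL(1) LL(1) h])
  have hs: "h (f x) \<oplus>\<^bsub>L\<^esub> h (g x) = x" if "x \<in> carrier L" for x
    using that inv_into_f_f[OF inj, of x] h.add[of "f x" "g x"] by (simp add: h_def del: h.add)
  define k where "k = (\<lambda>x. h (g x))"
  have k: "k \<in> module_hom A L L" unfolding k_def by (rule module_hom_comp[OF g h])
  have "\<not> inj_on k (carrier L)"
    using ng unfolding k_def inj_on_def by metis
  then obtain n where n: "\<And>x. x \<in> carrier L \<Longrightarrow> (k ^^ n) x = \<zero>\<^bsub>L\<^esub>"
    using fitting[OF L k] by blast
  have "x = \<zero>\<^bsub>L\<^esub>" if x: "x \<in> carrier L" and fx: "f x = \<zero>\<^bsub>L\<^esub>" for x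
  proof -
    \<comment> \<open>On the kernel of \<open>f\<close> the equation \<open>hs\<close> reduces to
      \<open>k x = x\<close>, which is incompatible with nilpotence of \<open>k\<close> unless
      \<open>x\<close> is zero.\<close>
    have "k x = x" using hs[OF x] fx x by (simp add: k_def)
    then have "(k ^^ m) x = x" for m by (induction m) auto
    then show ?thesis using n[OF x] by metis
  qed
  then show "inj_on f (carrier L)" using f.inj_iff by blast
qed

lemma endo_inj_iff_split_mono:
  assumes "fd_module K A L" "f \<in> module_hom A L L"
  shows "split_mono A L L f \<longleftrightarrow> inj_on f (carrier L)"
proof
  note LL = fd_moduleD(1)[OF assms(1)]
  assume inj: "inj_on f (carrier L)"
  show "split_mono A L L f"
    by (rule split_monoI[OF assms(2)
        left_module_hom.inverse_hom[OF left_module_homI[OF LL LL assms(2)] endo_inj_imp_bij[OF assms inj]]])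
      (use inj in simp)
qed (rule split_mono_inj)

text \<open>The endomorphism \<open>r\<close> after \<open>h\<close> is invertible in finite
  dimension; its inverse after \<open>r\<close> is a retraction of \<open>h\<close>.\<close>

lemma split_mono_of_inj_retract:
  assumes L: "fd_module K A L" and h: "h \<in> module_hom A L M" and r: "r \<in> module_hom A M L"
    and "inj_on (\<lambda>x. r (h x)) (carrier L)"
  shows "split_mono A L M h"
  by (rule split_mono_comp_imp[OF h r]) (use endo_inj_iff_split_mono[OF L module_hom_comp[OF h r]] assms in simp)

text \<open>In contrapositive form: the radical is closed under addition. A retraction of the sum
  carries both terms to endomorphisms of \<open>L\<close>, where locality applies.\<close>

lemma split_mono_sum:
  assumes L: "fd_module K A L" "indecomposable A L" and M: "left_module A M"
    and f: "f \<in> module_hom A L M" and g: "g \<in> module_hom A L M"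
    and "split_mono A L M (\<lambda>x. f x \<oplus>\<^bsub>M\<^esub> g x)"
  shows "split_mono A L M f \<or> split_mono A L M g"
proof -
  note LL = fd_moduleD(1)[OF L(1)]
  obtain r where r: "r \<in> module_hom A M L" "\<And>x. x \<in> carrier L \<Longrightarrow> r (f x \<oplus>\<^bsub>M\<^esub> g x) = x"
    using assms(6) by (rule split_monoD) blast
  interpret r: left_module_hom A M L r by (rule left_module_homI[OF M LL r(1)])
  have "inj_on (\<lambda>x. r (f x) \<oplus>\<^bsub>L\<^esub> r (g x)) (carrier L)"
    using r(2) module_hom_in[OF f] module_hom_in[OF g] by (intro inj_onI) (metis r.add)
  then show ?thesis
    using endo_sum_inj[OF L module_hom_comp[OF f r(1)] module_hom_comp[OF g r(1)]]
      split_mono_of_inj_retract[OF L(1) f r(1)] split_mono_of_inj_retract[OF L(1) g r(1)] by blast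
qed

end

section \<open>Direct sum decompositions\<close>

lemma bij_module_iso:
  "f \<in> module_hom A M N \<Longrightarrow> bij_betw f (carrier M) (carrier N) \<Longrightarrow> module_iso A M N"
  by (auto simp: module_iso_def)

lemma module_isoE:
  assumes "module_iso A M N" "left_module A M" "left_module A N"
  obtains f g where "f \<in> module_hom A M N" "g \<in> module_hom A N M"
    "\<And>x. x \<in> carrier M \<Longrightarrow> g (f x) = x" "\<And>y. y \<in> carrier N \<Longrightarrow> f (g y) = y"
proof -
  obtain f where f: "f \<in> module_hom A M N" "bij_betw f (carrier M) (carrier N)"
    using assms(1) by (auto simp: module_iso_def)
  then show thesis
    using that[OF f(1) left_module_hom.inverse_hom[OF left_module_homI[OF assms(2,3) f(1)] f(2)]]
    by (simp add: bij_betw_def f_inv_into_f)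
qed

lemma module_isoI:
  assumes "f \<in> module_hom A M N" "g \<in> module_hom A N M"
    "\<And>x. x \<in> carrier M \<Longrightarrow> g (f x) = x" "\<And>y. y \<in> carrier N \<Longrightarrow> f (g y) = y"
  shows "module_iso A M N"
  by (rule bij_module_iso[OF assms(1)], rule bij_betwI[where g = g])
    (use assms module_hom_in[OF assms(1)] module_hom_in[OF assms(2)] in auto)

lemma module_iso_refl: "module_iso A M M"
  by (rule module_isoI[OF module_hom_id module_hom_id]) auto

section \<open>External direct sums\<close>

lemma dsum_simps [simp]:
  "f \<in> carrier (dsum I F) \<longleftrightarrow> f \<in> (\<Pi>\<^sub>E i\<in>I. carrier (F i)) \<and> finite {i \<in> I. f i \<noteq> \<zero>\<^bsub>F i\<^esub>}"
  "zero (dsum I F) = (\<lambda>i\<in>I. \<zero>\<^bsub>F i\<^esub>)"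
  "f \<oplus>\<^bsub>dsum I F\<^esub> g = (\<lambda>i\<in>I. f i \<oplus>\<^bsub>F i\<^esub> g i)"
  "a \<odot>\<^bsub>dsum I F\<^esub> f = (\<lambda>i\<in>I. a \<odot>\<^bsub>F i\<^esub> f i)"
  by (simp_all add: dsum_def)

lemma dsum_left_module:
  assumes A: "ring A" and F: "\<And>i. i \<in> I \<Longrightarrow> left_module A (F i)"
  shows "left_module A (dsum I F)"
proof -
  interpret A: ring A by fact
  have ag: "abelian_group (F i)" if "i \<in> I" for i
    using F[OF that] by (simp add: left_module_def)
  note am = abelian_group.axioms(1)[OF ag]
  have fin_add: "finite {i \<in> I. f i \<oplus>\<^bsub>F i\<^esub> g i \<noteq> \<zero>\<^bsub>F i\<^esub>}"
    if "finite {i \<in> I. f i \<noteq> \<zero>\<^bsub>F i\<^esub>}" "finite {i \<in> I. g i \<noteq> \<zero>\<^bsub>F i\<^esub>}" for f g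
    by (rule finite_subset[OF _ finite_UnI[OF that]])
      (use abelian_monoid.l_zero[OF am] abelian_monoid.zero_closed[OF am] in auto)
  have fin_smult: "finite {i \<in> I. a \<odot>\<^bsub>F i\<^esub> f i \<noteq> \<zero>\<^bsub>F i\<^esub>}"
    if "finite {i \<in> I. f i \<noteq> \<zero>\<^bsub>F i\<^esub>}" "a \<in> carrier A" for f a
    by (rule finite_subset[OF _ that(1)]) (use that(2) left_module.smult_zero_right[OF F] in auto)
  show ?thesis
  proof (intro left_module.intro left_module_axioms.intro abelian_groupI)
    show "ring A" by fact
    show "f \<oplus>\<^bsub>dsum I F\<^esub> g \<in> carrier (dsum I F)"
      if "f \<in> carrier (dsum I F)" "g \<in> carrier (dsum I F)" for f g
      using that fin_add[of f g] abelian_monoid.a_closed[OF am] by (auto simp: PiE_iff cong: conj_cong)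
    show "\<zero>\<^bsub>dsum I F\<^esub> \<in> carrier (dsum I F)"
      using abelian_monoid.zero_closed[OF am] by auto
    show "a \<odot>\<^bsub>dsum I F\<^esub> f \<in> carrier (dsum I F)"
      if "a \<in> carrier A" "f \<in> carrier (dsum I F)" for a f
      using that fin_smult[of f a] left_module.smult_closed[OF F] by (auto simp: PiE_iff cong: conj_cong)
    show "\<exists>g\<in>carrier (dsum I F). g \<oplus>\<^bsub>dsum I F\<^esub> f = \<zero>\<^bsub>dsum I F\<^esub>"
      if f: "f \<in> carrier (dsum I F)" for f
    proof (rule bexI[of _ "\<lambda>i\<in>I. \<ominus>\<^bsub>F i\<^esub> f i"])
      show "(\<lambda>i\<in>I. \<ominus>\<^bsub>F i\<^esub> f i) \<oplus>\<^bsub>dsum I F\<^esub> f = \<zero>\<^bsub>dsum I F\<^esub>"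
        using f abelian_group.l_neg[OF ag] by (auto simp: fun_eq_iff PiE_iff)
      have "{i \<in> I. (\<lambda>i\<in>I. \<ominus>\<^bsub>F i\<^esub> f i) i \<noteq> \<zero>\<^bsub>F i\<^esub>} \<subseteq> {i \<in> I. f i \<noteq> \<zero>\<^bsub>F i\<^esub>}"
      proof safe
        fix i assume i: "i \<in> I" and nz: "(\<lambda>i\<in>I. \<ominus>\<^bsub>F i\<^esub> f i) i \<noteq> \<zero>\<^bsub>F i\<^esub>" and "f i = \<zero>\<^bsub>F i\<^esub>"
        interpret left_module A "F i" by (rule F[OF i])
        show False using i nz \<open>f i = \<zero>\<^bsub>F i\<^esub>\<close> by simp
      qed
      then have "finite {i \<in> I. (\<lambda>i\<in>I. \<ominus>\<^bsub>F i\<^esub> f i) i \<noteq> \<zero>\<^bsub>F i\<^esub>}"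
        by (rule finite_subset) (use f in simp)
      then show "(\<lambda>i\<in>I. \<ominus>\<^bsub>F i\<^esub> f i) \<in> carrier (dsum I F)"
        unfolding dsum_simps using f abelian_group.a_inv_closed[OF ag] by (simp add: PiE_iff)
    qed
    show "f \<oplus>\<^bsub>dsum I F\<^esub> g \<oplus>\<^bsub>dsum I F\<^esub> h = f \<oplus>\<^bsub>dsum I F\<^esub> (g \<oplus>\<^bsub>dsum I F\<^esub> h)"
      if "f \<in> carrier (dsum I F)" "g \<in> carrier (dsum I F)" "h \<in> carrier (dsum I F)" for f g h
      using that abelian_monoid.a_assoc[OF am] by (auto simp: fun_eq_iff PiE_iff)
    show "f \<oplus>\<^bsub>dsum I F\<^esub> g = g \<oplus>\<^bsub>dsum I F\<^esub> f"
      if "f \<in> carrier (dsum I F)" "g \<in> carrier (dsum I F)" for f g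
      using that abelian_monoid.a_comm[OF am] by (auto simp: fun_eq_iff PiE_iff)
    show "\<zero>\<^bsub>dsum I F\<^esub> \<oplus>\<^bsub>dsum I F\<^esub> f = f" if "f \<in> carrier (dsum I F)" for f
      using that abelian_monoid.l_zero[OF am] by (auto simp: fun_eq_iff PiE_iff extensional_def)
    show "(a \<oplus>\<^bsub>A\<^esub> b) \<odot>\<^bsub>dsum I F\<^esub> f = a \<odot>\<^bsub>dsum I F\<^esub> f \<oplus>\<^bsub>dsum I F\<^esub> b \<odot>\<^bsub>dsum I F\<^esub> f"
      if "a \<in> carrier A" "b \<in> carrier A" "f \<in> carrier (dsum I F)" for a b f
      using that left_module.smult_l_distr[OF F] by (auto simp: fun_eq_iff PiE_iff)
    show "a \<odot>\<^bsub>dsum I F\<^esub> (f \<oplus>\<^bsub>dsum I F\<^esub> g) = a \<odot>\<^bsub>dsum I F\<^esub> f \<oplus>\<^bsub>dsum I F\<^esub> a \<odot>\<^bsub>dsum I F\<^esub> g"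
      if "a \<in> carrier A" "f \<in> carrier (dsum I F)" "g \<in> carrier (dsum I F)" for a f g
      using that left_module.smult_r_distr[OF F] by (auto simp: fun_eq_iff PiE_iff)
    show "(a \<otimes>\<^bsub>A\<^esub> b) \<odot>\<^bsub>dsum I F\<^esub> f = a \<odot>\<^bsub>dsum I F\<^esub> (b \<odot>\<^bsub>dsum I F\<^esub> f)"
      if "a \<in> carrier A" "b \<in> carrier A" "f \<in> carrier (dsum I F)" for a b f
      using that left_module.smult_assoc[OF F] by (auto simp: fun_eq_iff PiE_iff)
    show "\<one>\<^bsub>A\<^esub> \<odot>\<^bsub>dsum I F\<^esub> f = f" if "f \<in> carrier (dsum I F)" for f
      using that left_module.smult_one[OF F] by (auto simp: fun_eq_iff PiE_iff extensional_def)
  qed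
qed

text \<open>An internal description of a direct sum that applies to \<open>dsum\<close>, to
  isomorphic copies and to splittings into submodules alike. The identity "x is the sum of its
  components" would need infinite sums; finite support and joint injectivity of the projections take
  its place.\<close>

locale decomposition = left_module A M
  for A :: "('k, 'a) module" and M :: "('a, 'm) module" (structure) +
  fixes I :: "'i set" and F :: "'i \<Rightarrow> ('a, 'n) module"
    and emb :: "'i \<Rightarrow> 'n \<Rightarrow> 'm" and proj :: "'i \<Rightarrow> 'm \<Rightarrow> 'n"
  assumes summand: "i \<in> I \<Longrightarrow> left_module A (F i)"
    and emb: "i \<in> I \<Longrightarrow> emb i \<in> module_hom A (F i) M"
    and proj: "i \<in> I \<Longrightarrow> proj i \<in> module_hom A M (F i)"
    and proj_emb: "i \<in> I \<Longrightarrow> j \<in> I \<Longrightarrow> y \<in> carrier (F i) \<Longrightarrow>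
      proj j (emb i y) = (if j = i then y else \<zero>\<^bsub>F j\<^esub>)"
    and finite_support: "x \<in> carrier M \<Longrightarrow> finite {i \<in> I. proj i x \<noteq> \<zero>\<^bsub>F i\<^esub>}"
    and proj_jointly_inj: "x \<in> carrier M \<Longrightarrow> (\<And>i. i \<in> I \<Longrightarrow> proj i x = \<zero>\<^bsub>F i\<^esub>) \<Longrightarrow> x = \<zero>"
begin

lemma emb_hom: "i \<in> I \<Longrightarrow> left_module_hom A (F i) M (emb i)"
  by (rule left_module_homI[OF summand _ emb]) (auto intro: left_module_axioms)

lemma proj_hom: "i \<in> I \<Longrightarrow> left_module_hom A M (F i) (proj i)"
  by (rule left_module_homI[OF _ summand proj]) (auto intro: left_module_axioms)

lemma proj_add:
  "i \<in> I \<Longrightarrow> x \<in> carrier M \<Longrightarrow> y \<in> carrier M \<Longrightarrow> proj i (x \<oplus> y) = proj i x \<oplus>\<^bsub>F i\<^esub> proj i y"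
  using left_module_hom.add[OF proj_hom] .

lemma proj_eqI:
  assumes "x \<in> carrier M" "y \<in> carrier M" "\<And>i. i \<in> I \<Longrightarrow> proj i x = proj i y"
  shows "x = y"
proof -
  have "x \<ominus> y = \<zero>"
  proof (rule proj_jointly_inj)
    fix i assume i: "i \<in> I"
    interpret p: left_module_hom A M "F i" "proj i" by (rule proj_hom[OF i])
    show "proj i (x \<ominus> y) = \<zero>\<^bsub>F i\<^esub>" using assms i by simp
  qed (use assms in simp)
  then show ?thesis using assms by simp
qed

text \<open>The supports of the elements are finite even if the index set is not.\<close>

lemma submodule_eq_carrier:
  assumes U: "Module.submodule U A M" and emb_U: "\<And>i y. i \<in> I \<Longrightarrow> y \<in> carrier (F i) \<Longrightarrow> emb i y \<in> U"
  shows "U = carrier M"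
proof -
  have "x \<in> U" if "finite S" "S \<subseteq> I" "x \<in> carrier M" "\<And>i. i \<in> I - S \<Longrightarrow> proj i x = \<zero>\<^bsub>F i\<^esub>" for S x
    using that
  proof (induction S arbitrary: x rule: finite_induct)
    case empty
    then have "x = \<zero>" by (intro proj_jointly_inj) auto
    then show ?case using U by (simp add: submodule_iff)
  next
    case (insert i S)
    then have i: "i \<in> I" and x: "x \<in> carrier M" by auto
    let ?y = "emb i (proj i x)"
    interpret p: left_module_hom A M "F i" "proj i" by (rule proj_hom[OF i])
    interpret e: left_module_hom A "F i" M "emb i" by (rule emb_hom[OF i])
    have y: "?y \<in> U" "?y \<in> carrier M" using x i emb_U by auto
    have "x \<ominus> ?y \<in> U"
    proof (rule insert.IH)
      fix j assume j: "j \<in> I - S"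
      interpret pj: left_module_hom A M "F j" "proj j" by (rule proj_hom) (use j in simp)
      have "proj j (x \<ominus> ?y) = proj j x \<ominus>\<^bsub>F j\<^esub> (if j = i then proj i x else \<zero>\<^bsub>F j\<^esub>)"
        using x y j i proj_emb[OF i, of j "proj i x"] by simp
      moreover have "proj j x \<ominus>\<^bsub>F j\<^esub> proj j x = \<zero>\<^bsub>F j\<^esub>"
        using x by (simp add: pj.N.M.minus_eq pj.N.M.r_neg)
      ultimately show "proj j (x \<ominus> ?y) = \<zero>\<^bsub>F j\<^esub>"
        using insert.prems(3)[of j] j by (cases "j = i") (auto simp: pj.N.M.minus_eq)
    qed (use insert.prems x y in auto)
    then have "(x \<ominus> ?y) \<oplus> ?y \<in> U" using U y by (simp add: submodule_iff)
    then show ?case using x y by (simp add: M.minus_eq M.a_assoc M.l_neg)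
  qed
  then have "x \<in> U" if "x \<in> carrier M" for x
    using finite_support[OF that] that by auto
  then show ?thesis using U by (auto simp: submodule_iff)
qed

text \<open>The map is the sum of \<open>emb i\<close> after \<open>u i\<close> over
  \<open>S\<close>, built one summand at a time. The invariant \<open>P\<close> lets a property that
  survives each addition, such as not being a split monomorphism, pass to the whole sum.\<close>

lemma hom_assemble:
  assumes "left_module A L" "finite S" "S \<subseteq> I" "\<And>i. i \<in> S \<Longrightarrow> u i \<in> module_hom A L (F i)"
    and zero: "P (\<lambda>x. \<zero>)"
    and add: "\<And>g i. i \<in> S \<Longrightarrow> g \<in> module_hom A L M \<Longrightarrow> P g \<Longrightarrow> P (\<lambda>x. g x \<oplus> emb i (u i x))"
  shows "\<exists>g\<in>module_hom A L M. P g \<and>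
    (\<forall>x\<in>carrier L. \<forall>j\<in>I. proj j (g x) = (if j \<in> S then u j x else \<zero>\<^bsub>F j\<^esub>))"
  using assms(2-4) add
proof (induction S rule: finite_induct)
  case empty
  have "(\<lambda>x. \<zero>) \<in> module_hom A L M" by (rule module_hom_zero_map[OF left_module_axioms])
  moreover have "proj j \<zero> = \<zero>\<^bsub>F j\<^esub>" if "j \<in> I" for j
    using left_module_hom.zero[OF proj_hom[OF that]] .
  ultimately show ?case using zero by auto
next
  case (insert i S)
  have i: "i \<in> I" using insert.prems by simp
  have u: "u i \<in> module_hom A L (F i)" using insert.prems by simp
  have "\<exists>g\<in>module_hom A L M. P g \<and>
    (\<forall>x\<in>carrier L. \<forall>j\<in>I. proj j (g x) = (if j \<in> S then u j x else \<zero>\<^bsub>F j\<^esub>))"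
    by (rule insert.IH) (use insert.prems in auto)
  then obtain g where g: "g \<in> module_hom A L M" "P g"
    "\<And>x j. x \<in> carrier L \<Longrightarrow> j \<in> I \<Longrightarrow> proj j (g x) = (if j \<in> S then u j x else \<zero>\<^bsub>F j\<^esub>)"
    by blast
  interpret g: left_module_hom A L M g
    by (rule left_module_homI[OF assms(1) left_module_axioms g(1)])
  interpret e: left_module_hom A "F i" M "emb i" by (rule emb_hom[OF i])
  show ?case
  proof (intro bexI[of _ "\<lambda>x. g x \<oplus> emb i (u i x)"] conjI ballI)
    show "(\<lambda>x. g x \<oplus> emb i (u i x)) \<in> module_hom A L M"
      by (rule g.sum_hom[OF module_hom_comp[OF u emb[OF i]]])
    show "P (\<lambda>x. g x \<oplus> emb i (u i x))" by (rule insert.prems(3)) (use g in auto)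
    fix x j assume x: "x \<in> carrier L" and j: "j \<in> I"
    interpret pj: left_module_hom A M "F j" "proj j" by (rule proj_hom) (use j in simp)
    have "u i x \<in> carrier (F i)" using u x by (rule module_hom_in)
    moreover have "u j x \<in> carrier (F j)" if "j \<in> insert i S"
      using insert.prems(2)[OF that] x by (rule module_hom_in)
    ultimately show "proj j (g x \<oplus> emb i (u i x)) = (if j \<in> insert i S then u j x else \<zero>\<^bsub>F j\<^esub>)"
      using g(3)[OF x j] x j proj_emb[OF i j, of "u i x"] insert.hyps by auto
  qed
qed

lemma element_assemble:
  assumes "finite S" "S \<subseteq> I" "\<And>i. i \<in> S \<Longrightarrow> w i \<in> carrier (F i)"
  shows "\<exists>x\<in>carrier M. \<forall>j\<in>I. proj j x = (if j \<in> S then w j else \<zero>\<^bsub>F j\<^esub>)"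
  using assms
proof (induction S rule: finite_induct)
  case empty
  have "proj j \<zero> = \<zero>\<^bsub>F j\<^esub>" if "j \<in> I" for j
    using left_module_hom.zero[OF proj_hom[OF that]] .
  then show ?case by (intro bexI[of _ \<zero>]) auto
next
  case (insert i S)
  then obtain x where x: "x \<in> carrier M"
    "\<And>j. j \<in> I \<Longrightarrow> proj j x = (if j \<in> S then w j else \<zero>\<^bsub>F j\<^esub>)" by auto
  have i: "i \<in> I" using insert.prems by simp
  interpret e: left_module_hom A "F i" M "emb i" by (rule emb_hom[OF i])
  show ?case
  proof (intro bexI[of _ "x \<oplus> emb i (w i)"] ballI)
    fix j assume j: "j \<in> I"
    interpret pj: left_module_hom A M "F j" "proj j" by (rule proj_hom[OF j])
    have "w i \<in> carrier (F i)" using insert.prems by simp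
    moreover have "w j \<in> carrier (F j)" if "j \<in> insert i S"
      using insert.prems(2)[OF that] .
    ultimately show "proj j (x \<oplus> emb i (w i)) = (if j \<in> insert i S then w j else \<zero>\<^bsub>F j\<^esub>)"
      using x(2)[OF j] x(1) j proj_emb[OF i j, of "w i"] insert.hyps by auto
  qed (use x insert.prems in simp)
qed

text \<open>The map collects the components. A family with finite support is realised by summing its
  finitely many nonzero entries.\<close>

lemma iso_dsum: "module_iso A M (dsum I F)"
proof (rule bij_module_iso)
  let ?f = "\<lambda>x. \<lambda>i\<in>I. proj i x"
  have pc: "proj i x \<in> carrier (F i)" if "i \<in> I" "x \<in> carrier M" for i x
    using proj[OF that(1)] that(2) by (rule module_hom_in)
  have cl: "?f x \<in> carrier (dsum I F)" if "x \<in> carrier M" for x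
    using that finite_support pc by (auto simp: PiE_iff cong: conj_cong)
  show "?f \<in> module_hom A M (dsum I F)"
  proof (rule module_homI)
    show "?f (x \<oplus> y) = ?f x \<oplus>\<^bsub>dsum I F\<^esub> ?f y" if "x \<in> carrier M" "y \<in> carrier M" for x y
      using that proj_add by (auto simp: fun_eq_iff)
    show "?f (a \<odot> x) = a \<odot>\<^bsub>dsum I F\<^esub> ?f x" if "a \<in> carrier A" "x \<in> carrier M" for a x
      using that left_module_hom.smult[OF proj_hom] by (auto simp: fun_eq_iff)
  qed (rule cl)
  have "inj_on ?f (carrier M)"
    by (rule inj_onI, rule proj_eqI) (auto simp: fun_eq_iff, metis)
  moreover have "carrier (dsum I F) \<subseteq> ?f ` carrier M"
  proof
    fix w assume w: "w \<in> carrier (dsum I F)"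
    let ?S = "{i \<in> I. w i \<noteq> \<zero>\<^bsub>F i\<^esub>}"
    obtain x where x: "x \<in> carrier M" "\<And>j. j \<in> I \<Longrightarrow> proj j x = (if j \<in> ?S then w j else \<zero>\<^bsub>F j\<^esub>)"
      using element_assemble[of ?S w] w by (auto simp: PiE_iff)
    then have "w = ?f x" using w by (auto simp: fun_eq_iff PiE_iff extensional_def)
    then show "w \<in> ?f ` carrier M" using x(1) by blast
  qed
  ultimately show "bij_betw ?f (carrier M) (carrier (dsum I F))"
    unfolding bij_betw_def using cl by blast
qed

lemma transfer_iso:
  assumes N: "left_module A N" and iso: "module_iso A N M"
  shows "\<exists>e p. decomposition A N I F e p"
proof -
  obtain f g where f: "f \<in> module_hom A N M" and g: "g \<in> module_hom A M N"
    and gf: "\<And>x. x \<in> carrier N \<Longrightarrow> g (f x) = x" and fg: "\<And>y. y \<in> carrier M \<Longrightarrow> f (g y) = y"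
    using iso N left_module_axioms by (rule module_isoE) blast
  interpret f: left_module_hom A N M f by (rule left_module_homI[OF N left_module_axioms f])
  interpret g: left_module_hom A M N g by (rule left_module_homI[OF left_module_axioms N g])
  have "decomposition A N I F (\<lambda>i x. g (emb i x)) (\<lambda>i x. proj i (f x))"
  proof (intro decomposition.intro decomposition_axioms.intro)
    show "left_module A N" by fact
    show "left_module A (F i)" if "i \<in> I" for i by (rule summand[OF that])
    show "(\<lambda>x. g (emb i x)) \<in> module_hom A (F i) N" if "i \<in> I" for i
      by (rule module_hom_comp[OF emb[OF that] g])
    show "(\<lambda>x. proj i (f x)) \<in> module_hom A N (F i)" if "i \<in> I" for i
      by (rule module_hom_comp[OF f proj[OF that]])
    show "proj j (f (g (emb i y))) = (if j = i then y else \<zero>\<^bsub>F j\<^esub>)"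
      if "i \<in> I" "j \<in> I" "y \<in> carrier (F i)" for i j y
      using proj_emb[OF that] fg[OF module_hom_in[OF emb]] that by simp
    show "finite {i \<in> I. proj i (f x) \<noteq> \<zero>\<^bsub>F i\<^esub>}" if "x \<in> carrier N" for x
      using finite_support f.in_carrier[OF that] by blast
    show "x = \<zero>\<^bsub>N\<^esub>" if "x \<in> carrier N" "\<And>i. i \<in> I \<Longrightarrow> proj i (f x) = \<zero>\<^bsub>F i\<^esub>" for x
      using proj_jointly_inj[OF f.in_carrier[OF that(1)] that(2)] gf[OF that(1)] g.zero by simp
  qed
  then show ?thesis by blast
qed

end

lemma dsum_decomposition:
  assumes A: "ring A" and F: "\<And>i. i \<in> I \<Longrightarrow> left_module A (F i)"
  shows "decomposition A (dsum I F) I F (\<lambda>i x. \<lambda>j\<in>I. if j = i then x else \<zero>\<^bsub>F j\<^esub>) (\<lambda>i f. f i)"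
proof (intro decomposition.intro decomposition_axioms.intro)
  show "left_module A (dsum I F)" by (rule dsum_left_module[OF assms])
  have ag: "abelian_group (F i)" if "i \<in> I" for i
    using F[OF that] by (simp add: left_module_def)
  note am = abelian_group.axioms(1)[OF ag]
  show "(\<lambda>x. \<lambda>j\<in>I. if j = i then x else \<zero>\<^bsub>F j\<^esub>) \<in> module_hom A (F i) (dsum I F)"
    if i: "i \<in> I" for i
  proof (rule module_homI)
    fix x assume x: "x \<in> carrier (F i)"
    have "finite {j \<in> I. (\<lambda>j\<in>I. if j = i then x else \<zero>\<^bsub>F j\<^esub>) j \<noteq> \<zero>\<^bsub>F j\<^esub>}"
      by (rule finite_subset[of _ "{i}"]) (auto split: if_splits)
    then show "(\<lambda>j\<in>I. if j = i then x else \<zero>\<^bsub>F j\<^esub>) \<in> carrier (dsum I F)"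
      using x abelian_monoid.zero_closed[OF am] by (auto simp: PiE_iff)
  qed (use i abelian_monoid.l_zero[OF am] abelian_monoid.zero_closed[OF am]
        left_module.smult_zero_right[OF F] in \<open>auto simp: fun_eq_iff\<close>)
qed (use F in \<open>auto simp: module_hom_def PiE_iff extensional_def fun_eq_iff cong: conj_cong\<close>)

section \<open>Residues and the radical of the category\<close>

definition field_space :: "('k, 'r) ring_scheme \<Rightarrow> ('k, 'k) module" where
  "field_space K = \<lparr>carrier = carrier K, monoid.mult = monoid.mult K, one = one K, zero = zero K,
    add = add K, smult = monoid.mult K\<rparr>"

lemma field_space_simps [simp]:
  "carrier (field_space K) = carrier K"
  "zero (field_space K) = zero K"
  "add (field_space K) = add K"
  "smult (field_space K) = monoid.mult K"
  by (simp_all add: field_space_def)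

lemma (in field) field_space_vectorspace: "vectorspace R (field_space R)"
proof (rule vs_criteria)
  show "field R" ..
  show "\<forall>v\<in>carrier (field_space R). \<exists>w\<in>carrier (field_space R).
      v \<oplus>\<^bsub>field_space R\<^esub> w = \<zero>\<^bsub>field_space R\<^esub>"
    using r_neg by auto
qed (auto simp: a_ac m_assoc l_distr r_distr)

lemma (in field) dim_field_space: "vectorspace.dim R (field_space R) = 1"
proof -
  interpret F: vectorspace R "field_space R" by (rule field_space_vectorspace)
  show ?thesis
  proof (rule F.dim1I)
    have "F.span {\<one>} \<subseteq> carrier R" using F.span_is_subset2[of "{\<one>}"] by simp
    moreover have "c \<in> F.span {\<one>}" if c: "c \<in> carrier R" for c
    proof -
      have s: "subspace R (F.span {\<one>}) (field_space R)" by (rule F.span_is_subspace) simp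
      interpret S: LinearCombinations.submodule R "F.span {\<one>}" "field_space R"
        using s by (simp add: subspace_def)
      have "\<one> \<in> F.span {\<one>}" using F.in_own_span[of "{\<one>}"] by simp
      from S.smult_closed[OF c this] show ?thesis using c by simp
    qed
    ultimately show "F.gen_set {\<one>}" by auto
  qed auto
qed

text \<open>For indecomposable finite-dimensional \<open>L\<close> this is the radical of the module
  category at \<open>(L, M)\<close>. That it is a subspace is not built in; it is seen when the set
  is identified with a joint kernel or with an image.\<close>

definition radical :: "('k, 'a) module \<Rightarrow> ('a, 'm) module \<Rightarrow> ('a, 'n) module \<Rightarrow> ('m \<Rightarrow> 'n) set" where
  "radical A L M = {h \<in> carrier (hom_space A L M). \<not> split_mono A L M h}"

context fd_modules
begin

text \<open>Restriction to the summands is jointly bijective on \<open>Hom(E, M)\<close>. Finite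
  dimension of \<open>Hom(E, M)\<close> follows from the summands, without treating \<open>E\<close>
  itself as a finite-dimensional module.\<close>

lemma hom_dim_decomposition:
  assumes E: "decomposition A E I F e p" and fin: "finite I"
    and F: "\<And>i. i \<in> I \<Longrightarrow> fd_module K A (F i)" and M: "fd_module K A M"
  shows "vectorspace.fin_dim K (hom_space A E M)"
    and "hom_dim K A E M = (\<Sum>i\<in>I. hom_dim K A (F i) M)"
proof -
  note MM = fd_moduleD(1)[OF M]
  interpret D: decomposition A E I F e p by (rule E)
  interpret M: left_module A M by (rule MM)
  have EE: "left_module A E" by (rule D.left_module_axioms)
  let ?T = "\<lambda>i f. \<lambda>x\<in>carrier (F i). f (e i x)"
  have vsE: "vectorspace K (hom_space A E M)" by (rule hom_space_vectorspace[OF EE MM])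
  have vs: "vectorspace K (hom_space A (F i) M)" if "i \<in> I" for i
    by (rule hom_space_vectorspace[OF D.summand[OF that] MM])
  have T: "?T i \<in> module_hom K (hom_space A E M) (hom_space A (F i) M)" if "i \<in> I" for i
    by (rule hom_precomp[OF EE D.summand[OF that] MM D.emb[OF that]])
  have inj: "f = \<zero>\<^bsub>hom_space A E M\<^esub>"
    if f: "f \<in> carrier (hom_space A E M)" and z: "\<And>i. i \<in> I \<Longrightarrow> ?T i f = \<zero>\<^bsub>hom_space A (F i) M\<^esub>" for f
  proof -
    interpret f: left_module_hom A E M f by (rule left_module_homI[OF EE MM]) (use f in simp)
    \<comment> \<open>The kernel of \<open>f\<close> is a submodule that contains the images of all
      summands.\<close>
    have "{x \<in> carrier E. f x = \<zero>\<^bsub>M\<^esub>} = carrier E"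
    proof (rule D.submodule_eq_carrier[OF f.kernel_submodule])
      fix i y assume i: "i \<in> I" and y: "y \<in> carrier (F i)"
      show "e i y \<in> {x \<in> carrier E. f x = \<zero>\<^bsub>M\<^esub>}"
        using fun_cong[OF z[OF i], of y] y module_hom_in[OF D.emb[OF i] y] by simp
    qed
    then have "f x = \<zero>\<^bsub>M\<^esub>" if "x \<in> carrier E" for x using that by blast
    then show ?thesis using f by (auto simp: fun_eq_iff extensional_def)
  qed
  show fdE: "vectorspace.fin_dim K (hom_space A E M)"
    by (rule fin_dim_joint_inj[OF vsE fin vs hom_space_fin_dim[OF F M] T inj])
  have surj: "\<exists>f\<in>carrier (hom_space A E M). \<forall>i\<in>I. ?T i f = w i"
    if w: "\<And>i. i \<in> I \<Longrightarrow> w i \<in> carrier (hom_space A (F i) M)" for w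
  proof -
    have wh: "w i \<in> module_hom A (F i) M" if "i \<in> I" for i using w[OF that] by simp
    \<comment> \<open>The sum of \<open>w i\<close> after \<open>p i\<close> is accumulated over the
      finite set \<open>S\<close>, with zero prescribed on the summands outside
      \<open>S\<close>.\<close>
    have "\<exists>f\<in>module_hom A E M. \<forall>i\<in>I. \<forall>x\<in>carrier (F i). f (e i x) = (if i \<in> S then w i x else \<zero>\<^bsub>M\<^esub>)"
      if "finite S" "S \<subseteq> I" for S using that
    proof (induction S rule: finite_induct)
      case empty
      then show ?case using module_hom_zero_map[OF MM] by (intro bexI[of _ "\<lambda>x. \<zero>\<^bsub>M\<^esub>"]) auto
    next
      case (insert j S)
      then obtain f where f: "f \<in> module_hom A E M"
        "\<And>i x. i \<in> I \<Longrightarrow> x \<in> carrier (F i) \<Longrightarrow> f (e i x) = (if i \<in> S then w i x else \<zero>\<^bsub>M\<^esub>)" by auto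
      have j: "j \<in> I" using insert.prems by simp
      interpret f: left_module_hom A E M f by (rule left_module_homI[OF EE MM f(1)])
      interpret wj: left_module_hom A "F j" M "w j" by (rule left_module_homI[OF D.summand[OF j] MM wh[OF j]])
      show ?case
      proof (intro bexI[of _ "\<lambda>x. f x \<oplus>\<^bsub>M\<^esub> w j (p j x)"] ballI)
        show "(\<lambda>x. f x \<oplus>\<^bsub>M\<^esub> w j (p j x)) \<in> module_hom A E M"
          by (rule f.sum_hom[OF module_hom_comp[OF D.proj[OF j] wh[OF j]]])
        fix i x assume i: "i \<in> I" and x: "x \<in> carrier (F i)"
        have "w i x \<in> carrier M" using module_hom_in[OF wh[OF i] x] .
        then show "f (e i x) \<oplus>\<^bsub>M\<^esub> w j (p j (e i x)) = (if i \<in> insert j S then w i x else \<zero>\<^bsub>M\<^esub>)"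
          using f(2)[OF i x] D.proj_emb[OF i j x] insert.hyps by auto
      qed
    qed
    from this[OF fin] obtain f where f: "f \<in> module_hom A E M"
        "\<And>i x. i \<in> I \<Longrightarrow> x \<in> carrier (F i) \<Longrightarrow> f (e i x) = w i x" by auto
    have "?T i (restrict f (carrier E)) = w i" if i: "i \<in> I" for i
    proof
      fix x
      show "?T i (restrict f (carrier E)) x = w i x"
        using f(2)[OF i] w[OF i] module_hom_in[OF D.emb[OF i]] by (auto simp: extensional_def)
    qed
    moreover have "restrict f (carrier E) \<in> carrier (hom_space A E M)"
      using D.module_hom_restrict[OF f(1)] by simp
    ultimately show ?thesis by blast
  qed
  let ?N = "{f \<in> carrier (hom_space A E M). \<forall>i\<in>I. ?T i f = \<zero>\<^bsub>hom_space A (F i) M\<^esub>}"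
  have N: "subspace K ?N (hom_space A E M)" by (rule joint_kernel_subspace[OF vsE vs T])
  interpret N: vectorspace K "(hom_space A E M)\<lparr>carrier := ?N\<rparr>"
    by (rule vectorspace.subspace_is_vs[OF vsE N])
  have "carrier ((hom_space A E M)\<lparr>carrier := ?N\<rparr>) = {\<zero>\<^bsub>(hom_space A E M)\<lparr>carrier := ?N\<rparr>\<^esub>}"
    using inj N.M.zero_closed by auto
  then have "N.dim = 0" by (rule N.dim_zero_space)
  then show "hom_dim K A E M = (\<Sum>i\<in>I. hom_dim K A (F i) M)"
    unfolding hom_dim_def using dim_joint_kernel[OF vsE fdE fin vs T surj] by simp
qed

end

section \<open>Residues of endomorphisms of an indecomposable module\<close>

locale alg_closed_modules = fd_modules K A + algebraically_closed K
  for K :: "'k ring" and A :: "('k, 'a) module"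
begin

lemma scalar_endo:
  assumes "left_module A L" "c \<in> carrier K"
  shows "(\<lambda>x. scalar c \<odot>\<^bsub>L\<^esub> x) \<in> module_hom A L L"
  by (rule scalar_hom[OF assms module_hom_id])

lemma scalar_endo_inj:
  assumes "left_module A L" "c \<in> carrier K" "c \<noteq> \<zero>\<^bsub>K\<^esub>"
  shows "inj_on (\<lambda>x. scalar c \<odot>\<^bsub>L\<^esub> x) (carrier L)"
proof (rule inj_on_inverseI)
  interpret L: left_module A L by fact
  fix x assume x: "x \<in> carrier L"
  have K: "field K" ..
  then have "monoid K" by (simp add: field_def domain_def cring_def ring_def)
  note K_inv = monoid.Units_inv_closed[OF this] monoid.Units_l_inv[OF this]
  have c: "c \<in> Units K" using assms(2,3) by (simp add: field_Units)
  have "scalar (inv\<^bsub>K\<^esub> c) \<odot>\<^bsub>L\<^esub> (scalar c \<odot>\<^bsub>L\<^esub> x) = scalar (inv\<^bsub>K\<^esub> c \<otimes>\<^bsub>K\<^esub> c) \<odot>\<^bsub>L\<^esub> x"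
    unfolding scalar_mult[OF K_inv(1)[OF c] assms(2)]
    by (rule L.smult_assoc[symmetric]) (use x c assms(2) in auto)
  then show "scalar (inv\<^bsub>K\<^esub> c) \<odot>\<^bsub>L\<^esub> (scalar c \<odot>\<^bsub>L\<^esub> x) = x"
    using x K_inv(2)[OF c] by (simp add: L.smult_one)
qed

text \<open>The sum enters as a separate \<open>h\<close>, equal to it only on the carrier, so that
  algebraic rewriting of the sum can be done pointwise.\<close>

lemma endo_sum_not_inj:
  assumes L: "fd_module K A L" "indecomposable A L"
    and "f \<in> module_hom A L L" "g \<in> module_hom A L L"
    and "\<not> inj_on f (carrier L)" "\<not> inj_on g (carrier L)"
    and "\<And>x. x \<in> carrier L \<Longrightarrow> h x = f x \<oplus>\<^bsub>L\<^esub> g x"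
  shows "\<not> inj_on h (carrier L)"
  using endo_sum_inj[OF L assms(3,4)] assms(5,6) inj_on_cong[of "carrier L" h, OF assms(7)] by auto

lemma endo_neg_not_inj:
  assumes "left_module A L" "f \<in> module_hom A L L" "\<not> inj_on f (carrier L)"
  shows "\<not> inj_on (\<lambda>x. \<ominus>\<^bsub>L\<^esub> f x) (carrier L)"
proof -
  interpret L: left_module A L by fact
  show ?thesis using assms(3) module_hom_in[OF assms(2)]
    unfolding inj_on_def by (metis L.M.minus_minus)
qed

text \<open>The image of \<open>f\<close> in the residue field of the local ring
  \<open>End(L)\<close>, which is \<open>K\<close>; equivalently the only eigenvalue of
  \<open>f\<close>.\<close>

definition residue :: "('a, 'm) module \<Rightarrow> ('m \<Rightarrow> 'm) \<Rightarrow> 'k" where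
  "residue L f = (THE c. c \<in> carrier K \<and> \<not> inj_on (\<lambda>x. f x \<ominus>\<^bsub>L\<^esub> scalar c \<odot>\<^bsub>L\<^esub> x) (carrier L))"

lemma shifted_endo:
  assumes "left_module A L" "c \<in> carrier K" "f \<in> module_hom A L L"
  shows "(\<lambda>x. f x \<ominus>\<^bsub>L\<^esub> scalar c \<odot>\<^bsub>L\<^esub> x) \<in> module_hom A L L"
  by (rule left_module_hom.diff_hom[OF left_module_homI[OF assms(1,1,3)] scalar_endo[OF assms(1,2)]])

text \<open>If \<open>f - c\<close> and \<open>f - d\<close> are both noninjective, then so is their
  difference, multiplication by \<open>d - c\<close>, by locality. A nonzero scalar acts
  injectively, hence \<open>d = c\<close>.\<close>

lemma residue_eqI:
  assumes L: "fd_module K A L" "indecomposable A L" and f: "f \<in> module_hom A L L"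
    and c: "c \<in> carrier K" "\<not> inj_on (\<lambda>x. f x \<ominus>\<^bsub>L\<^esub> scalar c \<odot>\<^bsub>L\<^esub> x) (carrier L)"
  shows "residue L f = c"
  unfolding residue_def
proof (rule the_equality)
  note LL = fd_moduleD(1)[OF L(1)]
  interpret L: left_module A L by (rule LL)
  fix d assume d: "d \<in> carrier K \<and> \<not> inj_on (\<lambda>x. f x \<ominus>\<^bsub>L\<^esub> scalar d \<odot>\<^bsub>L\<^esub> x) (carrier L)"
  let ?f = "\<lambda>c x. f x \<ominus>\<^bsub>L\<^esub> scalar c \<odot>\<^bsub>L\<^esub> x"
  have fc: "?f c \<in> module_hom A L L" and fd: "?f d \<in> module_hom A L L"
    using shifted_endo[OF LL] c d f by auto
  have "\<not> inj_on (\<lambda>x. scalar (d \<ominus>\<^bsub>K\<^esub> c) \<odot>\<^bsub>L\<^esub> x) (carrier L)"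
  proof (rule endo_sum_not_inj[OF L fc left_module_hom.diff_hom[OF
      left_module_homI[OF LL LL module_hom_zero_map[OF LL]] fd] c(2)])
    have "\<not> inj_on (\<lambda>x. \<ominus>\<^bsub>L\<^esub> ?f d x) (carrier L)"
      by (rule endo_neg_not_inj[OF LL fd]) (use d in simp)
    moreover have "\<zero>\<^bsub>L\<^esub> \<ominus>\<^bsub>L\<^esub> ?f d x = \<ominus>\<^bsub>L\<^esub> ?f d x" if "x \<in> carrier L" for x
      using module_hom_in[OF fd that] by (simp add: L.M.minus_eq)
    ultimately show "\<not> inj_on (\<lambda>x. \<zero>\<^bsub>L\<^esub> \<ominus>\<^bsub>L\<^esub> ?f d x) (carrier L)"
      by (simp cong: inj_on_cong)
    fix x assume x: "x \<in> carrier L"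
    have cd: "d \<ominus>\<^bsub>K\<^esub> c = d \<oplus>\<^bsub>K\<^esub> (\<ominus>\<^bsub>K\<^esub> c)" by (simp add: R.minus_eq)
    have neg: "scalar (\<ominus>\<^bsub>K\<^esub> c) \<odot>\<^bsub>L\<^esub> x = \<ominus>\<^bsub>L\<^esub> (scalar c \<odot>\<^bsub>L\<^esub> x)"
    proof -
      have "scalar (\<ominus>\<^bsub>K\<^esub> c) \<odot>\<^bsub>L\<^esub> x \<oplus>\<^bsub>L\<^esub> scalar c \<odot>\<^bsub>L\<^esub> x = scalar (\<ominus>\<^bsub>K\<^esub> c \<oplus>\<^bsub>K\<^esub> c) \<odot>\<^bsub>L\<^esub> x"
        using x c(1) scalar_add[of "\<ominus>\<^bsub>K\<^esub> c" c] L.smult_l_distr by simp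
      also have "\<dots> = \<zero>\<^bsub>L\<^esub>" using x c(1) by (simp add: R.l_neg)
      finally show ?thesis
        using x c(1) L.smult_closed by (metis L.M.minus_equality R.a_inv_closed scalar_closed)
    qed
    have car: "f x \<in> carrier L" "scalar c \<odot>\<^bsub>L\<^esub> x \<in> carrier L" "scalar d \<odot>\<^bsub>L\<^esub> x \<in> carrier L"
      using x c(1) d module_hom_in[OF f x] by (auto simp: L.smult_closed)
    have "scalar (d \<ominus>\<^bsub>K\<^esub> c) \<odot>\<^bsub>L\<^esub> x = scalar d \<odot>\<^bsub>L\<^esub> x \<ominus>\<^bsub>L\<^esub> scalar c \<odot>\<^bsub>L\<^esub> x"
      unfolding cd using x c(1) d scalar_add[of d "\<ominus>\<^bsub>K\<^esub> c"] neg L.smult_l_distr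
      by (simp add: L.M.minus_eq)
    also have "\<dots> = (f x \<ominus>\<^bsub>L\<^esub> scalar c \<odot>\<^bsub>L\<^esub> x) \<oplus>\<^bsub>L\<^esub> (\<zero>\<^bsub>L\<^esub> \<ominus>\<^bsub>L\<^esub> (f x \<ominus>\<^bsub>L\<^esub> scalar d \<odot>\<^bsub>L\<^esub> x))"
    proof -
      \<comment> \<open>The difference of the two shifts is written as a sum, with \<open>r\<close>
        in the role of \<open>f x\<close>, to fit \<open>endo_sum_not_inj\<close>.\<close>
      have *: "p \<ominus>\<^bsub>L\<^esub> q = (r \<ominus>\<^bsub>L\<^esub> q) \<oplus>\<^bsub>L\<^esub> (\<zero>\<^bsub>L\<^esub> \<ominus>\<^bsub>L\<^esub> (r \<ominus>\<^bsub>L\<^esub> p))"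
        if "p \<in> carrier L" "q \<in> carrier L" "r \<in> carrier L" for p q r
      proof -
        have "(r \<ominus>\<^bsub>L\<^esub> q) \<oplus>\<^bsub>L\<^esub> (\<zero>\<^bsub>L\<^esub> \<ominus>\<^bsub>L\<^esub> (r \<ominus>\<^bsub>L\<^esub> p)) = (p \<ominus>\<^bsub>L\<^esub> q) \<oplus>\<^bsub>L\<^esub> (r \<ominus>\<^bsub>L\<^esub> r)"
          using that by (simp add: L.M.minus_eq L.M.minus_add L.M.a_ac)
        also have "\<dots> = p \<ominus>\<^bsub>L\<^esub> q" using that by (simp add: L.M.minus_eq L.M.r_neg)
        finally show ?thesis by simp
      qed
      show ?thesis by (rule *) fact+
    qed
    finally show "scalar (d \<ominus>\<^bsub>K\<^esub> c) \<odot>\<^bsub>L\<^esub> x = ?f c x \<oplus>\<^bsub>L\<^esub> (\<zero>\<^bsub>L\<^esub> \<ominus>\<^bsub>L\<^esub> ?f d x)" .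
  qed
  then have "d \<ominus>\<^bsub>K\<^esub> c = \<zero>\<^bsub>K\<^esub>"
    using scalar_endo_inj[OF LL, of "d \<ominus>\<^bsub>K\<^esub> c"] c(1) d by auto
  then show "d = c" using c(1) d by simp
qed (use c in simp)

text \<open>An eigenvector of \<open>f\<close> for \<open>c\<close> lies in the kernel of
  \<open>f - c\<close>; with the uniqueness above, the residue is that eigenvalue.\<close>

lemma residue_props:
  assumes L: "fd_module K A L" "indecomposable A L" and f: "f \<in> module_hom A L L"
  shows "residue L f \<in> carrier K"
    and "\<not> inj_on (\<lambda>x. f x \<ominus>\<^bsub>L\<^esub> scalar (residue L f) \<odot>\<^bsub>L\<^esub> x) (carrier L)"
proof -
  note LL = fd_moduleD[OF L(1)]
  interpret L: left_module A L by (rule LL)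
  interpret UL: vectorspace K "underlying_space A L" by (rule underlying_vectorspace[OF LL(1)])
  obtain x where x: "x \<in> carrier L" "x \<noteq> \<zero>\<^bsub>L\<^esub>"
    using indecomposableD(1)[OF L(2)] L.M.zero_closed by blast
  interpret cyclic_span K "underlying_space A L" f x
    by unfold_locales (use LL(2) module_hom_underlying[OF f] x in auto)
  obtain c v where c: "c \<in> carrier K" "v \<in> carrier L" "v \<noteq> \<zero>\<^bsub>L\<^esub>" "f v = scalar c \<odot>\<^bsub>L\<^esub> v"
    using eigenvector_exists algebraically_closed_axioms by auto
  let ?g = "\<lambda>x. f x \<ominus>\<^bsub>L\<^esub> scalar c \<odot>\<^bsub>L\<^esub> x"
  interpret g: left_module_hom A L L ?g
    by (rule left_module_homI[OF LL(1) LL(1) shifted_endo[OF LL(1) c(1) f]])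
  have "?g v = \<zero>\<^bsub>L\<^esub>" using c by (simp add: L.M.minus_eq L.M.r_neg L.smult_closed)
  then have "\<not> inj_on ?g (carrier L)" unfolding g.inj_iff using c(2,3) by blast
  moreover from this have "residue L f = c" by (rule residue_eqI[OF L f c(1)])
  ultimately show "residue L f \<in> carrier K"
    "\<not> inj_on (\<lambda>x. f x \<ominus>\<^bsub>L\<^esub> scalar (residue L f) \<odot>\<^bsub>L\<^esub> x) (carrier L)"
    using c(1) by auto
qed

lemma residue_eq_0_iff:
  assumes L: "fd_module K A L" "indecomposable A L" and f: "f \<in> module_hom A L L"
  shows "residue L f = \<zero>\<^bsub>K\<^esub> \<longleftrightarrow> \<not> inj_on f (carrier L)"
proof -
  interpret L: left_module A L by (rule fd_moduleD(1)[OF L(1)])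
  have "inj_on (\<lambda>x. f x \<ominus>\<^bsub>L\<^esub> scalar \<zero>\<^bsub>K\<^esub> \<odot>\<^bsub>L\<^esub> x) (carrier L) \<longleftrightarrow> inj_on f (carrier L)"
    by (rule inj_on_cong) (use module_hom_in[OF f] in \<open>simp add: L.M.minus_eq\<close>)
  then show ?thesis using residue_props(2)[OF L f] residue_eqI[OF L f R.zero_closed] by auto
qed

lemma residue_cong:
  assumes "\<And>x. x \<in> carrier L \<Longrightarrow> f x = g x"
  shows "residue L f = residue L g"
proof -
  have "inj_on (\<lambda>x. f x \<ominus>\<^bsub>L\<^esub> scalar c \<odot>\<^bsub>L\<^esub> x) (carrier L) \<longleftrightarrow>
    inj_on (\<lambda>x. g x \<ominus>\<^bsub>L\<^esub> scalar c \<odot>\<^bsub>L\<^esub> x) (carrier L)" for c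
    by (rule inj_on_cong) (simp add: assms)
  then show ?thesis by (simp add: residue_def)
qed

lemma residue_scalar:
  assumes L: "fd_module K A L" "indecomposable A L" and c: "c \<in> carrier K"
  shows "residue L (\<lambda>x. scalar c \<odot>\<^bsub>L\<^esub> x) = c"
proof (rule residue_eqI[OF L scalar_endo[OF fd_moduleD(1)[OF L(1)] c] c])
  interpret L: left_module A L by (rule fd_moduleD(1)[OF L(1)])
  obtain x where x: "x \<in> carrier L" "x \<noteq> \<zero>\<^bsub>L\<^esub>"
    using indecomposableD(1)[OF L(2)] L.M.zero_closed by blast
  show "\<not> inj_on (\<lambda>x. scalar c \<odot>\<^bsub>L\<^esub> x \<ominus>\<^bsub>L\<^esub> scalar c \<odot>\<^bsub>L\<^esub> x) (carrier L)"
  proof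
    assume inj: "inj_on (\<lambda>x. scalar c \<odot>\<^bsub>L\<^esub> x \<ominus>\<^bsub>L\<^esub> scalar c \<odot>\<^bsub>L\<^esub> x) (carrier L)"
    have "x = \<zero>\<^bsub>L\<^esub>"
      by (rule inj_onD[OF inj]) (use x c in \<open>simp_all add: L.M.minus_eq L.M.r_neg L.smult_closed\<close>)
    with x show False by simp
  qed
qed

text \<open>The sum of two shifted, noninjective endomorphisms is \<open>f + g\<close> shifted by
  the sum of the residues, and it is noninjective by locality.\<close>

lemma residue_add:
  assumes L: "fd_module K A L" "indecomposable A L"
    and f: "f \<in> module_hom A L L" and g: "g \<in> module_hom A L L"
  shows "residue L (\<lambda>x. f x \<oplus>\<^bsub>L\<^esub> g x) = residue L f \<oplus>\<^bsub>K\<^esub> residue L g"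
proof (rule residue_eqI[OF L])
  note LL = fd_moduleD(1)[OF L(1)]
  interpret L: left_module A L by (rule LL)
  note rf = residue_props[OF L f] and rg = residue_props[OF L g]
  show "(\<lambda>x. f x \<oplus>\<^bsub>L\<^esub> g x) \<in> module_hom A L L"
    by (rule left_module_hom.sum_hom[OF left_module_homI[OF LL LL f] g])
  show "residue L f \<oplus>\<^bsub>K\<^esub> residue L g \<in> carrier K" using rf rg by simp
  show "\<not> inj_on (\<lambda>x. f x \<oplus>\<^bsub>L\<^esub> g x \<ominus>\<^bsub>L\<^esub> scalar (residue L f \<oplus>\<^bsub>K\<^esub> residue L g) \<odot>\<^bsub>L\<^esub> x) (carrier L)"
  proof (rule endo_sum_not_inj[OF L shifted_endo[OF LL rf(1) f] shifted_endo[OF LL rg(1) g] rf(2) rg(2)])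
    fix x assume x: "x \<in> carrier L"
    have *: "f x \<in> carrier L" "g x \<in> carrier L" "scalar (residue L f) \<odot>\<^bsub>L\<^esub> x \<in> carrier L"
      "scalar (residue L g) \<odot>\<^bsub>L\<^esub> x \<in> carrier L"
      using x rf rg module_hom_in[OF f x] module_hom_in[OF g x] by (auto simp: L.smult_closed)
    have "scalar (residue L f \<oplus>\<^bsub>K\<^esub> residue L g) \<odot>\<^bsub>L\<^esub> x =
        scalar (residue L f) \<odot>\<^bsub>L\<^esub> x \<oplus>\<^bsub>L\<^esub> scalar (residue L g) \<odot>\<^bsub>L\<^esub> x"
      using x rf(1) rg(1) scalar_add[OF rf(1) rg(1)] L.smult_l_distr by simp
    then show "f x \<oplus>\<^bsub>L\<^esub> g x \<ominus>\<^bsub>L\<^esub> scalar (residue L f \<oplus>\<^bsub>K\<^esub> residue L g) \<odot>\<^bsub>L\<^esub> x =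
      (f x \<ominus>\<^bsub>L\<^esub> scalar (residue L f) \<odot>\<^bsub>L\<^esub> x) \<oplus>\<^bsub>L\<^esub> (g x \<ominus>\<^bsub>L\<^esub> scalar (residue L g) \<odot>\<^bsub>L\<^esub> x)"
      using * by (simp add: L.M.minus_eq L.M.minus_add L.M.a_ac)
  qed
qed

lemma residue_smult:
  assumes L: "fd_module K A L" "indecomposable A L"
    and c: "c \<in> carrier K" and f: "f \<in> module_hom A L L"
  shows "residue L (\<lambda>x. scalar c \<odot>\<^bsub>L\<^esub> f x) = c \<otimes>\<^bsub>K\<^esub> residue L f"
proof (rule residue_eqI[OF L])
  note LL = fd_moduleD(1)[OF L(1)]
  interpret L: left_module A L by (rule LL)
  note rf = residue_props[OF L f]
  show "(\<lambda>x. scalar c \<odot>\<^bsub>L\<^esub> f x) \<in> module_hom A L L" by (rule scalar_hom[OF LL c f])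
  show "c \<otimes>\<^bsub>K\<^esub> residue L f \<in> carrier K" using c rf by simp
  let ?g = "\<lambda>x. f x \<ominus>\<^bsub>L\<^esub> scalar (residue L f) \<odot>\<^bsub>L\<^esub> x"
  have eq: "scalar c \<odot>\<^bsub>L\<^esub> f x \<ominus>\<^bsub>L\<^esub> scalar (c \<otimes>\<^bsub>K\<^esub> residue L f) \<odot>\<^bsub>L\<^esub> x = scalar c \<odot>\<^bsub>L\<^esub> ?g x"
    if x: "x \<in> carrier L" for x
  proof -
    have "scalar (c \<otimes>\<^bsub>K\<^esub> residue L f) \<odot>\<^bsub>L\<^esub> x = scalar c \<odot>\<^bsub>L\<^esub> (scalar (residue L f) \<odot>\<^bsub>L\<^esub> x)"
      unfolding scalar_mult[OF c rf(1)] by (rule L.smult_assoc) (use x c rf in auto)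
    then show ?thesis using x c rf(1) module_hom_in[OF f x]
      by (simp add: L.M.minus_eq L.smult_r_distr L.smult_neg L.smult_closed)
  qed
  show "\<not> inj_on (\<lambda>x. scalar c \<odot>\<^bsub>L\<^esub> f x \<ominus>\<^bsub>L\<^esub> scalar (c \<otimes>\<^bsub>K\<^esub> residue L f) \<odot>\<^bsub>L\<^esub> x) (carrier L)"
  proof
    assume "inj_on (\<lambda>x. scalar c \<odot>\<^bsub>L\<^esub> f x \<ominus>\<^bsub>L\<^esub> scalar (c \<otimes>\<^bsub>K\<^esub> residue L f) \<odot>\<^bsub>L\<^esub> x) (carrier L)"
    then have "inj_on (\<lambda>x. scalar c \<odot>\<^bsub>L\<^esub> ?g x) (carrier L)"
      using inj_on_cong[of "carrier L", OF eq] by simp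
    \<comment> \<open>Injectivity of a composite passes to its inner map, so the case
      \<open>c = \<zero>\<close> needs no separate treatment.\<close>
    then have "inj_on ?g (carrier L)" by (auto simp: inj_on_def)
    with rf(2) show False by simp
  qed
qed

lemma residue_hom:
  assumes L: "fd_module K A L" "indecomposable A L" and M: "left_module A M"
    and u: "u \<in> module_hom A M L"
  shows "(\<lambda>h. residue L (\<lambda>x. u (h x))) \<in> module_hom K (hom_space A L M) (field_space K)"
proof (rule module_homI)
  note LL = fd_moduleD(1)[OF L(1)]
  interpret u: left_module_hom A M L u by (rule left_module_homI[OF M LL u])
  have uh: "(\<lambda>x. u (h x)) \<in> module_hom A L L" if "h \<in> carrier (hom_space A L M)" for h
    using that module_hom_comp[OF _ u, of h L] by simp
  show "residue L (\<lambda>x. u (h x)) \<in> carrier (field_space K)" if "h \<in> carrier (hom_space A L M)" for h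
    using residue_props(1)[OF L uh[OF that]] by simp
  show "residue L (\<lambda>x. u ((g \<oplus>\<^bsub>hom_space A L M\<^esub> h) x)) =
      residue L (\<lambda>x. u (g x)) \<oplus>\<^bsub>field_space K\<^esub> residue L (\<lambda>x. u (h x))"
    if g: "g \<in> carrier (hom_space A L M)" and h: "h \<in> carrier (hom_space A L M)" for g h
  proof -
    have "residue L (\<lambda>x. u ((g \<oplus>\<^bsub>hom_space A L M\<^esub> h) x)) = residue L (\<lambda>x. u (g x) \<oplus>\<^bsub>L\<^esub> u (h x))"
      by (rule residue_cong) (use g h in \<open>simp add: module_hom_in[of _ A L M]\<close>)
    then show ?thesis using residue_add[OF L uh[OF g] uh[OF h]] by simp
  qed
  show "residue L (\<lambda>x. u ((c \<odot>\<^bsub>hom_space A L M\<^esub> h) x)) =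
      c \<odot>\<^bsub>field_space K\<^esub> residue L (\<lambda>x. u (h x))"
    if c: "c \<in> carrier K" and h: "h \<in> carrier (hom_space A L M)" for c h
  proof -
    have "residue L (\<lambda>x. u ((c \<odot>\<^bsub>hom_space A L M\<^esub> h) x)) = residue L (\<lambda>x. scalar c \<odot>\<^bsub>L\<^esub> u (h x))"
      by (rule residue_cong) (use c h in \<open>simp add: module_hom_in[of _ A L M]\<close>)
    then show ?thesis using residue_smult[OF L c uh[OF h]] by simp
  qed
qed

text \<open>Each summand isomorphic to \<open>L\<close> contributes one linear functional on
  \<open>Hom(L, M)\<close>: the residue of the component, read as an endomorphism of
  \<open>L\<close>. These functionals are jointly surjective and their joint kernel is the radical.
  The other summands may be infinite in number.\<close>

theorem dim_hom_radical:
  assumes L: "fd_module K A L" "indecomposable A L" and M: "fd_module K A M"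
    and dec: "decomposition A M I F e p"
    and indec: "\<And>i. i \<in> I \<Longrightarrow> indecomposable A (F i)"
    and fin: "finite {i \<in> I. module_iso A L (F i)}"
  shows "hom_dim K A L M = vectorspace.dim K ((hom_space A L M)\<lparr>carrier := radical A L M\<rparr>)
    + card {i \<in> I. module_iso A L (F i)}"
proof -
  note LL = fd_moduleD(1)[OF L(1)] and MM = fd_moduleD(1)[OF M]
  interpret L: left_module A L by (rule LL)
  interpret M: left_module A M by (rule MM)
  interpret D: decomposition A M I F e p by (rule dec)
  obtain x0 where x0: "x0 \<in> carrier L" "x0 \<noteq> \<zero>\<^bsub>L\<^esub>"
    using indecomposableD(1)[OF L(2)] L.M.zero_closed by blast
  let ?J = "{i \<in> I. module_iso A L (F i)}"
  \<comment> \<open>Bundles a pair of mutually inverse isomorphisms, so that one choice fixes both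
    for every \<open>i\<close>.\<close>
  define P where "P = (\<lambda>i s t. s \<in> module_hom A L (F i) \<and> t \<in> module_hom A (F i) L \<and>
      (\<forall>x\<in>carrier L. t (s x) = x) \<and> (\<forall>y\<in>carrier (F i). s (t y) = y))"
  have "\<exists>s t. P i s t" if "i \<in> ?J" for i
  proof -
    have "module_iso A L (F i)" "left_module A (F i)" using that D.summand by auto
    then show ?thesis unfolding P_def using module_isoE[OF _ LL, of "F i"] by metis
  qed
  then obtain s t where P: "\<And>i. i \<in> ?J \<Longrightarrow> P i (s i) (t i)" by metis
  have s: "\<And>i. i \<in> ?J \<Longrightarrow> s i \<in> module_hom A L (F i)"
    and t: "\<And>i. i \<in> ?J \<Longrightarrow> t i \<in> module_hom A (F i) L"
    and ts: "\<And>i x. i \<in> ?J \<Longrightarrow> x \<in> carrier L \<Longrightarrow> t i (s i x) = x"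
    and st: "\<And>i y. i \<in> ?J \<Longrightarrow> y \<in> carrier (F i) \<Longrightarrow> s i (t i y) = y"
    using P unfolding P_def by blast+
  let ?T = "\<lambda>i h. residue L (\<lambda>x. t i (p i (h x)))"
  have tp: "(\<lambda>y. t i (p i y)) \<in> module_hom A M L" if "i \<in> ?J" for i
    by (rule module_hom_comp[OF D.proj t]) (use that in auto)
  \<comment> \<open>A residue vanishes exactly when the endomorphism is noninjective, and as
    \<open>t i\<close> is an isomorphism this means that the component does not split.\<close>
  have ker: "?T i h = \<zero>\<^bsub>K\<^esub> \<longleftrightarrow> \<not> split_mono A L (F i) (\<lambda>x. p i (h x))"
    if i: "i \<in> ?J" and h: "h \<in> module_hom A L M" for i h
  proof -
    have ph: "(\<lambda>x. p i (h x)) \<in> module_hom A L (F i)" using module_hom_comp[OF h D.proj] i by simp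
    have tph: "(\<lambda>x. t i (p i (h x))) \<in> module_hom A L L" by (rule module_hom_comp[OF ph t[OF i]])
    have "split_mono A L (F i) (\<lambda>x. p i (h x)) \<longleftrightarrow> inj_on (\<lambda>x. t i (p i (h x))) (carrier L)"
    proof
      assume "split_mono A L (F i) (\<lambda>x. p i (h x))"
      then have inj: "inj_on (\<lambda>x. p i (h x)) (carrier L)" by (rule split_mono_inj)
      have phc: "p i (h x) \<in> carrier (F i)" if "x \<in> carrier L" for x
        using module_hom_in[OF ph that] .
      show "inj_on (\<lambda>x. t i (p i (h x))) (carrier L)"
      proof (rule inj_onI)
        fix x y assume xy: "x \<in> carrier L" "y \<in> carrier L" "t i (p i (h x)) = t i (p i (h y))"
        then have "p i (h x) = p i (h y)" using st[OF i phc] by metis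
        then show "x = y" using inj xy by (auto dest: inj_onD)
      qed
    next
      assume "inj_on (\<lambda>x. t i (p i (h x))) (carrier L)"
      then show "split_mono A L (F i) (\<lambda>x. p i (h x))"
        by (rule split_mono_of_inj_retract[OF L(1) ph t[OF i]])
    qed
    then show ?thesis using residue_eq_0_iff[OF L tph] by simp
  qed
  have rad: "{h \<in> carrier (hom_space A L M). \<forall>i\<in>?J. ?T i h = \<zero>\<^bsub>field_space K\<^esub>} = radical A L M"
  proof (intro equalityI subsetI)
    fix h assume h: "h \<in> radical A L M"
    then have hh: "h \<in> module_hom A L M" "h \<in> carrier (hom_space A L M)" by (auto simp: radical_def)
    have "\<not> split_mono A L (F i) (\<lambda>x. p i (h x))" if "i \<in> ?J" for i
      using split_mono_comp_imp[OF hh(1) D.proj, of i] that h by (auto simp: radical_def)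
    then show "h \<in> {h \<in> carrier (hom_space A L M). \<forall>i\<in>?J. ?T i h = \<zero>\<^bsub>field_space K\<^esub>}"
      using ker hh by auto
  next
    fix h assume "h \<in> {h \<in> carrier (hom_space A L M). \<forall>i\<in>?J. ?T i h = \<zero>\<^bsub>field_space K\<^esub>}"
    then have hc: "h \<in> carrier (hom_space A L M)" and h: "h \<in> module_hom A L M"
      and h0: "\<And>i. i \<in> ?J \<Longrightarrow> \<not> split_mono A L (F i) (\<lambda>x. p i (h x))"
      using ker by auto
    \<comment> \<open>A split monomorphism from \<open>L\<close> into an indecomposable summand is
      an isomorphism, so components outside \<open>?J\<close> never split.\<close>
    have ns: "\<not> split_mono A L (F i) (\<lambda>x. p i (h x))" if i: "i \<in> I" for i
      using h0[of i] split_mono_onto_indecomposable[OF LL indecomposableD(1)[OF L(2)] D.summand[OF i] indec[OF i]]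
        bij_module_iso[of "\<lambda>x. p i (h x)" A L "F i"] i by (auto simp: split_mono_def)
    have "\<not> split_mono A L M h"
    proof
      assume split: "split_mono A L M h"
      interpret h: left_module_hom A L M h by (rule left_module_homI[OF LL MM h])
      \<comment> \<open>The index set may be infinite, so \<open>h\<close> is not known to be a
        finite sum of its components. The finite support of the single vector \<open>h x0\<close> is
        enough: \<open>g\<close> collects just these components, and as a finite sum of nonsplit
        maps it does not split.\<close>
      let ?S = "{i \<in> I. p i (h x0) \<noteq> \<zero>\<^bsub>F i\<^esub>}"
      have "\<exists>g\<in>module_hom A L M. \<not> split_mono A L M g \<and>
        (\<forall>x\<in>carrier L. \<forall>j\<in>I. p j (g x) = (if j \<in> ?S then p j (h x) else \<zero>\<^bsub>F j\<^esub>))"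
      proof (rule D.hom_assemble[OF LL])
        show "finite ?S" by (rule D.finite_support) (use x0 in simp)
        show hp: "(\<lambda>x. p i (h x)) \<in> module_hom A L (F i)" if "i \<in> ?S" for i
          using module_hom_comp[OF h D.proj] that by simp
        show "\<not> split_mono A L M (\<lambda>x. \<zero>\<^bsub>M\<^esub>)"
        proof
          assume "split_mono A L M (\<lambda>x. \<zero>\<^bsub>M\<^esub>)"
          then have "inj_on (\<lambda>x. \<zero>\<^bsub>M\<^esub>) (carrier L)" by (rule split_mono_inj)
          then show False using inj_onD[of "\<lambda>x. \<zero>\<^bsub>M\<^esub>" "carrier L" x0 "\<zero>\<^bsub>L\<^esub>"] x0 by simp
        qed
        show "\<not> split_mono A L M (\<lambda>x. g x \<oplus>\<^bsub>M\<^esub> e i (p i (h x)))"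
          if "i \<in> ?S" "g \<in> module_hom A L M" "\<not> split_mono A L M g" for g i
        proof
          have i: "i \<in> I" using that(1) by simp
          assume "split_mono A L M (\<lambda>x. g x \<oplus>\<^bsub>M\<^esub> e i (p i (h x)))"
          then have "split_mono A L M (\<lambda>x. e i (p i (h x)))"
            using split_mono_sum[OF L MM that(2) module_hom_comp[OF hp[OF that(1)] D.emb[OF i]]]
              that(3) by blast
          then show False using split_mono_comp_imp[OF hp[OF that(1)] D.emb[OF i]] ns[OF i] by blast
        qed
      qed auto
      then obtain g where g: "g \<in> module_hom A L M" "\<not> split_mono A L M g"
        "\<And>x j. x \<in> carrier L \<Longrightarrow> j \<in> I \<Longrightarrow> p j (g x) = (if j \<in> ?S then p j (h x) else \<zero>\<^bsub>F j\<^esub>)"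
        by blast
      have d: "(\<lambda>x. h x \<ominus>\<^bsub>M\<^esub> g x) \<in> module_hom A L M" by (rule h.diff_hom[OF g(1)])
      have sum: "g x \<oplus>\<^bsub>M\<^esub> (h x \<ominus>\<^bsub>M\<^esub> g x) = h x" if "x \<in> carrier L" for x
        using that module_hom_in[OF g(1) that] M.M.a_lcomm[of "g x" "h x" "\<ominus>\<^bsub>M\<^esub> g x"]
        by (simp add: M.M.minus_eq M.M.r_neg)
      have "split_mono A L M (\<lambda>x. g x \<oplus>\<^bsub>M\<^esub> (h x \<ominus>\<^bsub>M\<^esub> g x))"
        using split split_mono_cong[OF LL sum] by simp
      \<comment> \<open>As \<open>h\<close> splits and \<open>g\<close> does not,
        \<open>h - g\<close> must split and hence be injective; but it kills the nonzero vector
        \<open>x0\<close>.\<close>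
      then have "split_mono A L M (\<lambda>x. h x \<ominus>\<^bsub>M\<^esub> g x)"
        using split_mono_sum[OF L MM g(1) d] g(2) by blast
      then have inj: "inj_on (\<lambda>x. h x \<ominus>\<^bsub>M\<^esub> g x) (carrier L)" by (rule split_mono_inj)
      interpret g: left_module_hom A L M g by (rule left_module_homI[OF LL MM g(1)])
      have "h x0 = g x0"
        by (rule D.proj_eqI) (use g(3)[OF x0(1)] x0 in auto)
      then have "x0 = \<zero>\<^bsub>L\<^esub>" using inj_onD[OF inj, of x0 "\<zero>\<^bsub>L\<^esub>"] x0(1)
        by (simp add: M.M.minus_eq M.M.r_neg)
      then show False using x0 by simp
    qed
    then show "h \<in> radical A L M" using hc by (simp add: radical_def)
  qed
  have surj: "\<exists>h\<in>carrier (hom_space A L M). \<forall>i\<in>?J. ?T i h = w i"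
    if w: "\<And>i. i \<in> ?J \<Longrightarrow> w i \<in> carrier (field_space K)" for w
  proof -
    have "\<exists>g\<in>module_hom A L M. True \<and>
        (\<forall>x\<in>carrier L. \<forall>j\<in>I. p j (g x) = (if j \<in> ?J then s j (scalar (w j) \<odot>\<^bsub>L\<^esub> x) else \<zero>\<^bsub>F j\<^esub>))"
    proof (rule D.hom_assemble[OF LL fin])
      show "(\<lambda>x. s i (scalar (w i) \<odot>\<^bsub>L\<^esub> x)) \<in> module_hom A L (F i)" if "i \<in> ?J" for i
        using module_hom_comp[OF scalar_endo[OF LL] s[OF that]] w[OF that] by simp
    qed auto
    then obtain g where g: "g \<in> module_hom A L M"
        "\<And>x j. x \<in> carrier L \<Longrightarrow> j \<in> I \<Longrightarrow>
          p j (g x) = (if j \<in> ?J then s j (scalar (w j) \<odot>\<^bsub>L\<^esub> x) else \<zero>\<^bsub>F j\<^esub>)"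
      by blast
    have "?T i (restrict g (carrier L)) = w i" if i: "i \<in> ?J" for i
    proof -
      have "?T i (restrict g (carrier L)) = residue L (\<lambda>x. scalar (w i) \<odot>\<^bsub>L\<^esub> x)"
        by (rule residue_cong) (use g(2) i ts[OF i] w[OF i] in \<open>simp add: L.smult_closed\<close>)
      then show ?thesis using residue_scalar[OF L] w[OF i] by simp
    qed
    moreover have "restrict g (carrier L) \<in> carrier (hom_space A L M)"
      using L.module_hom_restrict[OF g(1)] by simp
    ultimately show ?thesis by blast
  qed
  have "hom_dim K A L M = vectorspace.dim K ((hom_space A L M)\<lparr>carrier :=
      {h \<in> carrier (hom_space A L M). \<forall>i\<in>?J. ?T i h = \<zero>\<^bsub>field_space K\<^esub>}\<rparr>)
      + (\<Sum>i\<in>?J. vectorspace.dim K (field_space K))"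
    unfolding hom_dim_def
    by (rule dim_joint_kernel[OF hom_space_vectorspace[OF LL MM] hom_space_fin_dim[OF L(1) M] fin
          field_space_vectorspace _ surj]) (use residue_hom[OF L MM tp] in auto)
  then show ?thesis unfolding rad dim_field_space by simp
qed

end

section \<open>The Krull--Schmidt theorem\<close>

lemma (in left_module) direct_sum_projections:
  assumes U: "Module.submodule U A M" and V: "Module.submodule V A M"
    and int: "U \<inter> V = {\<zero>}" and sum: "U <+>\<^bsub>M\<^esub> V = carrier M"
  obtains pu pv where "pu \<in> module_hom A M (M\<lparr>carrier := U\<rparr>)" "pv \<in> module_hom A M (M\<lparr>carrier := V\<rparr>)"
    "\<And>u v. u \<in> U \<Longrightarrow> v \<in> V \<Longrightarrow> pu (u \<oplus> v) = u \<and> pv (u \<oplus> v) = v"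
    "\<And>x. x \<in> carrier M \<Longrightarrow> pu x \<in> U \<and> pv x \<in> V \<and> x = pu x \<oplus> pv x"
proof -
  have U': "U \<subseteq> carrier M" "\<And>x y. x \<in> U \<Longrightarrow> y \<in> U \<Longrightarrow> x \<oplus> y \<in> U" 
    "\<And>a x. a \<in> carrier A \<Longrightarrow> x \<in> U \<Longrightarrow> a \<odot> x \<in> U" 
    and V': "V \<subseteq> carrier M" "\<And>x y. x \<in> V \<Longrightarrow> y \<in> V \<Longrightarrow> x \<oplus> y \<in> V" 
    "\<And>a x. a \<in> carrier A \<Longrightarrow> x \<in> V \<Longrightarrow> a \<odot> x \<in> V"
    using U V by (auto simp: submodule_iff)
  have "\<forall>x\<in>carrier M. \<exists>u. u \<in> U \<and> (\<exists>v. v \<in> V \<and> x = u \<oplus> v)"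
    using sum add_sum_iff[of _ U V] by blast
  then obtain pu where "\<forall>x\<in>carrier M. pu x \<in> U \<and> (\<exists>v. v \<in> V \<and> x = pu x \<oplus> v)"
    unfolding bchoice_iff by blast
  moreover from this have "\<forall>x\<in>carrier M. \<exists>v. v \<in> V \<and> x = pu x \<oplus> v" by blast
  then obtain pv where "\<forall>x\<in>carrier M. pv x \<in> V \<and> x = pu x \<oplus> pv x"
    unfolding bchoice_iff by blast
  ultimately have p: "pu x \<in> U" "pv x \<in> V" "x = pu x \<oplus> pv x" if "x \<in> carrier M" for x
    using that by blast+
  \<comment> \<open>Equality of the two sums gives \<open>u - u' = v' - v\<close>, an element of the
    zero intersection.\<close>
  have uniq: "u = u' \<and> v = v'"
    if uv: "u \<in> U" "u' \<in> U" "v \<in> V" "v' \<in> V" and eq: "u \<oplus> v = u' \<oplus> v'" for u u' v v'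
  proof -
    have c: "u \<in> carrier M" "u' \<in> carrier M" "v \<in> carrier M" "v' \<in> carrier M"
      using uv U'(1) V'(1) by auto
    have "u \<ominus> u' = (u \<oplus> v) \<ominus> (u' \<oplus> v)" using c by (simp add: M.minus_eq M.minus_add M.a_ac M.r_neg)
    also have "\<dots> = (v' \<ominus> v) \<oplus> (u' \<ominus> u')" unfolding eq using c
      by (simp add: M.minus_eq M.minus_add M.a_ac)
    also have "\<dots> = v' \<ominus> v" using c by (simp add: M.minus_eq M.r_neg)
    finally have "u \<ominus> u' = v' \<ominus> v" .
    moreover have "u \<ominus> u' \<in> U" by (rule submodule_minus[OF U uv(1,2)])
    moreover have "v' \<ominus> v \<in> V" by (rule submodule_minus[OF V uv(4,3)])
    ultimately have "u \<ominus> u' = \<zero>" "v' \<ominus> v = \<zero>" using int by auto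
    then show ?thesis using c by simp
  qed
  have puv: "pu (u \<oplus> v) = u \<and> pv (u \<oplus> v) = v" if uv: "u \<in> U" "v \<in> V" for u v
  proof -
    have "u \<oplus> v \<in> carrier M" using uv U'(1) V'(1) by auto
    from p[OF this] uniq[of "pu (u \<oplus> v)" u "pv (u \<oplus> v)" v] uv show ?thesis by auto
  qed
  have add: "pu (x \<oplus> y) = pu x \<oplus> pu y \<and> pv (x \<oplus> y) = pv x \<oplus> pv y"
    if xy: "x \<in> carrier M" "y \<in> carrier M" for x y
  proof -
    note px = p[OF xy(1)] and py = p[OF xy(2)]
    have c: "pu x \<in> carrier M" "pv x \<in> carrier M" "pu y \<in> carrier M" "pv y \<in> carrier M"
      using px py U'(1) V'(1) by auto
    have "x \<oplus> y = (pu x \<oplus> pv x) \<oplus> (pu y \<oplus> pv y)" using px(3) py(3) by simp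
    also have "\<dots> = (pu x \<oplus> pu y) \<oplus> (pv x \<oplus> pv y)" using c by (simp add: M.a_ac)
    finally show ?thesis using puv[of "pu x \<oplus> pu y" "pv x \<oplus> pv y"] px py U'(2) V'(2) by simp
  qed
  have smult: "pu (a \<odot> x) = a \<odot> pu x \<and> pv (a \<odot> x) = a \<odot> pv x"
    if a: "a \<in> carrier A" and x: "x \<in> carrier M" for a x
  proof -
    note px = p[OF x]
    have c: "pu x \<in> carrier M" "pv x \<in> carrier M" using px U'(1) V'(1) by auto
    have "a \<odot> x = a \<odot> (pu x \<oplus> pv x)" using px(3) by simp
    also have "\<dots> = a \<odot> pu x \<oplus> a \<odot> pv x" using c a by (rule_tac smult_r_distr)
    finally show ?thesis using puv[of "a \<odot> pu x" "a \<odot> pv x"] px a U'(3) V'(3) by simp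
  qed
  show thesis
  proof (rule that)
    show "pu \<in> module_hom A M (M\<lparr>carrier := U\<rparr>)" by (rule module_homI) (use p add smult in auto)
    show "pv \<in> module_hom A M (M\<lparr>carrier := V\<rparr>)" by (rule module_homI) (use p add smult in auto)
  qed (use puv p in blast)+
qed

lemma decomposition_reindex:
  assumes dec: "decomposition A M I F e p" and \<sigma>: "bij_betw \<sigma> I' I"
    and F: "\<And>i. i \<in> I' \<Longrightarrow> F' i = F (\<sigma> i)"
  shows "decomposition A M I' F' (\<lambda>i. e (\<sigma> i)) (\<lambda>i. p (\<sigma> i))"
proof -
  interpret decomposition A M I F e p by fact
  have \<sigma>I: "\<sigma> i \<in> I" if "i \<in> I'" for i using \<sigma> that by (auto simp: bij_betw_def)
  have \<sigma>_eq: "\<sigma> i = \<sigma> j \<longleftrightarrow> i = j" if "i \<in> I'" "j \<in> I'" for i j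
    using \<sigma> that by (auto simp: bij_betw_def dest: inj_onD)
  show ?thesis
  proof (intro decomposition.intro decomposition_axioms.intro)
    show "left_module A M" by (rule left_module_axioms)
    fix x assume x: "x \<in> carrier M"
    have "{i \<in> I'. p (\<sigma> i) x \<noteq> \<zero>\<^bsub>F' i\<^esub>} = (inv_into I' \<sigma>) ` {i \<in> I. p i x \<noteq> \<zero>\<^bsub>F i\<^esub>}"
      using \<sigma> F by (force simp: bij_betw_def image_iff)
    then show "finite {i \<in> I'. p (\<sigma> i) x \<noteq> \<zero>\<^bsub>F' i\<^esub>}" using finite_support[OF x] by simp
    assume 0: "\<And>i. i \<in> I' \<Longrightarrow> p (\<sigma> i) x = \<zero>\<^bsub>F' i\<^esub>"
    show "x = \<zero>\<^bsub>M\<^esub>"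
    proof (rule proj_jointly_inj[OF x])
      fix i assume "i \<in> I"
      then obtain j where "j \<in> I'" "i = \<sigma> j" using \<sigma> by (auto simp: bij_betw_def)
      then show "p i x = \<zero>\<^bsub>F i\<^esub>" using 0[of j] F[of j] by simp
    qed
  qed (use \<sigma>I \<sigma>_eq F summand emb proj proj_emb in auto)
qed

text \<open>Embeddings and projections of the two halves are combined with the projections of
  \<open>M\<close> onto \<open>U\<close> and \<open>V\<close>. Disjoint index sets let both halves
  share the family \<open>F\<close>.\<close>

lemma decomposition_direct_sum:
  assumes M: "left_module A M"
    and U: "Module.submodule U A M" and V: "Module.submodule V A M"
    and int: "U \<inter> V = {\<zero>\<^bsub>M\<^esub>}" and sum: "U <+>\<^bsub>M\<^esub> V = carrier M"
    and decU: "decomposition A (M\<lparr>carrier := U\<rparr>) I F e p"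
    and decV: "decomposition A (M\<lparr>carrier := V\<rparr>) I' F e' p'"
    and disj: "I \<inter> I' = {}"
  shows "\<exists>e p. decomposition A M (I \<union> I') F e p"
proof -
  interpret left_module A M by fact
  interpret U: decomposition A "M\<lparr>carrier := U\<rparr>" I F e p by fact
  interpret V: decomposition A "M\<lparr>carrier := V\<rparr>" I' F e' p' by fact
  obtain pu pv where pu: "pu \<in> module_hom A M (M\<lparr>carrier := U\<rparr>)" and pv: "pv \<in> module_hom A M (M\<lparr>carrier := V\<rparr>)"
    and puv: "\<And>u v. u \<in> U \<Longrightarrow> v \<in> V \<Longrightarrow> pu (u \<oplus>\<^bsub>M\<^esub> v) = u \<and> pv (u \<oplus>\<^bsub>M\<^esub> v) = v"
    and p: "\<And>x. x \<in> carrier M \<Longrightarrow> pu x \<in> U \<and> pv x \<in> V \<and> x = pu x \<oplus>\<^bsub>M\<^esub> pv x"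
    by (rule direct_sum_projections[OF U V int sum]) blast
  have sub: "U \<subseteq> carrier M" "V \<subseteq> carrier M" "\<zero>\<^bsub>M\<^esub> \<in> U" "\<zero>\<^bsub>M\<^esub> \<in> V"
    using U V by (auto simp: submodule_iff)
  have pu_u: "pu u = u" "pv u = \<zero>\<^bsub>M\<^esub>" if "u \<in> U" for u
    using puv[OF that sub(4)] that sub by auto
  have pv_v: "pv v = v" "pu v = \<zero>\<^bsub>M\<^esub>" if "v \<in> V" for v
    using puv[OF sub(3) that] that sub by auto
  have eU: "e i y \<in> U" if "i \<in> I" "y \<in> carrier (F i)" for i y
    using module_hom_in[OF U.emb[OF that(1)] that(2)] by simp
  have eV: "e' i y \<in> V" if "i \<in> I'" "y \<in> carrier (F i)" for i y
    using module_hom_in[OF V.emb[OF that(1)] that(2)] by simp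
  have p0: "p i \<zero>\<^bsub>M\<^esub> = \<zero>\<^bsub>F i\<^esub>" if "i \<in> I" for i
    using left_module_hom.zero[OF U.proj_hom[OF that]] by simp
  have p'0: "p' i \<zero>\<^bsub>M\<^esub> = \<zero>\<^bsub>F i\<^esub>" if "i \<in> I'" for i
    using left_module_hom.zero[OF V.proj_hom[OF that]] by simp
  let ?e = "\<lambda>i. if i \<in> I then e i else e' i"
  let ?p = "\<lambda>i x. if i \<in> I then p i (pu x) else p' i (pv x)"
  have "decomposition A M (I \<union> I') F ?e ?p"
  proof (intro decomposition.intro decomposition_axioms.intro)
    show "left_module A M" by fact
    fix i assume i: "i \<in> I \<union> I'"
    show "left_module A (F i)" using i U.summand V.summand by blast
    show "?e i \<in> module_hom A (F i) M"
    proof (cases "i \<in> I")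
      case True
      then show ?thesis
        using module_hom_comp[OF U.emb[OF True] module_hom_inclusion[OF U]] by simp
    next
      case False
      then have "i \<in> I'" using i by blast
      then show ?thesis
        using module_hom_comp[OF V.emb[OF \<open>i \<in> I'\<close>] module_hom_inclusion[OF V]] False by simp
    qed
    show "?p i \<in> module_hom A M (F i)"
    proof (cases "i \<in> I")
      case True
      then show ?thesis using module_hom_comp[OF pu U.proj[OF True]] by simp
    next
      case False
      then have "i \<in> I'" using i by blast
      then show ?thesis using module_hom_comp[OF pv V.proj[OF \<open>i \<in> I'\<close>]] False by simp
    qed
    fix j y assume j: "j \<in> I \<union> I'" and y: "y \<in> carrier (F i)"
    show "?p j (?e i y) = (if j = i then y else \<zero>\<^bsub>F j\<^esub>)"
    proof (cases "i \<in> I")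
      case True
      then show ?thesis
        using eU[OF True y] U.proj_emb[OF True _ y, of j] p'0[of j] pu_u[of "e i y"] j disj by auto
    next
      case False
      then have i': "i \<in> I'" using i by blast
      then show ?thesis
        using eV[OF i' y] V.proj_emb[OF i' _ y, of j] p0[of j] pv_v[of "e' i y"] j False disj by auto
    qed
  next
    fix x assume x: "x \<in> carrier M"
    have "{i \<in> I \<union> I'. ?p i x \<noteq> \<zero>\<^bsub>F i\<^esub>} \<subseteq>
      {i \<in> I. p i (pu x) \<noteq> \<zero>\<^bsub>F i\<^esub>} \<union> {i \<in> I'. p' i (pv x) \<noteq> \<zero>\<^bsub>F i\<^esub>}"
      by auto
    moreover have "finite {i \<in> I. p i (pu x) \<noteq> \<zero>\<^bsub>F i\<^esub>}"
      by (rule U.finite_support) (use p[OF x] in simp)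
    moreover have "finite {i \<in> I'. p' i (pv x) \<noteq> \<zero>\<^bsub>F i\<^esub>}"
      by (rule V.finite_support) (use p[OF x] in simp)
    ultimately show "finite {i \<in> I \<union> I'. ?p i x \<noteq> \<zero>\<^bsub>F i\<^esub>}"
      by (meson finite_UnI finite_subset)
    assume 0: "\<And>i. i \<in> I \<union> I' \<Longrightarrow> ?p i x = \<zero>\<^bsub>F i\<^esub>"
    have "pu x = \<zero>\<^bsub>M\<lparr>carrier := U\<rparr>\<^esub>"
    proof (rule U.proj_jointly_inj)
      show "p i (pu x) = \<zero>\<^bsub>F i\<^esub>" if "i \<in> I" for i using 0[of i] that by simp
    qed (use p[OF x] in simp)
    moreover have "pv x = \<zero>\<^bsub>M\<lparr>carrier := V\<rparr>\<^esub>"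
    proof (rule V.proj_jointly_inj)
      show "p' i (pv x) = \<zero>\<^bsub>F i\<^esub>" if i: "i \<in> I'" for i
      proof -
        have "i \<notin> I" using i disj by blast
        then show ?thesis using 0[of i] i by simp
      qed
    qed (use p[OF x] in simp)
    ultimately have "pu x = \<zero>\<^bsub>M\<^esub>" "pv x = \<zero>\<^bsub>M\<^esub>" by simp_all
    then show "x = \<zero>\<^bsub>M\<^esub>" using p[OF x] by simp
  qed
  then show ?thesis by blast
qed

section \<open>Representatives and existence of decompositions\<close>

lemma complete_indecomposablesD:
  assumes "complete_indecomposables K A (\<L> :: ('a, 'm) module set)"
  shows "\<And>Y. Y \<in> \<L> \<Longrightarrow> fd_module K A Y" "\<And>Y. Y \<in> \<L> \<Longrightarrow> indecomposable A Y"
    and "\<And>L :: ('a, 'm) module. fd_module K A L \<Longrightarrow> indecomposable A L \<Longrightarrow> \<exists>!Y. Y \<in> \<L> \<and> module_iso A L Y"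
  using assms unfolding complete_indecomposables_def by blast+

lemma representative_props:
  assumes "complete_indecomposables K A \<L>" "fd_module K A L" "indecomposable A L"
  shows "representative A \<L> L \<in> \<L>" "module_iso A L (representative A \<L> L)"
    and "\<And>Y. Y \<in> \<L> \<Longrightarrow> module_iso A L Y \<Longrightarrow> Y = representative A \<L> L"
proof -
  note ex1 = complete_indecomposablesD(3)[OF assms]
  show "representative A \<L> L \<in> \<L>" "module_iso A L (representative A \<L> L)"
    unfolding representative_def using theI'[OF ex1] by auto
  then show "\<And>Y. Y \<in> \<L> \<Longrightarrow> module_iso A L Y \<Longrightarrow> Y = representative A \<L> L" using ex1 by auto
qed

context fd_modules
begin

text \<open>Induction on the dimension over \<open>K\<close>: a module is zero, indecomposable, or
  the direct sum of two nonzero submodules, both of smaller dimension.\<close>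

lemma krull_schmidt_exists:
  fixes M :: "('a, 'm) module" and \<L> :: "('a, 'm) module set"
  assumes \<L>: "complete_indecomposables K A \<L>" and "fd_module K A M"
  shows "\<exists>(d :: ('a, 'm) module \<Rightarrow> nat) e p. decomposition A M (SIGMA Y:\<L>. {..<d Y}) fst e p"
  using assms(2)
proof (induction "vectorspace.dim K (underlying_space A M)" arbitrary: M rule: less_induct)
  case less
  note M = fd_moduleD[OF less.prems]
  interpret M: left_module A M by (rule M)
  interpret UM: vectorspace K "underlying_space A M" by (rule underlying_vectorspace[OF M(1)])
  consider (zero) "carrier M = {\<zero>\<^bsub>M\<^esub>}" | (indec) "indecomposable A M"
    | (split) U V where "Module.submodule U A M" "Module.submodule V A M" "U \<inter> V = {\<zero>\<^bsub>M\<^esub>}"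
      "U <+>\<^bsub>M\<^esub> V = carrier M" "U \<noteq> {\<zero>\<^bsub>M\<^esub>}" "V \<noteq> {\<zero>\<^bsub>M\<^esub>}"
    unfolding indecomposable_def by blast
  then show ?case
  proof cases
    case zero
    \<comment> \<open>All multiplicities are zero, so the index set is empty and the embeddings and
      projections are arbitrary.\<close>
    have "decomposition A M (SIGMA Y:\<L>. {..<0 :: nat}) fst (\<lambda>i x. \<zero>\<^bsub>M\<^esub>) (\<lambda>i x. x)"
      by (intro decomposition.intro decomposition_axioms.intro M(1)) (use zero in auto)
    then show ?thesis by (rule_tac exI[of _ "\<lambda>_. 0"]) blast
  next
    case indec
    let ?Y = "representative A \<L> M"
    note Y = representative_props[OF \<L> less.prems indec]
    have YL: "left_module A ?Y" using fd_moduleD(1) complete_indecomposablesD(1)[OF \<L> Y(1)] by blast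
    obtain f g where fg: "f \<in> module_hom A M ?Y" "g \<in> module_hom A ?Y M"
      "\<And>x. x \<in> carrier M \<Longrightarrow> g (f x) = x" "\<And>y. y \<in> carrier ?Y \<Longrightarrow> f (g y) = y"
      by (rule module_isoE[OF Y(2) M(1) YL]) blast
    have S: "(SIGMA Y:\<L>. {..<if Y = ?Y then 1 else 0 :: nat}) = {(?Y, 0)}"
      using Y(1) by (auto split: if_splits)
    interpret g: left_module_hom A ?Y M g by (rule left_module_homI[OF YL M(1) fg(2)])
    have "decomposition A M {(?Y, 0 :: nat)} fst (\<lambda>_. g) (\<lambda>_. f)"
    proof (intro decomposition.intro decomposition_axioms.intro M(1))
      fix x assume x: "x \<in> carrier M" and 0: "\<And>i. i \<in> {(?Y, 0 :: nat)} \<Longrightarrow> f x = \<zero>\<^bsub>fst i\<^esub>"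
      have "x = g \<zero>\<^bsub>?Y\<^esub>" using fg(3)[OF x] 0[of "(?Y, 0)"] by simp
      then show "x = \<zero>\<^bsub>M\<^esub>" by simp
    qed (use YL fg in auto)
    then show ?thesis unfolding S[symmetric] by (intro exI)
  next
    case split
    note sU = submodule_subspace[OF M(1) split(1)] and sV = submodule_subspace[OF M(1) split(2)]
    have sub: "U \<subseteq> carrier M" "V \<subseteq> carrier M" using split(1,2) by (auto simp: M.submodule_iff)
    \<comment> \<open>If one summand were everything, the other would equal the zero
      intersection.\<close>
    have "U \<noteq> carrier M" "V \<noteq> carrier M" using split(3,5,6) sub by blast+
    then have "vectorspace.dim K (UM.vs U) < UM.dim" "vectorspace.dim K (UM.vs V) < UM.dim"
      using UM.subspace_dim_le[OF M(2) sU] UM.subspace_dim_le[OF M(2) sV] by (auto simp: less_le)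
    then have "\<exists>(d :: ('a, 'm) module \<Rightarrow> nat) e p. decomposition A (M\<lparr>carrier := U\<rparr>) (SIGMA Y:\<L>. {..<d Y}) fst e p"
      "\<exists>(d :: ('a, 'm) module \<Rightarrow> nat) e p. decomposition A (M\<lparr>carrier := V\<rparr>) (SIGMA Y:\<L>. {..<d Y}) fst e p"
      using less.hyps[OF _ fd_submodule[OF less.prems split(1)]]
        less.hyps[OF _ fd_submodule[OF less.prems split(2)]]
      by (simp_all add: underlying_space_submodule)
    then obtain d d' :: "('a, 'm) module \<Rightarrow> nat" and e p e' p' where
      d: "decomposition A (M\<lparr>carrier := U\<rparr>) (SIGMA Y:\<L>. {..<d Y}) fst e p" and
      d': "decomposition A (M\<lparr>carrier := V\<rparr>) (SIGMA Y:\<L>. {..<d' Y}) fst e' p'" by blast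
    \<comment> \<open>The copies of \<open>Y\<close> in the second half are renumbered to start at
      \<open>d Y\<close>: this makes the index sets disjoint and their union again of the required
      form.\<close>
    let ?I = "SIGMA Y:\<L>. {..<d Y}" and ?I' = "SIGMA Y:\<L>. {d Y..<d Y + d' Y}"
    let ?s = "\<lambda>(Y, i). (Y, i - d Y)"
    have bij: "bij_betw ?s ?I' (SIGMA Y:\<L>. {..<d' Y})"
      by (rule bij_betwI[where g = "\<lambda>(Y, i). (Y, i + d Y)"]) auto
    have "\<exists>e p. decomposition A M (?I \<union> ?I') fst e p"
      by (rule decomposition_direct_sum[OF M(1) split(1-4) d decomposition_reindex[OF d' bij]]) auto
    moreover have "?I \<union> ?I' = (SIGMA Y:\<L>. {..<d Y + d' Y})" by auto
    ultimately show ?thesis by (intro exI[of _ "\<lambda>Y. d Y + d' Y"]) simp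
  qed
qed

lemma multiple_dsum_decomposition:
  assumes "\<And>Y. Y \<in> J \<Longrightarrow> left_module A Y"
  shows "\<exists>e p. decomposition A (multiple_dsum J d) (SIGMA Y:J. {..<d Y}) fst e p"
proof -
  have "ring A" ..
  moreover have "left_module A (fst i)" if "i \<in> (SIGMA Y:J. {..<d Y})" for i
    using assms that by auto
  ultimately show ?thesis
    unfolding multiple_dsum_def by (intro exI) (rule dsum_decomposition)
qed

end

section \<open>Multiplicities and uniqueness of the decomposition\<close>

context alg_closed_modules
begin

text \<open>The summands isomorphic to \<open>L\<close> are exactly the copies of its
  representative, so there are finitely many for every \<open>d\<close>. Both dimensions are
  independent of \<open>d\<close>, hence the equation determines the multiplicity.\<close>

lemma multiplicity_from_radical:
  assumes \<L>: "complete_indecomposables K A \<L>"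
    and L: "fd_module K A L" "indecomposable A L" and M: "fd_module K A M"
    and iso: "module_iso A M (multiple_dsum \<L> d)"
  shows "hom_dim K A L M = vectorspace.dim K ((hom_space A L M)\<lparr>carrier := radical A L M\<rparr>)
    + d (representative A \<L> L)"
proof -
  note \<L>D = complete_indecomposablesD[OF \<L>] and rep = representative_props[OF \<L> L]
  let ?I = "SIGMA Y:\<L>. {..<d Y}"
  obtain e p where "decomposition A (multiple_dsum \<L> d) ?I fst e p"
    using multiple_dsum_decomposition[of \<L> d] fd_moduleD(1) \<L>D(1) by blast
  then obtain e p where dec: "decomposition A M ?I fst e p"
    using decomposition.transfer_iso[OF _ fd_moduleD(1)[OF M] iso] by blast
  have iff: "Y \<in> \<L> \<and> module_iso A L Y \<longleftrightarrow> Y = representative A \<L> L" for Y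
    using rep by blast
  have "{i \<in> ?I. module_iso A L (fst i)} =
      (SIGMA Y:{Y. Y \<in> \<L> \<and> module_iso A L Y}. {..<d Y})" by auto
  also have "\<dots> = {representative A \<L> L} \<times> {..<d (representative A \<L> L)}"
    unfolding iff by auto
  finally have eq: "{i \<in> ?I. module_iso A L (fst i)} =
    {representative A \<L> L} \<times> {..<d (representative A \<L> L)}" .
  have ind: "indecomposable A (fst i)" if "i \<in> ?I" for i using \<L>D(2) that by auto
  show ?thesis
    using dim_hom_radical[OF L M dec ind] unfolding eq by (simp add: card_cartesian_product)
qed

text \<open>The definite description in \<open>decomposition_vector\<close> has to be justified.
  Uniqueness follows by comparing two candidates at each \<open>Y\<close> in \<L> through
  \<open>multiplicity_from_radical\<close>.\<close>

lemma decomposition_vector_props: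
  fixes M :: "('a, 'm) module" and \<L> :: "('a, 'm) module set"
  assumes \<L>: "complete_indecomposables K A \<L>" and M: "fd_module K A M"
  shows "module_iso A M (multiple_dsum \<L> (decomposition_vector A \<L> M))"
proof -
  note \<L>D = complete_indecomposablesD[OF \<L>]
  let ?P = "\<lambda>d. d \<in> extensional \<L> \<and> module_iso A M (multiple_dsum \<L> d)"
  obtain d :: "('a, 'm) module \<Rightarrow> nat" and e p
    where "decomposition A M (SIGMA Y:\<L>. {..<d Y}) fst e p"
    using krull_schmidt_exists[OF \<L> M] by blast
  then have "module_iso A M (multiple_dsum \<L> d)"
    unfolding multiple_dsum_def by (rule decomposition.iso_dsum)
  \<comment> \<open>Only values on \<L> enter the sum, so the function found may be made
    extensional.\<close>
  moreover have "multiple_dsum \<L> (restrict d \<L>) = multiple_dsum \<L> d"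
    unfolding multiple_dsum_def by (simp cong: Sigma_cong)
  ultimately have ex: "?P (restrict d \<L>)" by simp
  have "\<exists>!d. ?P d"
  proof (rule ex1I[of ?P, OF ex])
    fix d' assume d': "?P d'"
    show "d' = restrict d \<L>"
    proof (rule extensionalityI[of _ \<L>])
      fix Y assume Y: "Y \<in> \<L>"
      have "representative A \<L> Y = Y"
        using representative_props(3)[OF \<L> \<L>D(1)[OF Y] \<L>D(2)[OF Y] Y module_iso_refl] by simp
      then show "d' Y = restrict d \<L> Y"
        using multiplicity_from_radical[OF \<L> \<L>D(1)[OF Y] \<L>D(2)[OF Y] M] d' ex by (metis add_left_cancel)
    qed (use d' ex in auto)
  qed
  from theI'[OF this] show ?thesis unfolding decomposition_vector_def by blast
qed

end

section \<open>Almost split maps\<close>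

text \<open>The universal property of a quotient for an arbitrary surjection. The factor applies
  \<open>h\<close> to chosen preimages; the kernel condition makes the result independent of the
  choice.\<close>

lemma factor_through_surj:
  assumes L: "left_module A L" and E: "left_module A E" and M: "left_module A M"
    and g: "g \<in> module_hom A L E" "g ` carrier L = carrier E"
    and h: "h \<in> module_hom A L M"
    and ker: "\<And>x. x \<in> carrier L \<Longrightarrow> g x = \<zero>\<^bsub>E\<^esub> \<Longrightarrow> h x = \<zero>\<^bsub>M\<^esub>"
  shows "\<exists>k\<in>module_hom A E M. \<forall>x\<in>carrier L. k (g x) = h x"
proof -
  interpret g: left_module_hom A L E g by (rule left_module_homI[OF L E g(1)])
  interpret h: left_module_hom A L M h by (rule left_module_homI[OF L M h])
  let ?s = "inv_into (carrier L) g"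
  have s: "?s y \<in> carrier L" "g (?s y) = y" if "y \<in> carrier E" for y
    using that inv_into_into[of y g "carrier L"] f_inv_into_f[of y g "carrier L"] g(2) by auto
  have eq: "h x = h x'" if "x \<in> carrier L" "x' \<in> carrier L" "g x = g x'" for x x'
    using ker[of "x \<ominus>\<^bsub>L\<^esub> x'"] that by simp
  have k: "h (?s (g x)) = h x" if "x \<in> carrier L" for x
    by (rule eq) (use that s in auto)
  have "(\<lambda>y. h (?s y)) \<in> module_hom A E M"
  proof (rule module_homI)
    show "h (?s y) \<in> carrier M" if "y \<in> carrier E" for y using s[OF that] by simp
    show "h (?s (x \<oplus>\<^bsub>E\<^esub> y)) = h (?s x) \<oplus>\<^bsub>M\<^esub> h (?s y)" if "x \<in> carrier E" "y \<in> carrier E" for x y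
      using k[of "?s x \<oplus>\<^bsub>L\<^esub> ?s y"] s[OF that(1)] s[OF that(2)] by simp
    show "h (?s (a \<odot>\<^bsub>E\<^esub> y)) = a \<odot>\<^bsub>M\<^esub> h (?s y)" if "a \<in> carrier A" "y \<in> carrier E" for a y
      using k[of "a \<odot>\<^bsub>L\<^esub> ?s y"] s[OF that(2)] that(1) by (simp add: g.M.smult_closed)
  qed
  then show ?thesis using k by (intro bexI[of _ "\<lambda>y. h (?s y)"]) simp
qed

section \<open>Quotient modules and the socle\<close>

lemma quotient_module_simps [simp]:
  "carrier (quotient_module L S) = a_rcosets\<^bsub>L\<^esub> S"
  "add (quotient_module L S) = set_add L"
  "a \<odot>\<^bsub>quotient_module L S\<^esub> C = (\<Union>x\<in>C. S +>\<^bsub>L\<^esub> (a \<odot>\<^bsub>L\<^esub> x))"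
  by (simp_all add: quotient_module_def)

context left_module
begin

lemma submodule_abelian_subgroup:
  assumes "Module.submodule U A M"
  shows "abelian_subgroup U M"
proof -
  interpret U: Module.submodule U A M by fact
  show ?thesis
    by (rule abelian_subgroupI3[OF _ M.abelian_group_axioms])
      (auto simp: additive_subgroup_def intro: U.subgroup_axioms)
qed

end

context
  fixes A :: "('k, 'a) module" and M :: "('a, 'm) module" (structure)
  assumes left_module: "left_module A M"
begin

interpretation left_module A M by (rule left_module)

lemma coset_map_hom:
  assumes U: "Module.submodule U A M"
  shows "(\<lambda>x. U +>\<^bsub>M\<^esub> x) \<in> module_hom A M (quotient_module M U)"
proof -
  interpret U: abelian_subgroup U M by (rule submodule_abelian_subgroup[OF U])
  have Us: "\<And>a u. a \<in> carrier A \<Longrightarrow> u \<in> U \<Longrightarrow> a \<odot> u \<in> U" and UM: "U \<subseteq> carrier M"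
    using U by (auto simp: submodule_iff)
  show ?thesis
  proof (rule module_homI)
    show "U +> x \<in> carrier (quotient_module M U)" if "x \<in> carrier M" for x
      using that by (auto simp: A_RCOSETS_def')
    show "U +> (x \<oplus> y) = (U +> x) \<oplus>\<^bsub>quotient_module M U\<^esub> (U +> y)"
      if "x \<in> carrier M" "y \<in> carrier M" for x y
      using U.a_rcos_sum[OF that] by simp
    fix a x assume a: "a \<in> carrier A" and x: "x \<in> carrier M"
    \<comment> \<open>All representatives of a coset yield the same coset, so the union defining the
      action on the quotient collapses to a single one.\<close>
    have "U +> (a \<odot> z) = U +> (a \<odot> x)" if z: "z \<in> U +> x" for z
    proof -
      obtain u where u: "u \<in> U" "z = u \<oplus> x" using z by (auto simp: a_r_coset_def')
      have "a \<odot> z = a \<odot> u \<oplus> a \<odot> x" using u UM a x by (auto simp: smult_r_distr)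
      then have "a \<odot> z \<in> U +> (a \<odot> x)" using Us[OF a u(1)] by (auto simp: a_r_coset_def')
      then show ?thesis using U.a_repr_independence'[OF _ smult_closed[OF a x]] by simp
    qed
    then have "(\<Union>z\<in>U +> x. U +> (a \<odot> z)) = (\<Union>z\<in>U +> x. U +> (a \<odot> x))"
      by (rule SUP_cong[OF refl])
    also have "\<dots> = U +> (a \<odot> x)" using U.a_rcos_self[OF x] by blast
    finally show "U +> (a \<odot> x) = a \<odot>\<^bsub>quotient_module M U\<^esub> (U +> x)" by simp
  qed
qed

text \<open>Comparison with the coset of zero expresses the kernel of the coset map without using
  the module laws of the quotient.\<close>

lemma coset_eq_iff:
  assumes U: "Module.submodule U A M" and x: "x \<in> carrier M"
  shows "U +> x = U +> \<zero> \<longleftrightarrow> x \<in> U"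
proof -
  interpret U: abelian_subgroup U M by (rule submodule_abelian_subgroup[OF U])
  have UM: "U \<subseteq> carrier M" using U by (auto simp: submodule_iff)
  have "U +> \<zero> = U" using UM by (force simp: a_r_coset_def')
  then show ?thesis using U.a_rcos_self[OF x] U.a_rcos_const by auto
qed

text \<open>The whole module belongs to the intersected family, so the intersection is not over the
  empty set.\<close>

lemma socle_submodule: "Module.submodule (socle A M) A M"
proof -
  have "carrier M \<in> {U. Module.submodule U A M \<and> (\<forall>S. simple_submodule A M S \<longrightarrow> S \<subseteq> U)}"
    using submodule_self by (auto simp: simple_submodule_def submodule_iff)
  then show ?thesis unfolding socle_def by (auto simp: submodule_iff)
qed

lemma simple_subset_socle: "simple_submodule A M S \<Longrightarrow> S \<subseteq> socle A M"
  by (auto simp: socle_def)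

end

context fd_modules
begin

text \<open>A nonzero submodule of least dimension is simple.\<close>

lemma simple_submodule_exists:
  assumes M: "fd_module K A M" and nz: "carrier M \<noteq> {\<zero>\<^bsub>M\<^esub>}"
  shows "\<exists>S. simple_submodule A M S"
proof -
  note MM = fd_moduleD[OF M]
  interpret M: left_module A M by (rule MM)
  interpret UM: vectorspace K "underlying_space A M" by (rule underlying_vectorspace[OF MM(1)])
  let ?P = "\<lambda>S. Module.submodule S A M \<and> S \<noteq> {\<zero>\<^bsub>M\<^esub>}"
  have "?P (carrier M)" using M.submodule_self nz by simp
  then obtain S where S: "?P S" and min: "\<And>T. ?P T \<Longrightarrow>
      vectorspace.dim K (UM.vs S) \<le> vectorspace.dim K (UM.vs T)"
    using ex_has_least_nat[of ?P "carrier M" "\<lambda>S. vectorspace.dim K (UM.vs S)"] by blast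
  have "T = {\<zero>\<^bsub>M\<^esub>} \<or> T = S" if T: "Module.submodule T A M" "T \<subseteq> S" for T
  proof (rule disjCI)
    assume "T \<noteq> S"
    moreover have sub: "subspace K T (underlying_space A M)" "subspace K S (underlying_space A M)"
      using submodule_subspace[OF MM(1)] T S by auto
    ultimately have "vectorspace.dim K (UM.vs T) < vectorspace.dim K (UM.vs S)"
      using UM.subspace_dim_mono[OF MM(2) sub T(2)] by linarith
    then show "T = {\<zero>\<^bsub>M\<^esub>}" using min[of T] T(1) by linarith
  qed
  with S show ?thesis unfolding simple_submodule_def by blast
qed

text \<open>If \<open>U \<inter> V = 0\<close>, an extension of the projection \<open>U + V \<rightarrow> U\<close> to an endomorphism of \<open>L\<close> is
  neither injective nor nilpotent.\<close>

lemma injective_indecomposable_uniform: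
  assumes L: "fd_module K A L" "indecomposable A L" and inj: "injective_module K A L"
    and U: "Module.submodule U A L" "U \<noteq> {\<zero>\<^bsub>L\<^esub>}" and V: "Module.submodule V A L" "V \<noteq> {\<zero>\<^bsub>L\<^esub>}"
  shows "U \<inter> V \<noteq> {\<zero>\<^bsub>L\<^esub>}"
proof
  assume int: "U \<inter> V = {\<zero>\<^bsub>L\<^esub>}"
  note LL = fd_moduleD(1)[OF L(1)]
  interpret L: left_module A L by (rule LL)
  let ?Y = "L\<lparr>carrier := U <+>\<^bsub>L\<^esub> V\<rparr>"
  have S: "Module.submodule (U <+>\<^bsub>L\<^esub> V) A L" by (rule L.submodule_sum[OF U(1) V(1)])
  note UV_sub = L.submodule_in_sum[OF U(1) V(1)]
  have UL: "U \<subseteq> carrier L" "\<zero>\<^bsub>L\<^esub> \<in> U" and VL: "V \<subseteq> carrier L" "\<zero>\<^bsub>L\<^esub> \<in> V"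
    using U V by (auto simp: L.submodule_iff)
  interpret Y: left_module A ?Y by (rule L.submodule_is_left_module[OF S])
  have UY: "Module.submodule U A ?Y" and VY: "Module.submodule V A ?Y"
    using L.submodule_of_submodule[OF S] U V UV_sub by auto
  have "U <+>\<^bsub>?Y\<^esub> V = carrier ?Y" by (auto simp: set_eq_iff Y.add_sum_iff L.add_sum_iff)
  moreover have "U \<inter> V = {\<zero>\<^bsub>?Y\<^esub>}" using int by simp
  ultimately obtain pu pv where pu: "pu \<in> module_hom A ?Y (?Y\<lparr>carrier := U\<rparr>)"
    and "pv \<in> module_hom A ?Y (?Y\<lparr>carrier := V\<rparr>)"
    and puv': "\<And>u v. u \<in> U \<Longrightarrow> v \<in> V \<Longrightarrow> pu (u \<oplus>\<^bsub>?Y\<^esub> v) = u \<and> pv (u \<oplus>\<^bsub>?Y\<^esub> v) = v"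
    and "\<And>x. x \<in> carrier ?Y \<Longrightarrow> pu x \<in> U \<and> pv x \<in> V \<and> x = pu x \<oplus>\<^bsub>?Y\<^esub> pv x"
    using Y.direct_sum_projections[OF UY VY] by blast
  have puv: "pu (u \<oplus>\<^bsub>L\<^esub> v) = u" if "u \<in> U" "v \<in> V" for u v
    using puv'[OF that] by simp
  have puL: "pu \<in> module_hom A ?Y L"
    using pu UL by (auto simp: module_hom_def)
  obtain h where h: "h \<in> module_hom A L L" "\<And>x. x \<in> carrier ?Y \<Longrightarrow> h x = pu x"
    using inj L(1) fd_submodule[OF L(1) S] L.module_hom_inclusion[OF S] puL
    unfolding injective_module_def by (metis inj_on_id2)
  have hu: "h u = u" if "u \<in> U" for u
  proof -
    have "u \<in> carrier L" "u \<in> carrier ?Y" using that UL UV_sub(1) by auto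
    then show ?thesis using h(2)[of u] puv[OF that VL(2)] by simp
  qed
  have hv: "h v = \<zero>\<^bsub>L\<^esub>" if "v \<in> V" for v
  proof -
    have "v \<in> carrier L" "v \<in> carrier ?Y" using that VL UV_sub(2) by auto
    then show ?thesis using h(2)[of v] puv[OF UL(2) that] by simp
  qed
  obtain u v where u: "u \<in> U" "u \<noteq> \<zero>\<^bsub>L\<^esub>" and v: "v \<in> V" "v \<noteq> \<zero>\<^bsub>L\<^esub>"
    using U(2) V(2) UL VL by blast
  interpret h: left_module_hom A L L h by (rule left_module_homI[OF LL LL h(1)])
  have "\<not> inj_on h (carrier L)" unfolding h.inj_iff using hv v VL by blast
  then obtain n where "(h ^^ n) u = \<zero>\<^bsub>L\<^esub>" using fitting[OF L h(1)] u UL by blast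
  moreover have "(h ^^ n) u = u" for n by (induction n) (use hu u in auto)
  ultimately show False using u by metis
qed

text \<open>The map is the coset map followed by the given isomorphism, so its kernel is the socle.
  A nonsplit \<open>h\<close> factors through it because the kernel of \<open>h\<close> contains
  every simple submodule.\<close>

lemma injective_quotient_left_almost_split:
  fixes L :: "('a, 'm) module"
  assumes L: "fd_module K A L" "indecomposable A L" and inj: "injective_module K A L"
    and E: "left_module A E" and iso: "module_iso A (quotient_module L (socle A L)) E"
  shows "\<exists>f. f \<in> module_hom A L E \<and> f ` carrier L = carrier E \<and> left_almost_split K A L E f"
proof -
  note LL = fd_moduleD(1)[OF L(1)]
  interpret L: left_module A L by (rule LL)
  let ?S = "socle A L"
  have S: "Module.submodule ?S A L" by (rule socle_submodule[OF LL])
  have S0: "\<zero>\<^bsub>L\<^esub> \<in> ?S" "?S \<subseteq> carrier L" using S by (auto simp: L.submodule_iff)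
  obtain \<phi> where \<phi>: "\<phi> \<in> module_hom A (quotient_module L ?S) E"
      "bij_betw \<phi> (carrier (quotient_module L ?S)) (carrier E)"
    using iso by (auto simp: module_iso_def)
  define f where "f = (\<lambda>x. \<phi> (?S +>\<^bsub>L\<^esub> x))"
  have f: "f \<in> module_hom A L E" unfolding f_def
    by (rule module_hom_comp[OF coset_map_hom[OF LL S] \<phi>(1)])
  interpret f: left_module_hom A L E f by (rule left_module_homI[OF LL E f])
  have onto: "f ` carrier L = carrier E"
  proof -
    have "carrier E = \<phi> ` (a_rcosets\<^bsub>L\<^esub> ?S)" using \<phi>(2) by (simp add: bij_betw_def)
    also have "a_rcosets\<^bsub>L\<^esub> ?S = (\<lambda>x. ?S +>\<^bsub>L\<^esub> x) ` carrier L" by (auto simp: A_RCOSETS_def')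
    finally show ?thesis by (simp add: f_def image_image)
  qed
  have ker: "f x = \<zero>\<^bsub>E\<^esub> \<longleftrightarrow> x \<in> ?S" if x: "x \<in> carrier L" for x
  proof -
    have mem: "?S +>\<^bsub>L\<^esub> y \<in> carrier (quotient_module L ?S)" if "y \<in> carrier L" for y
      using that by (auto simp: A_RCOSETS_def')
    \<comment> \<open>The equation is compared at \<open>x\<close> and at zero, where injectivity of
      the isomorphism reduces it to an equality of cosets.\<close>
    have "f x = \<zero>\<^bsub>E\<^esub> \<longleftrightarrow> f x = f \<zero>\<^bsub>L\<^esub>" by simp
    also have "\<dots> \<longleftrightarrow> ?S +>\<^bsub>L\<^esub> x = ?S +>\<^bsub>L\<^esub> \<zero>\<^bsub>L\<^esub>"
      unfolding f_def using \<phi>(2) mem[OF x] mem[OF L.M.zero_closed]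
      by (auto simp: bij_betw_def dest: inj_onD)
    also have "\<dots> \<longleftrightarrow> x \<in> ?S" by (rule coset_eq_iff[OF LL S x])
    finally show ?thesis .
  qed
  obtain T where T: "simple_submodule A L T"
    using simple_submodule_exists[OF L(1) indecomposableD(1)[OF L(2)]] by blast
  \<comment> \<open>A nonzero socle makes \<open>f\<close> noninjective, hence not split.\<close>
  have Snz: "?S \<noteq> {\<zero>\<^bsub>L\<^esub>}"
    using simple_subset_socle[OF LL T] T by (auto simp: simple_submodule_def L.submodule_iff)
  have "left_almost_split K A L E f"
    unfolding left_almost_split_def
  proof (intro conjI allI impI)
    show "f \<in> module_hom A L E" by fact
    show "\<not> split_mono A L E f"
    proof
      assume "split_mono A L E f"
      then have "inj_on f (carrier L)" by (rule split_mono_inj)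
      then show False using Snz S0 ker unfolding f.inj_iff by blast
    qed
    fix Z :: "('a, 'm) module" and h
    assume "fd_module K A Z \<and> h \<in> module_hom A L Z \<and> \<not> split_mono A L Z h"
    then have Z: "fd_module K A Z" and h: "h \<in> module_hom A L Z" and ns: "\<not> split_mono A L Z h" by auto
    note ZZ = fd_moduleD(1)[OF Z]
    interpret h: left_module_hom A L Z h by (rule left_module_homI[OF LL ZZ h])
    \<comment> \<open>If \<open>h\<close> were injective, the identity of \<open>L\<close> would
      extend along \<open>h\<close> by injectivity of \<open>L\<close>, giving a retraction.\<close>
    have "\<not> inj_on h (carrier L)"
    proof
      assume "inj_on h (carrier L)"
      then obtain r where "r \<in> module_hom A Z L" "\<forall>x\<in>carrier L. r (h x) = x"
        using inj L(1) Z h module_hom_id[of A L] unfolding injective_module_def by blast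
      then show False using ns h by (auto simp: split_mono_def)
    qed
    then have Nnz: "{x \<in> carrier L. h x = \<zero>\<^bsub>Z\<^esub>} \<noteq> {\<zero>\<^bsub>L\<^esub>}" unfolding h.inj_iff by blast
    have "?S \<subseteq> {x \<in> carrier L. h x = \<zero>\<^bsub>Z\<^esub>}"
      unfolding socle_def
    proof (rule Inter_lower, clarsimp simp only: mem_Collect_eq, intro conjI allI impI)
      show "Module.submodule {x \<in> carrier L. h x = \<zero>\<^bsub>Z\<^esub>} A L" by (rule h.kernel_submodule)
      fix T assume T: "simple_submodule A L T"
      then have sT: "Module.submodule T A L" "T \<noteq> {\<zero>\<^bsub>L\<^esub>}" by (auto simp: simple_submodule_def)
      \<comment> \<open>By uniformity the simple \<open>T\<close> meets the kernel in a nonzero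
        submodule, which by simplicity is all of \<open>T\<close>.\<close>
      have "T \<inter> {x \<in> carrier L. h x = \<zero>\<^bsub>Z\<^esub>} \<noteq> {\<zero>\<^bsub>L\<^esub>}"
        by (rule injective_indecomposable_uniform[OF L inj sT h.kernel_submodule Nnz])
      moreover have "Module.submodule (T \<inter> {x \<in> carrier L. h x = \<zero>\<^bsub>Z\<^esub>}) A L"
        by (rule L.submodule_Int[OF sT(1) h.kernel_submodule])
      ultimately have "T \<inter> {x \<in> carrier L. h x = \<zero>\<^bsub>Z\<^esub>} = T"
        using T unfolding simple_submodule_def by blast
      then show "T \<subseteq> {x \<in> carrier L. h x = \<zero>\<^bsub>Z\<^esub>}" by blast
    qed
    then show "\<exists>h'\<in>module_hom A E Z. \<forall>x\<in>carrier L. h' (f x) = h x"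
      using factor_through_surj[OF LL E ZZ f onto h] ker by blast
  qed
  with f onto show ?thesis by blast
qed

text \<open>In effect the sequence 0, Hom(N, M), Hom(E, M), rad(L, M), 0 is exact; rank-nullity is
  applied to both of its maps. Stated for any surjection \<open>g\<close> with kernel the image of
  \<open>f\<close>, it serves the injective case, with \<open>N\<close> zero, as well.\<close>

lemma hom_dim_left_almost_split:
  fixes L M :: "('a, 'm) module"
  assumes L: "fd_module K A L" and M: "fd_module K A M" and N: "fd_module K A N"
    and E: "left_module A E" and fd: "vectorspace.fin_dim K (hom_space A E M)"
    and f: "left_almost_split K A L E f"
    and g: "g \<in> module_hom A E N" "g ` carrier E = carrier N"
    and exact: "f ` carrier L = {y \<in> carrier E. g y = \<zero>\<^bsub>N\<^esub>}"
  shows "hom_dim K A E M = hom_dim K A N M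
    + vectorspace.dim K ((hom_space A L M)\<lparr>carrier := radical A L M\<rparr>)"
proof -
  note LL = fd_moduleD(1)[OF L] and MM = fd_moduleD(1)[OF M] and NN = fd_moduleD(1)[OF N]
  interpret L: left_module A L by (rule LL)
  interpret E: left_module A E by (rule E)
  interpret M: left_module A M by (rule MM)
  interpret N: left_module A N by (rule NN)
  have fh: "f \<in> module_hom A L E" and fns: "\<not> split_mono A L E f"
    and fac: "\<And>h. h \<in> module_hom A L M \<Longrightarrow> \<not> split_mono A L M h \<Longrightarrow>
      \<exists>h'\<in>module_hom A E M. \<forall>x\<in>carrier L. h' (f x) = h x"
    using f M unfolding left_almost_split_def by blast+
  let ?T = "\<lambda>h. \<lambda>x\<in>carrier L. h (f x)" and ?G = "\<lambda>h. \<lambda>x\<in>carrier E. h (g x)"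
  have vsE: "vectorspace K (hom_space A E M)" and vsL: "vectorspace K (hom_space A L M)"
    and vsN: "vectorspace K (hom_space A N M)"
    using hom_space_vectorspace LL NN E MM by auto
  interpret T: linear_map K "hom_space A E M" "hom_space A L M" ?T
    by (rule linear_mapI[OF vsE vsL hom_precomp[OF E LL MM fh]])
  interpret G: linear_map K "hom_space A N M" "hom_space A E M" ?G
    by (rule linear_mapI[OF vsN vsE hom_precomp[OF NN E MM g(1)]])
  have im: "?T ` carrier (hom_space A E M) = radical A L M"
  proof (intro equalityI subsetI)
    fix k assume "k \<in> ?T ` carrier (hom_space A E M)"
    then obtain h where h: "h \<in> carrier (hom_space A E M)" "k = ?T h" by blast
    have hh: "h \<in> module_hom A E M" using h by simp
    have "k \<in> carrier (hom_space A L M)" unfolding h(2) by (rule T.T_im[OF h(1)])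
    \<comment> \<open>A retraction of the composite would give one of \<open>f\<close>, which is not
      split.\<close>
    moreover have "\<not> split_mono A L M (\<lambda>x. h (f x))"
      using split_mono_comp_imp[OF fh hh] fns by blast
    then have "\<not> split_mono A L M k"
      using split_mono_cong[OF LL, of k "\<lambda>x. h (f x)"] h(2) by simp
    ultimately show "k \<in> radical A L M" by (simp add: radical_def)
  next
    fix k assume k: "k \<in> radical A L M"
    then have kh: "k \<in> module_hom A L M" "k \<in> extensional (carrier L)" "\<not> split_mono A L M k"
      by (auto simp: radical_def)
    obtain h where h: "h \<in> module_hom A E M" "\<forall>x\<in>carrier L. h (f x) = k x"
      using fac[OF kh(1,3)] by blast
    have "k = ?T (restrict h (carrier E))"
      using h(2) kh(2) module_hom_in[OF fh] by (auto simp: fun_eq_iff extensional_def)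
    moreover have "restrict h (carrier E) \<in> carrier (hom_space A E M)"
      using E.module_hom_restrict[OF h(1)] by simp
    ultimately show "k \<in> ?T ` carrier (hom_space A E M)" by blast
  qed
  have ker: "{h \<in> carrier (hom_space A E M). ?T h = \<zero>\<^bsub>hom_space A L M\<^esub>} = ?G ` carrier (hom_space A N M)"
  proof (intro equalityI subsetI)
    fix h assume "h \<in> {h \<in> carrier (hom_space A E M). ?T h = \<zero>\<^bsub>hom_space A L M\<^esub>}"
    then have h: "h \<in> module_hom A E M" "h \<in> extensional (carrier E)"
      and 0: "?T h = (\<lambda>x\<in>carrier L. \<zero>\<^bsub>M\<^esub>)" by auto
    have hf: "h (f x) = \<zero>\<^bsub>M\<^esub>" if "x \<in> carrier L" for x using fun_cong[OF 0, of x] that by simp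
    \<comment> \<open>A map that vanishes on the image of \<open>f\<close> vanishes on the kernel of
      \<open>g\<close>, and therefore factors through \<open>g\<close>.\<close>
    have "h y = \<zero>\<^bsub>M\<^esub>" if "y \<in> carrier E" "g y = \<zero>\<^bsub>N\<^esub>" for y
    proof -
      have "y \<in> f ` carrier L" using that unfolding exact by simp
      then show ?thesis using hf by (elim imageE) simp
    qed
    then obtain k where k: "k \<in> module_hom A N M" "\<forall>y\<in>carrier E. k (g y) = h y"
      using factor_through_surj[OF E NN MM g h(1)] by blast
    have "h = ?G (restrict k (carrier N))"
      using k(2) h(2) module_hom_in[OF g(1)] by (auto simp: fun_eq_iff extensional_def)
    moreover have "restrict k (carrier N) \<in> carrier (hom_space A N M)"
      using N.module_hom_restrict[OF k(1)] by simp
    ultimately show "h \<in> ?G ` carrier (hom_space A N M)" by blast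
  next
    fix h assume "h \<in> ?G ` carrier (hom_space A N M)"
    then obtain k where k: "k \<in> carrier (hom_space A N M)" "h = ?G k" by blast
    interpret k: left_module_hom A N M k by (rule left_module_homI[OF NN MM]) (use k in simp)
    have "h \<in> carrier (hom_space A E M)" unfolding k(2) by (rule G.T_im[OF k(1)])
    moreover have "?T h = \<zero>\<^bsub>hom_space A L M\<^esub>"
    proof
      fix x
      have "f x \<in> {y \<in> carrier E. g y = \<zero>\<^bsub>N\<^esub>}" if "x \<in> carrier L"
        using that unfolding exact[symmetric] by (rule imageI)
      then have "f x \<in> carrier E" "g (f x) = \<zero>\<^bsub>N\<^esub>" if "x \<in> carrier L" using that by auto
      then show "?T h x = \<zero>\<^bsub>hom_space A L M\<^esub> x" by (simp add: k(2))
    qed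
    ultimately show "h \<in> {h \<in> carrier (hom_space A E M). ?T h = \<zero>\<^bsub>hom_space A L M\<^esub>}" by blast
  qed
  have "inj_on ?G (carrier (hom_space A N M))"
  proof (rule inj_onI)
    fix k l assume k: "k \<in> carrier (hom_space A N M)" and l: "l \<in> carrier (hom_space A N M)"
      and eq: "?G k = ?G l"
    have "k y = l y" if y: "y \<in> carrier N" for y
    proof -
      have "y \<in> g ` carrier E" using y unfolding g(2) .
      then obtain x where "x \<in> carrier E" "y = g x" by (rule imageE)
      then show ?thesis using fun_cong[OF eq, of x] by simp
    qed
    moreover have "k \<in> extensional (carrier N)" "l \<in> extensional (carrier N)" using k l by simp_all
    ultimately show "k = l" by (intro extensionalityI[of k "carrier N" l])
  qed
  then have "vectorspace.dim K ((hom_space A N M)\<lparr>carrier :=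
      {h \<in> carrier (hom_space A N M). ?G h = \<zero>\<^bsub>hom_space A E M\<^esub>}\<rparr>) = 0"
    using G.inj_imp_dim_ker0 by (simp add: G.ker_def)
  then have "vectorspace.dim K (hom_space A N M) =
      vectorspace.dim K ((hom_space A E M)\<lparr>carrier := ?G ` carrier (hom_space A N M)\<rparr>)"
    using G.rank_nullity'[OF hom_space_fin_dim[OF N M]] by simp
  moreover have "vectorspace.dim K (hom_space A E M) =
      vectorspace.dim K ((hom_space A L M)\<lparr>carrier := radical A L M\<rparr>) +
      vectorspace.dim K ((hom_space A E M)\<lparr>carrier := ?G ` carrier (hom_space A N M)\<rparr>)"
    using T.rank_nullity'[OF fd] unfolding im ker .
  ultimately show ?thesis unfolding hom_dim_def by simp
qed

end

theorem theorem3p4: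
  fixes K :: "'k ring" and A :: "('k, 'a) module"
    and \<L> :: "('a, 'm) module set" and M L :: "('a, 'm) module"
    and J :: "('a, 'm) module set" and a :: "('a, 'm) module \<Rightarrow> nat" and \<tau>L :: "('a, 'm) module"
  assumes "algebraically_closed K"
    and "fd_algebra K A"
    and "complete_indecomposables K A \<L>"
    and "fd_module K A M"
    and "fd_module K A L" and "indecomposable A L"
    and "ar_data K A \<L> L J a \<tau>L"
  shows "int (multiplicity_in A \<L> M L) =
           int (hom_dim K A L M) - (\<Sum>Y\<in>J. int (a Y) * int (hom_dim K A Y M))
             + int (hom_dim K A \<tau>L M)"
proof -
  interpret alg_closed_modules K A
    using assms(1,2) by (simp add: alg_closed_modules_def fd_modules_def)
  note \<L> = assms(3) and M = assms(4) and L = assms(5,6)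
  let ?E = "multiple_dsum J a" and ?I = "SIGMA Y:J. {..<a Y}"
  have J: "finite J" "J \<subseteq> \<L>" and N: "fd_module K A \<tau>L"
    and ar: "if injective_module K A L
      then module_iso A (quotient_module L (socle A L)) ?E \<and> carrier \<tau>L = {\<zero>\<^bsub>\<tau>L\<^esub>}
      else \<exists>f g. almost_split_sequence K A L ?E \<tau>L f g"
    using assms(7) unfolding ar_data_def by blast+
  have JF: "fd_module K A Y" if "Y \<in> J" for Y
    using complete_indecomposablesD(1)[OF \<L>] J(2) that by blast
  obtain e p where dec: "decomposition A ?E ?I fst e p"
    using multiple_dsum_decomposition[of J a] fd_moduleD(1)[OF JF] by blast
  have E: "left_module A ?E" using dec by (simp add: decomposition_def)
  have finI: "finite ?I" using J(1) by blast
  have IF: "fd_module K A (fst i)" if "i \<in> ?I" for i using JF that by auto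
  note homE = hom_dim_decomposition[OF dec finI IF M]
  have "hom_dim K A ?E M = (\<Sum>i\<in>?I. hom_dim K A (fst i) M)" by (rule homE(2))
  \<comment> \<open>The summand depends only on the first component of the index, so
    \<open>a Y\<close> copies contribute \<open>a Y\<close> equal terms.\<close>
  also have "\<dots> = (\<Sum>Y\<in>J. \<Sum>i<a Y. hom_dim K A Y M)"
    using sum.Sigma[of J "\<lambda>Y. {..<a Y}" "\<lambda>Y i. hom_dim K A Y M"] J(1)
    by (simp add: case_prod_beta)
  finally have dimE: "hom_dim K A ?E M = (\<Sum>Y\<in>J. a Y * hom_dim K A Y M)" by simp
  \<comment> \<open>Both branches of \<open>ar_data\<close> are brought to the same form: a left
    almost split map followed by a surjection onto \<open>\<tau>L\<close> with kernel its
    image.\<close>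
  obtain f g where fg: "left_almost_split K A L ?E f" "g \<in> module_hom A ?E \<tau>L"
    "g ` carrier ?E = carrier \<tau>L" "f ` carrier L = {y \<in> carrier ?E. g y = \<zero>\<^bsub>\<tau>L\<^esub>}"
  proof (cases "injective_module K A L")
    case True
    then obtain f where f: "f \<in> module_hom A L ?E" "f ` carrier L = carrier ?E"
      "left_almost_split K A L ?E f"
      using injective_quotient_left_almost_split[OF L True E] ar by auto
    have N0: "carrier \<tau>L = {\<zero>\<^bsub>\<tau>L\<^esub>}" using ar True by simp
    interpret E: left_module A ?E by (rule E)
    show thesis
    \<comment> \<open>Here \<open>\<tau>L\<close> is zero, so the zero map is surjective; its kernel
      is all of the middle term, which is the image of the surjective \<open>f\<close>.\<close>
    proof (rule that[OF f(3) module_hom_zero_map[OF fd_moduleD(1)[OF N]]])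
      show "(\<lambda>x. \<zero>\<^bsub>\<tau>L\<^esub>) ` carrier ?E = carrier \<tau>L"
        using N0 E.M.zero_closed by blast
    qed (use f in simp)
  next
    case False
    then obtain f g where "almost_split_sequence K A L ?E \<tau>L f g" using ar by auto
    then show thesis
      using that unfolding almost_split_sequence_def short_exact_def by blast
  qed
  have "hom_dim K A ?E M = hom_dim K A \<tau>L M
    + vectorspace.dim K ((hom_space A L M)\<lparr>carrier := radical A L M\<rparr>)"
    by (rule hom_dim_left_almost_split[OF L(1) M N E homE(1) fg])
  \<comment> \<open>The dimension of the radical is the common term of this equation and the
    previous one; eliminating it gives the formula.\<close>
  moreover have "hom_dim K A L M = vectorspace.dim K ((hom_space A L M)\<lparr>carrier := radical A L M\<rparr>)
    + multiplicity_in A \<L> M L"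
    unfolding multiplicity_in_def
    by (rule multiplicity_from_radical[OF \<L> L M decomposition_vector_props[OF \<L> M]])
  moreover have "(\<Sum>Y\<in>J. int (a Y) * int (hom_dim K A Y M)) = int (\<Sum>Y\<in>J. a Y * hom_dim K A Y M)"
    by simp
  ultimately show ?thesis unfolding dimE by linarith
qed

end
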